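(* Let $k$ be an algebraically closed field of characteristic zero and let $H$ be a finite dimensional cosemisimple Hopf algebra over $k$. If $H$ acts inner faithfully on a commutative domain $A$ over $k$, then $H$ is a finite group algebra, i.e. $H\cong kG$ as Hopf algebras for some finite group $G$.
   Context: A Hopf algebra $H$ (with comultiplication $\Delta$ and counit $\epsilon$) acts on a $k$-algebra $A$ if $A$ is a left $H$-module such that $h\cdot(ab)=\sum (h_1\cdot a)(h_2\cdot b)$ and $h\cdot 1_A=\epsilon(h)1_A$ for all $h\in H$, $a,b\in A$, where $\Delta(h)=\sum h_1\otimes h_2$. The action is inner faithful if $IA\neq 0$ for every nonzero Hopf ideal $I$ of $H$. (Over a field of characteristic zero, semisimplicity and cosemisimplicity of a finite dimensional Hopf algebra are equivalent.) *)

theory Defs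
  imports
    "HOL-Algebra.Group"
    "HOL-Library.Poly_Mapping"
    "HOL-Computational_Algebra.Polynomial"
begin

section \<open>Tensor powers of a vector space\<close>

text \<open>
  The free vector space on a type is the type of finitely supported functions. The tensor
  powers of a vector space \<open>C\<close> (a subspace of a type, with scalar multiplication \<open>s\<close>) are
  quotients of free vector spaces by the multilinearity relations, and their elements are cosets.
\<close>

definition free_scale :: "'k::field \<Rightarrow> ('b \<Rightarrow>\<^sub>0 'k) \<Rightarrow> ('b \<Rightarrow>\<^sub>0 'k)"
  where "free_scale c p = Poly_Mapping.map ((*) c) p"

text \<open>The linear extension to the free vector space of a function \<open>f\<close> given on the basis.\<close>

definition lin_ext ::
    "('k::field \<Rightarrow> 'u \<Rightarrow> 'u) \<Rightarrow> ('b \<Rightarrow> 'u::ab_group_add) \<Rightarrow> ('b \<Rightarrow>\<^sub>0 'k) \<Rightarrow> 'u"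
  where "lin_ext s f p = (\<Sum>b\<in>Poly_Mapping.keys p. s (Poly_Mapping.lookup p b) (f b))"

text \<open>Linearity relations in one tensor slot; \<open>i\<close> puts a vector into the slot and keeps the
  other slots fixed.\<close>

definition slot_relations ::
    "('k::field \<Rightarrow> 'v \<Rightarrow> 'v) \<Rightarrow> 'v::ab_group_add set \<Rightarrow> ('v \<Rightarrow> 'b) \<Rightarrow> ('b \<Rightarrow>\<^sub>0 'k) set"
  where "slot_relations s C i =
    {Poly_Mapping.single (i (x + y)) 1 - Poly_Mapping.single (i x) 1 - Poly_Mapping.single (i y) 1
      | x y. x \<in> C \<and> y \<in> C} \<union>
    {Poly_Mapping.single (i (s c x)) 1 - Poly_Mapping.single (i x) c | c x. x \<in> C}"

definition tensor2_relations ::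
    "('k::field \<Rightarrow> 'v \<Rightarrow> 'v) \<Rightarrow> 'v::ab_group_add set \<Rightarrow> (('v \<times> 'v) \<Rightarrow>\<^sub>0 'k) set"
  where "tensor2_relations s C = module.span free_scale
    (\<Union>y\<in>C. slot_relations s C (\<lambda>x. (x, y)) \<union> slot_relations s C (\<lambda>x. (y, x)))"

definition tensor3_relations ::
    "('k::field \<Rightarrow> 'v \<Rightarrow> 'v) \<Rightarrow> 'v::ab_group_add set \<Rightarrow> (('v \<times> 'v \<times> 'v) \<Rightarrow>\<^sub>0 'k) set"
  where "tensor3_relations s C = module.span free_scale
    (\<Union>y\<in>C. \<Union>z\<in>C. slot_relations s C (\<lambda>x. (x, y, z)) \<union>
      slot_relations s C (\<lambda>x. (y, x, z)) \<union> slot_relations s C (\<lambda>x. (y, z, x)))"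

definition tensor2_class ::
    "('k::field \<Rightarrow> 'v \<Rightarrow> 'v) \<Rightarrow> 'v::ab_group_add set \<Rightarrow> (('v \<times> 'v) \<Rightarrow>\<^sub>0 'k) \<Rightarrow> (('v \<times> 'v) \<Rightarrow>\<^sub>0 'k) set"
  where "tensor2_class s C p = {q. q - p \<in> tensor2_relations s C}"

definition tensor3_class ::
    "('k::field \<Rightarrow> 'v \<Rightarrow> 'v) \<Rightarrow> 'v::ab_group_add set \<Rightarrow>
      (('v \<times> 'v \<times> 'v) \<Rightarrow>\<^sub>0 'k) \<Rightarrow> (('v \<times> 'v \<times> 'v) \<Rightarrow>\<^sub>0 'k) set"
  where "tensor3_class s C p = {q. q - p \<in> tensor3_relations s C}"

definition tensor2_space ::
    "('k::field \<Rightarrow> 'v \<Rightarrow> 'v) \<Rightarrow> 'v::ab_group_add set \<Rightarrow> (('v \<times> 'v) \<Rightarrow>\<^sub>0 'k) set set"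
  where "tensor2_space s C = tensor2_class s C ` {p. Poly_Mapping.keys p \<subseteq> C \<times> C}"


section \<open>Hopf algebras\<close>

text \<open>
  The fields of \<open>monoid\<close> hold the carrier, the multiplication and the unit; addition is that of
  the type, of which the carrier is a subspace.
\<close>

record (overloaded) ('k, 'h) hopf = "'h monoid" +
  vscale :: "'k \<Rightarrow> 'h \<Rightarrow> 'h"
  comult :: "'h \<Rightarrow> (('h \<times> 'h) \<Rightarrow>\<^sub>0 'k) set"
  counit :: "'h \<Rightarrow> 'k"
  antipode :: "'h \<Rightarrow> 'h"

text \<open>
  Sweedler notation: the value \<open>sweedler H x\<close> is a formal sum of pairs \<open>(x\<^sub>1, x\<^sub>2)\<close> representing the
  comultiplication of \<open>x\<close>. Each use below is multilinear in the components, hence independent of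
  the representative chosen.
\<close>

definition sweedler :: "('k::field, 'h) hopf \<Rightarrow> 'h \<Rightarrow> (('h \<times> 'h) \<Rightarrow>\<^sub>0 'k)"
  where "sweedler H x = (SOME p. p \<in> comult H x)"

text \<open>The product of \<open>H \<otimes> H\<close> on formal sums: \<open>(a \<otimes> b)(c \<otimes> d) = ac \<otimes> bd\<close>.\<close>

definition tensor2_mult ::
    "('k::field, 'h) hopf \<Rightarrow> (('h \<times> 'h) \<Rightarrow>\<^sub>0 'k) \<Rightarrow> (('h \<times> 'h) \<Rightarrow>\<^sub>0 'k) \<Rightarrow> (('h \<times> 'h) \<Rightarrow>\<^sub>0 'k)"
  where "tensor2_mult H p q =
    lin_ext free_scale (\<lambda>(a, b). lin_ext free_scale
      (\<lambda>(c, d). Poly_Mapping.single (a \<otimes>\<^bsub>H\<^esub> c, b \<otimes>\<^bsub>H\<^esub> d) 1) q) p"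

locale hopf_algebra = monoid H + V: vector_space "vscale H"
  for H :: "('k::field, 'h::ab_group_add) hopf" (structure) +
  assumes carrier_subspace: "V.subspace (carrier H)"
    and mult_add_left: "\<lbrakk>x \<in> carrier H; y \<in> carrier H; z \<in> carrier H\<rbrakk> \<Longrightarrow>
      (x + y) \<otimes> z = x \<otimes> z + y \<otimes> z"
    and mult_add_right: "\<lbrakk>x \<in> carrier H; y \<in> carrier H; z \<in> carrier H\<rbrakk> \<Longrightarrow>
      x \<otimes> (y + z) = x \<otimes> y + x \<otimes> z"
    and mult_scale_left: "\<lbrakk>x \<in> carrier H; y \<in> carrier H\<rbrakk> \<Longrightarrow>
      vscale H c x \<otimes> y = vscale H c (x \<otimes> y)"
    and mult_scale_right: "\<lbrakk>x \<in> carrier H; y \<in> carrier H\<rbrakk> \<Longrightarrow>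
      x \<otimes> vscale H c y = vscale H c (x \<otimes> y)"
    and comult_closed: "x \<in> carrier H \<Longrightarrow> comult H x \<in> tensor2_space (vscale H) (carrier H)"
    and comult_add: "\<lbrakk>x \<in> carrier H; y \<in> carrier H\<rbrakk> \<Longrightarrow>
      comult H (x + y) = tensor2_class (vscale H) (carrier H) (sweedler H x + sweedler H y)"
    and comult_scale: "x \<in> carrier H \<Longrightarrow>
      comult H (vscale H c x) = tensor2_class (vscale H) (carrier H) (free_scale c (sweedler H x))"
    and counit_add: "\<lbrakk>x \<in> carrier H; y \<in> carrier H\<rbrakk> \<Longrightarrow> counit H (x + y) = counit H x + counit H y"
    and counit_scale: "x \<in> carrier H \<Longrightarrow> counit H (vscale H c x) = c * counit H x"
    and coassoc: "x \<in> carrier H \<Longrightarrow>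
      tensor3_class (vscale H) (carrier H)
        (lin_ext free_scale (\<lambda>(a, b). lin_ext free_scale
          (\<lambda>(a1, a2). Poly_Mapping.single (a1, a2, b) 1) (sweedler H a)) (sweedler H x)) =
      tensor3_class (vscale H) (carrier H)
        (lin_ext free_scale (\<lambda>(a, b). lin_ext free_scale
          (\<lambda>(b1, b2). Poly_Mapping.single (a, b1, b2) 1) (sweedler H b)) (sweedler H x))"
    and counit_left: "x \<in> carrier H \<Longrightarrow>
      lin_ext (vscale H) (\<lambda>(a, b). vscale H (counit H a) b) (sweedler H x) = x"
    and counit_right: "x \<in> carrier H \<Longrightarrow>
      lin_ext (vscale H) (\<lambda>(a, b). vscale H (counit H b) a) (sweedler H x) = x"
    and comult_mult: "\<lbrakk>x \<in> carrier H; y \<in> carrier H\<rbrakk> \<Longrightarrow>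
      comult H (x \<otimes> y) =
        tensor2_class (vscale H) (carrier H) (tensor2_mult H (sweedler H x) (sweedler H y))"
    and comult_one: "comult H \<one> =
      tensor2_class (vscale H) (carrier H) (Poly_Mapping.single (\<one>, \<one>) 1)"
    and counit_mult: "\<lbrakk>x \<in> carrier H; y \<in> carrier H\<rbrakk> \<Longrightarrow> counit H (x \<otimes> y) = counit H x * counit H y"
    and counit_one: "counit H \<one> = 1"
    and antipode_closed: "x \<in> carrier H \<Longrightarrow> antipode H x \<in> carrier H"
    and antipode_add: "\<lbrakk>x \<in> carrier H; y \<in> carrier H\<rbrakk> \<Longrightarrow>
      antipode H (x + y) = antipode H x + antipode H y"
    and antipode_scale: "x \<in> carrier H \<Longrightarrow> antipode H (vscale H c x) = vscale H c (antipode H x)"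
    and antipode_left: "x \<in> carrier H \<Longrightarrow>
      lin_ext (vscale H) (\<lambda>(a, b). antipode H a \<otimes> b) (sweedler H x) = vscale H (counit H x) \<one>"
    and antipode_right: "x \<in> carrier H \<Longrightarrow>
      lin_ext (vscale H) (\<lambda>(a, b). a \<otimes> antipode H b) (sweedler H x) = vscale H (counit H x) \<one>"

definition fin_dim :: "('k::field, 'h::ab_group_add) hopf \<Rightarrow> bool"
  where "fin_dim H \<longleftrightarrow> (\<exists>B. finite B \<and> module.span (vscale H) B = carrier H)"

definition subcoalgebra :: "('k::field, 'h::ab_group_add) hopf \<Rightarrow> 'h set \<Rightarrow> bool"
  where "subcoalgebra H D \<longleftrightarrow>
    D \<subseteq> carrier H \<and> module.subspace (vscale H) D \<and>
    (\<forall>x\<in>D. \<exists>p\<in>comult H x. Poly_Mapping.keys p \<subseteq> D \<times> D)"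

definition simple_subcoalgebra :: "('k::field, 'h::ab_group_add) hopf \<Rightarrow> 'h set \<Rightarrow> bool"
  where "simple_subcoalgebra H D \<longleftrightarrow>
    subcoalgebra H D \<and> D \<noteq> {0} \<and> (\<forall>E. subcoalgebra H E \<and> E \<subseteq> D \<longrightarrow> E = {0} \<or> E = D)"

text \<open>Cosemisimple: equal to the coradical, the sum of all simple subcoalgebras.\<close>

definition cosemisimple :: "('k::field, 'h::ab_group_add) hopf \<Rightarrow> bool"
  where "cosemisimple H \<longleftrightarrow>
    module.span (vscale H) (\<Union>{D. simple_subcoalgebra H D}) = carrier H"

text \<open>The comultiplication condition is \<open>\<Delta>(I) \<subseteq> I \<otimes> H + H \<otimes> I\<close>.\<close>

definition hopf_ideal :: "('k::field, 'h::ab_group_add) hopf \<Rightarrow> 'h set \<Rightarrow> bool"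
  where "hopf_ideal H I \<longleftrightarrow>
    I \<subseteq> carrier H \<and> module.subspace (vscale H) I \<and>
    (\<forall>x\<in>I. \<forall>h\<in>carrier H. h \<otimes>\<^bsub>H\<^esub> x \<in> I \<and> x \<otimes>\<^bsub>H\<^esub> h \<in> I) \<and>
    (\<forall>x\<in>I. \<exists>p\<in>comult H x. Poly_Mapping.keys p \<subseteq> I \<times> carrier H \<union> carrier H \<times> I) \<and>
    (\<forall>x\<in>I. counit H x = 0) \<and>
    (\<forall>x\<in>I. antipode H x \<in> I)"

definition hopf_iso ::
    "('k::field, 'h::ab_group_add) hopf \<Rightarrow> ('k, 'l::ab_group_add) hopf \<Rightarrow> ('h \<Rightarrow> 'l) set"
  where "hopf_iso H L = {\<phi>.
    bij_betw \<phi> (carrier H) (carrier L) \<and>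
    (\<forall>x\<in>carrier H. \<forall>y\<in>carrier H. \<phi> (x + y) = \<phi> x + \<phi> y) \<and>
    (\<forall>c. \<forall>x\<in>carrier H. \<phi> (vscale H c x) = vscale L c (\<phi> x)) \<and>
    (\<forall>x\<in>carrier H. \<forall>y\<in>carrier H. \<phi> (x \<otimes>\<^bsub>H\<^esub> y) = \<phi> x \<otimes>\<^bsub>L\<^esub> \<phi> y) \<and>
    \<phi> \<one>\<^bsub>H\<^esub> = \<one>\<^bsub>L\<^esub> \<and>
    (\<forall>x\<in>carrier H. comult L (\<phi> x) = tensor2_class (vscale L) (carrier L)
      (lin_ext free_scale (\<lambda>(a, b). Poly_Mapping.single (\<phi> a, \<phi> b) 1) (sweedler H x))) \<and>
    (\<forall>x\<in>carrier H. counit L (\<phi> x) = counit H x) \<and>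
    (\<forall>x\<in>carrier H. \<phi> (antipode H x) = antipode L (\<phi> x))}"

definition hopf_isomorphic ::
    "('k::field, 'h::ab_group_add) hopf \<Rightarrow> ('k, 'l::ab_group_add) hopf \<Rightarrow> bool"
  where "hopf_isomorphic H L \<longleftrightarrow> hopf_iso H L \<noteq> {}"


section \<open>Group algebras\<close>

definition group_algebra :: "('g, 'm) monoid_scheme \<Rightarrow> ('k::field, 'g \<Rightarrow>\<^sub>0 'k) hopf"
  where "group_algebra G =
   \<lparr>carrier = {p. Poly_Mapping.keys p \<subseteq> carrier G},
    monoid.mult = (\<lambda>p q. lin_ext free_scale (\<lambda>g. lin_ext free_scale
      (\<lambda>h. Poly_Mapping.single (g \<otimes>\<^bsub>G\<^esub> h) 1) q) p),
    one = Poly_Mapping.single \<one>\<^bsub>G\<^esub> 1,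
    vscale = free_scale,
    comult = (\<lambda>p. tensor2_class free_scale {p. Poly_Mapping.keys p \<subseteq> carrier G}
      (lin_ext free_scale
        (\<lambda>g. Poly_Mapping.single (Poly_Mapping.single g 1, Poly_Mapping.single g 1) 1) p)),
    counit = lin_ext (*) (\<lambda>g. 1),
    antipode = lin_ext free_scale (\<lambda>g. Poly_Mapping.single (inv\<^bsub>G\<^esub> g) 1)\<rparr>"


section \<open>Actions of Hopf algebras\<close>

locale algebra_over = vector_space sA
  for sA :: "'k::field \<Rightarrow> 'a::ring_1 \<Rightarrow> 'a" +
  assumes scale_mult_left: "sA c a * b = sA c (a * b)"
    and scale_mult_right: "a * sA c b = sA c (a * b)"

locale hopf_action = hopf_algebra H + A: algebra_over sA
  for H :: "('k::field, 'h::ab_group_add) hopf" (structure)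
    and sA :: "'k \<Rightarrow> 'a::ring_1 \<Rightarrow> 'a" +
  fixes act :: "'h \<Rightarrow> 'a \<Rightarrow> 'a"
  assumes act_add_left: "\<lbrakk>x \<in> carrier H; y \<in> carrier H\<rbrakk> \<Longrightarrow> act (x + y) a = act x a + act y a"
    and act_scale_left: "x \<in> carrier H \<Longrightarrow> act (vscale H c x) a = sA c (act x a)"
    and act_add_right: "x \<in> carrier H \<Longrightarrow> act x (a + b) = act x a + act x b"
    and act_scale_right: "x \<in> carrier H \<Longrightarrow> act x (sA c a) = sA c (act x a)"
    and act_mult: "\<lbrakk>x \<in> carrier H; y \<in> carrier H\<rbrakk> \<Longrightarrow> act (x \<otimes> y) a = act x (act y a)"
    and act_one: "act \<one> a = a"
    and act_prod: "x \<in> carrier H \<Longrightarrow>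
      act x (a * b) = lin_ext sA (\<lambda>(x1, x2). act x1 a * act x2 b) (sweedler H x)"
    and act_unit: "x \<in> carrier H \<Longrightarrow> act x 1 = sA (counit H x) 1"

text \<open>The span below is the subspace \<open>IA\<close> of \<open>A\<close>.\<close>

definition inner_faithful ::
    "('k::field, 'h::ab_group_add) hopf \<Rightarrow> ('k \<Rightarrow> 'a \<Rightarrow> 'a) \<Rightarrow> ('h \<Rightarrow> 'a::ring_1 \<Rightarrow> 'a) \<Rightarrow> bool"
  where "inner_faithful H sA act \<longleftrightarrow>
    (\<forall>I. hopf_ideal H I \<and> I \<noteq> {0} \<longrightarrow> module.span sA {act x a | x a. x \<in> I} \<noteq> {0})"

end

theory Submission
  imports
    Defs
    "HOL-Library.Function_Algebras"
    "HOL-Computational_Algebra.Computational_Algebra"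
    "HOL-Computational_Algebra.Field_as_Ring"
begin

text \<open>
  Let \<open>F\<close> be the field of fractions of \<open>A\<close>. An element \<open>a\<close> of \<open>A\<close> gives the \<open>F\<close>-valued functional
  \<open>h \<mapsto> h \<cdot> a\<close> on \<open>H\<close>, and the \<open>F\<close>-span \<open>R\<close> of these functionals is a commutative subalgebra of the
  convolution algebra \<open>K\<close> of all \<open>F\<close>-valued functionals, stable under the right translations by \<open>H\<close>.

  Larson and Radford: a cosemisimple Hopf algebra in characteristic zero has an integral \<open>\<Lambda>\<close> with
  counit 1. Indeed its dual \<open>K\<close> is von Neumann regular, and computing the trace of the squared
  antipode (of finite order) on the corners of \<open>K\<close> cut out by primitive idempotents shows that the
  counit of an integral does not vanish.

  The form \<open>(r, r') \<mapsto> (r r')(\<Lambda>)\<close> on \<open>R\<close> is invariant, and its radical is a stable ideal which, unless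
  it is 0, generates the unit ideal of \<open>K\<close>; so the form is nondegenerate by Nakayama's lemma, and \<open>R\<close>
  is a separable algebra. A derivation of \<open>F\<close> over \<open>k\<close> then induces an inner derivation \<open>R \<rightarrow> K / R\<close>,
  given by an invariant element, which has to be a scalar. Hence \<open>R\<close> is stable under all derivations
  of \<open>F\<close> over \<open>k\<close>. As \<open>k\<close> is algebraically closed of characteristic zero, \<open>R\<close> is defined over \<open>k\<close>, and
  the annihilator of \<open>A\<close> is a Hopf ideal. It vanishes by inner faithfulness, so \<open>R = K\<close> is
  commutative. Thus \<open>H\<close> is cocommutative, and the characters of its commutative semisimple dual are a
  basis of \<open>H\<close> consisting of grouplike elements.
\<close>

section \<open>Finite-dimensional spaces of functions\<close>

text \<open>Tensor classes are awkward to compute with, and \<open>sweedler\<close> is just a chosen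
  representative. So identities in tensor powers of \<open>H\<close> are tested on multilinear
  functionals: \<open>sw\<close> evaluates a bilinear one, and \<open>K\<close> separates vectors
  and tensors. The homomorphism \<iota> serves both ranges of values: the identity of
  \<open>k\<close> for the Larson-Radford part, the embedding of \<open>k\<close> into
  \<open>F\<close> for the action.

  Cosemisimplicity directly gives only an integral \<open>lam\<close> on \<open>H\<close>, while the
  action is averaged with an integral in \<open>H\<close> whose counit is not 0. That rests on
  positivity, which \<open>k\<close> lacks: a multiple of the trace is a sum of roots of unity, so
  arranged that its complex counterpart is a sum of squared moduli, one of them equal to 1.

  The annihilator \<open>I\<close> of \<open>A\<close> is a coideal if the functionals over
  \<open>k\<close> that vanish on it are closed under products. For \<open>R\<close> this closure is
  known, but over \<open>F\<close>. So an echelon basis of \<open>R\<close>, with pivot values 0 and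
  1, is shown to take values in \<open>k\<close>. Derivations detect this: every element of
  \<open>F\<close> outside \<open>k\<close> has a nonzero image under some derivation over
  \<open>k\<close>, and all of them kill the pivot values.\<close>

definition fsc :: "'f::field \<Rightarrow> ('x \<Rightarrow> 'f) \<Rightarrow> 'x \<Rightarrow> 'f"
  where "fsc c \<phi> = (\<lambda>x. c * \<phi> x)"

lemma fsc_apply [simp]: "fsc c \<phi> x = c * \<phi> x"
  by (simp add: fsc_def)

interpretation fv: vector_space "fsc :: 'f::field \<Rightarrow> ('x \<Rightarrow> 'f) \<Rightarrow> 'x \<Rightarrow> 'f"
  by unfold_locales (auto simp: fun_eq_iff algebra_simps)

lemma sum_fun_apply [simp]: "(\<Sum>i\<in>I. f i) x = (\<Sum>i\<in>I. f i x)"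
  by (induction I rule: infinite_finite_induct) auto

text \<open>A space of functions \<open>W\<close> with a basis \<open>w\<close> dual to the evaluations at the points of \<open>T\<close>.\<close>

definition interp :: "('x \<Rightarrow> 'f::field) set \<Rightarrow> 'x set \<Rightarrow> ('x \<Rightarrow> 'x \<Rightarrow> 'f) \<Rightarrow> bool"
  where "interp W T w \<longleftrightarrow> finite T \<and> (\<forall>t\<in>T. w t \<in> W \<and> (\<forall>t'\<in>T. w t t' = (if t = t' then 1 else 0)))
    \<and> (\<forall>\<phi>\<in>W. \<forall>x. \<phi> x = (\<Sum>t\<in>T. \<phi> t * w t x))"

lemma interpD:
  assumes "interp W T w"
  shows "finite T" "t \<in> T \<Longrightarrow> w t \<in> W" "t \<in> T \<Longrightarrow> t' \<in> T \<Longrightarrow> w t t' = (if t = t' then 1 else 0)"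
    "\<phi> \<in> W \<Longrightarrow> \<phi> x = (\<Sum>t\<in>T. \<phi> t * w t x)"
  using assms by (auto simp: interp_def)

lemma interp_expand: "interp W T w \<Longrightarrow> \<phi> \<in> W \<Longrightarrow> \<phi> = (\<Sum>t\<in>T. fsc (\<phi> t) (w t))"
  using interpD(4) by (fastforce simp: fun_eq_iff)

text \<open>Gaussian elimination to reduced echelon form: each new generator is cleared at the old
  pivots, and if something is left, a point where it does not vanish becomes the next pivot. Pivots
  can be confined to \<open>X\<close> because all the functions vanish outside it.\<close>

lemma ex_interp:
  assumes "finite B" "\<And>\<phi> x. \<phi> \<in> B \<Longrightarrow> x \<notin> X \<Longrightarrow> \<phi> x = 0"
  shows "\<exists>T w. T \<subseteq> X \<and> interp (fv.span B :: ('x \<Rightarrow> 'f::field) set) T w"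
  using assms
proof (induction B rule: finite_induct)
  case empty
  have "interp (fv.span {}) {} w" for w :: "'x \<Rightarrow> 'x \<Rightarrow> 'f"
    unfolding interp_def fv.span_empty by simp
  then show ?case by blast
next
  case (insert g B)
  then obtain T w where T: "T \<subseteq> X" and I: "interp (fv.span B) T w"
    by blast
  note D = interpD[OF I]
  define g' where "g' = g - (\<Sum>t\<in>T. fsc (g t) (w t))"
  have s: "(\<Sum>t\<in>T. fsc (g t) (w t)) \<in> fv.span B"
    by (intro fv.span_sum fv.span_scale D)
  have g't: "g' t = 0" if "t \<in> T" for t
  proof -
    have "(\<Sum>t'\<in>T. g t' * w t' t) = (\<Sum>t'\<in>T. if t' = t then g t else 0)"
      using that by (intro sum.cong) (auto simp: D(3))
    also have "\<dots> = g t" using that D(1) by simp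
    finally show ?thesis unfolding g'_def minus_apply sum_fun_apply fsc_apply by (simp only: diff_self)
  qed
  have sub: "fv.span B \<subseteq> fv.span (insert g B)"
    by (rule fv.span_mono) (rule subset_insertI)
  show ?case
  proof (cases "\<forall>x. g' x = 0")
    case True
    then have "g' = 0" by (simp add: fun_eq_iff)
    then have "g = (\<Sum>t\<in>T. fsc (g t) (w t))"
      unfolding g'_def by (simp only: right_minus_eq)
    then have "g \<in> fv.span B" using s by simp
    then have "fv.span (insert g B) = fv.span B" by (rule fv.span_redundant)
    then show ?thesis using T I by metis
  next
    case False
    then obtain x where x: "g' x \<noteq> 0" by blast
    have gX: "g' y = 0" if "y \<notin> X" for y
    proof -
      have "w t y = 0" if "t \<in> T" for t
      proof -
        have "fv.span B \<subseteq> {\<phi>. \<phi> y = 0}"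
          using insert.prems \<open>y \<notin> X\<close> by (intro fv.span_minimal) (auto simp: fv.subspace_def)
        then show ?thesis using D(2)[OF that] by auto
      qed
      then show ?thesis using insert.prems[of g y] that by (simp add: g'_def)
    qed
    have xT: "x \<notin> T" using g't x by blast
    have xX: "x \<in> X" using gX x by blast
    \<comment> \<open>The new row is scaled to 1 at the pivot \<open>x\<close>, and that column is
      cleared from the old rows.\<close>
    define w' where "w' t = (if t = x then fsc (1 / g' x) g' else w t - fsc (w t x / g' x) g')" for t
    have gin: "g' \<in> fv.span (insert g B)"
      unfolding g'_def using s sub by (intro fv.span_diff) (auto intro: fv.span_base)
    have w'in: "w' t \<in> fv.span (insert g B)" if "t \<in> insert x T" for t
      using that gin D(2) sub xT by (auto simp: w'_def intro!: fv.span_scale fv.span_diff)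
    have w'd: "w' t t' = (if t = t' then 1 else 0)" if "t \<in> insert x T" "t' \<in> insert x T" for t t'
      using that xT x D(3) g't by (auto simp: w'_def)
    define P where "P \<phi> \<longleftrightarrow> (\<forall>y. \<phi> y = (\<Sum>t\<in>insert x T. \<phi> t * w' t y))" for \<phi>
    have sw: "(\<Sum>t\<in>T. \<phi> t * w' t y) = (\<Sum>t\<in>T. \<phi> t * w t y) - (\<Sum>t\<in>T. \<phi> t * w t x) * g' y / g' x" for \<phi> y
    proof -
      have "(\<Sum>t\<in>T. \<phi> t * w' t y) = (\<Sum>t\<in>T. \<phi> t * w t y - \<phi> t * w t x * g' y / g' x)"
        using xT by (intro sum.cong) (auto simp: w'_def algebra_simps)
      then show ?thesis by (simp add: sum_subtractf sum_distrib_right sum_divide_distrib)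
    qed
    have ins: "(\<Sum>t\<in>insert x T. \<phi> t * w' t y) = \<phi> x * (g' y / g' x) + (\<Sum>t\<in>T. \<phi> t * w' t y)" for \<phi> y
      using xT D(1) by (simp add: w'_def)
    have Pg: "P g'"
      unfolding P_def ins
    proof
      fix y
      have "(\<Sum>t\<in>T. g' t * w' t y) = 0" using g't by (intro sum.neutral) simp
      then show "g' y = g' x * (g' y / g' x) + (\<Sum>t\<in>T. g' t * w' t y)" using x by simp
    qed
    have PB: "P \<psi>" if "\<psi> \<in> fv.span B" for \<psi>
      unfolding P_def ins sw D(4)[OF that, symmetric] by simp
    have Padd: "P (\<phi> + \<psi>)" if "P \<phi>" "P \<psi>" for \<phi> \<psi>
      unfolding P_def
    proof
      fix y
      show "(\<phi> + \<psi>) y = (\<Sum>t\<in>insert x T. (\<phi> + \<psi>) t * w' t y)"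
        using that[unfolded P_def, rule_format, of y] by (simp only: plus_fun_apply distrib_right sum.distrib)
    qed
    have Psc: "P (fsc c \<phi>)" if "P \<phi>" for \<phi> c
      unfolding P_def
    proof
      fix y
      show "fsc c \<phi> y = (\<Sum>t\<in>insert x T. fsc c \<phi> t * w' t y)"
        using that[unfolded P_def, rule_format, of y] by (simp only: fsc_apply sum_distrib_left mult.assoc)
    qed
    have "P \<phi>" if "\<phi> \<in> fv.span (insert g B)" for \<phi>
    proof -
      from that obtain k where "\<phi> - fsc k g \<in> fv.span B"
        by (auto simp: fv.span_breakdown_eq)
      moreover have "\<phi> = fsc k g' + ((\<phi> - fsc k g) + fsc k (\<Sum>t\<in>T. fsc (g t) (w t)))"
        by (simp add: g'_def fv.scale_right_diff_distrib)
      ultimately show ?thesis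
        using s by (metis Padd Psc Pg PB fv.span_add fv.span_scale)
    qed
    then have "interp (fv.span (insert g B)) (insert x T) w'"
      using w'in w'd D(1) by (auto simp: interp_def P_def)
    then show ?thesis using T xX by blast
  qed
qed

section \<open>Field homomorphisms and formal sums\<close>

interpretation fr: vector_space "free_scale :: 'k::field \<Rightarrow> ('b \<Rightarrow>\<^sub>0 'k) \<Rightarrow> _"
proof -
  have l: "Poly_Mapping.lookup (free_scale c p) b = c * Poly_Mapping.lookup p b" for c :: 'k and p :: "'b \<Rightarrow>\<^sub>0 'k" and b
    by (simp add: free_scale_def Poly_Mapping.map.rep_eq when_def)
  show "vector_space (free_scale :: 'k \<Rightarrow> ('b \<Rightarrow>\<^sub>0 'k) \<Rightarrow> _)"
    by unfold_locales (auto intro!: poly_mapping_eqI simp: l Poly_Mapping.lookup_add algebra_simps)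
qed

lemma lookup_free_scale [simp]: "Poly_Mapping.lookup (free_scale c p) b = c * Poly_Mapping.lookup p b"
  by (simp add: free_scale_def Poly_Mapping.map.rep_eq when_def)

locale field_hom =
  fixes \<iota> :: "'k::field \<Rightarrow> 'f::field"
  assumes hom_add: "\<iota> (a + b) = \<iota> a + \<iota> b"
    and hom_mult: "\<iota> (a * b) = \<iota> a * \<iota> b"
    and hom_one: "\<iota> 1 = 1"
begin

lemma hom_zero: "\<iota> 0 = 0"
  using hom_add[of 0 0] by (metis add_cancel_right_left)

lemma hom_minus: "\<iota> (- a) = - \<iota> a"
  using hom_add[of a "- a"] by (simp add: eq_neg_iff_add_eq_0 add.commute hom_zero)

lemma hom_diff: "\<iota> (a - b) = \<iota> a - \<iota> b"
  using hom_add[of a "- b"] by (simp add: hom_minus)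

lemma hom_sum: "\<iota> (\<Sum>i\<in>I. f i) = (\<Sum>i\<in>I. \<iota> (f i))"
  by (induction I rule: infinite_finite_induct) (auto simp: hom_add hom_zero)

lemma hom_eq_0: "\<iota> a = 0 \<longleftrightarrow> a = 0"
proof
  assume "\<iota> a = 0"
  show "a = 0"
  proof (rule ccontr)
    assume "a \<noteq> 0"
    then have "\<iota> 1 = \<iota> a * \<iota> (inverse a)" by (simp flip: hom_mult)
    with \<open>\<iota> a = 0\<close> show False by (simp add: hom_one)
  qed
qed (simp add: hom_zero)

lemma hom_inj: "\<iota> a = \<iota> b \<longleftrightarrow> a = b"
  using hom_eq_0[of "a - b"] by (simp add: hom_diff)

text \<open>The counterpart of \<open>lin_ext\<close> with values in the larger field; scalars are
  carried along \<iota>.\<close>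

definition ev :: "('b \<Rightarrow> 'f) \<Rightarrow> ('b \<Rightarrow>\<^sub>0 'k) \<Rightarrow> 'f"
  where "ev g p = (\<Sum>b\<in>Poly_Mapping.keys p. \<iota> (Poly_Mapping.lookup p b) * g b)"

lemma ev_superset: "finite S \<Longrightarrow> Poly_Mapping.keys p \<subseteq> S \<Longrightarrow> ev g p = (\<Sum>b\<in>S. \<iota> (Poly_Mapping.lookup p b) * g b)"
  unfolding ev_def by (rule sum.mono_neutral_left) (auto simp: in_keys_iff hom_zero)

lemma ev_0 [simp]: "ev g 0 = 0"
  by (simp add: ev_def)

lemma ev_add: "ev g (p + q) = ev g p + ev g q"
proof -
  have "Poly_Mapping.keys (p + q) \<subseteq> Poly_Mapping.keys p \<union> Poly_Mapping.keys q" by (rule keys_add)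
  then show ?thesis
    by (simp add: ev_superset[of "Poly_Mapping.keys p \<union> Poly_Mapping.keys q"] lookup_add hom_add distrib_right sum.distrib)
qed

lemma ev_scale: "ev g (free_scale c p) = \<iota> c * ev g p"
proof -
  have "Poly_Mapping.keys (free_scale c p) \<subseteq> Poly_Mapping.keys p" by (auto simp: in_keys_iff)
  then show ?thesis
    by (simp add: ev_superset[of "Poly_Mapping.keys p"] hom_mult sum_distrib_left mult.assoc)
qed

lemma ev_diff: "ev g (p - q) = ev g p - ev g q"
  using ev_add[of g "p - q" q] by simp

lemma ev_single [simp]: "ev g (Poly_Mapping.single b c) = \<iota> c * g b"
  by (simp add: ev_superset[of "{b}"])

lemma ev_sum: "ev g (\<Sum>i\<in>I. p i) = (\<Sum>i\<in>I. ev g (p i))"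
  by (induction I rule: infinite_finite_induct) (auto simp: ev_add)

lemma ev_lin_ext: "ev g (lin_ext free_scale G p) = ev (\<lambda>b. ev g (G b)) p"
  by (simp add: lin_ext_def ev_sum ev_scale ev_def[of _ p])

lemma ev_cong: "(\<And>b. b \<in> Poly_Mapping.keys p \<Longrightarrow> g b = g' b) \<Longrightarrow> ev g p = ev g' p"
  by (simp add: ev_def)

lemma ev_span:
  assumes "q \<in> fr.span R" "\<And>r. r \<in> R \<Longrightarrow> ev g r = 0"
  shows "ev g q = 0"
proof -
  have "fr.span R \<subseteq> {q. ev g q = 0}"
    using assms(2) by (intro fr.span_minimal) (auto simp: fr.subspace_def ev_add ev_scale)
  then show ?thesis using assms(1) by auto
qed

end

section \<open>Field-valued Sweedler sums\<close>

locale hopf_ext = hopf_algebra H + field_hom \<iota>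
  for H :: "('k::field, 'h::ab_group_add) hopf" (structure) and \<iota> :: "'k \<Rightarrow> 'f::field"
begin

abbreviation "C \<equiv> carrier H"
abbreviation "s \<equiv> vscale H"

lemma C_zero [simp]: "0 \<in> C"
  and C_add [simp]: "x \<in> C \<Longrightarrow> y \<in> C \<Longrightarrow> x + y \<in> C"
  and C_scale [simp]: "x \<in> C \<Longrightarrow> s c x \<in> C"
  and C_diff [simp]: "x \<in> C \<Longrightarrow> y \<in> C \<Longrightarrow> x - y \<in> C"
  and C_minus [simp]: "x \<in> C \<Longrightarrow> - x \<in> C"
  using carrier_subspace
  by (auto simp: V.subspace_0 V.subspace_add V.subspace_scale V.subspace_diff V.subspace_neg)

lemma C_sum [simp]: "(\<And>i. i \<in> I \<Longrightarrow> f i \<in> C) \<Longrightarrow> (\<Sum>i\<in>I. f i) \<in> C"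
  using carrier_subspace by (rule V.subspace_sum)

lemma C_mult [simp]: "x \<in> C \<Longrightarrow> y \<in> C \<Longrightarrow> x \<otimes> y \<in> C"
  and C_one [simp]: "\<one> \<in> C" and C_antipode [simp]: "x \<in> C \<Longrightarrow> antipode H x \<in> C"
  by (auto simp: antipode_closed)

definition lin :: "('h \<Rightarrow> 'f) \<Rightarrow> bool"
  where "lin \<phi> \<longleftrightarrow> (\<forall>x\<in>C. \<forall>y\<in>C. \<phi> (x + y) = \<phi> x + \<phi> y) \<and> (\<forall>c. \<forall>x\<in>C. \<phi> (s c x) = \<iota> c * \<phi> x)"

definition blin :: "('h \<Rightarrow> 'h \<Rightarrow> 'f) \<Rightarrow> bool"
  where "blin f \<longleftrightarrow> (\<forall>a\<in>C. lin (f a)) \<and> (\<forall>b\<in>C. lin (\<lambda>a. f a b))"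

definition tlin :: "('h \<Rightarrow> 'h \<Rightarrow> 'h \<Rightarrow> 'f) \<Rightarrow> bool"
  where "tlin f \<longleftrightarrow> (\<forall>a\<in>C. blin (f a)) \<and> (\<forall>b\<in>C. \<forall>c\<in>C. lin (\<lambda>a. f a b c))"

lemma lin_add: "lin \<phi> \<Longrightarrow> x \<in> C \<Longrightarrow> y \<in> C \<Longrightarrow> \<phi> (x + y) = \<phi> x + \<phi> y"
  and lin_scale: "lin \<phi> \<Longrightarrow> x \<in> C \<Longrightarrow> \<phi> (s c x) = \<iota> c * \<phi> x"
  by (auto simp: lin_def)

lemma lin_zero: "lin \<phi> \<Longrightarrow> \<phi> 0 = 0"
  using lin_add[of \<phi> 0 0] by (metis C_zero add_cancel_right_left)

lemma lin_diff: "lin \<phi> \<Longrightarrow> x \<in> C \<Longrightarrow> y \<in> C \<Longrightarrow> \<phi> (x - y) = \<phi> x - \<phi> y"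
  using lin_add[of \<phi> "x - y" y] by simp

lemma lin_sum: "lin \<phi> \<Longrightarrow> (\<And>i. i \<in> I \<Longrightarrow> f i \<in> C) \<Longrightarrow> \<phi> (\<Sum>i\<in>I. f i) = (\<Sum>i\<in>I. \<phi> (f i))"
  by (induction I rule: infinite_finite_induct) (auto simp: lin_add lin_zero)

lemma slot_kill:
  assumes "r \<in> slot_relations s C i" "lin (\<lambda>x. g (i x))"
  shows "ev g r = 0"
  using assms lin_add[OF assms(2)] lin_scale[OF assms(2)]
  by (auto simp: slot_relations_def ev_diff hom_one)

text \<open>A bilinear map kills the generators of the relations in each slot, so its value depends
  only on the class of the formal sum.\<close>

lemma ev_tensor2:
  assumes "q - p \<in> tensor2_relations s C" "blin f"
  shows "ev (\<lambda>(a, b). f a b) q = ev (\<lambda>(a, b). f a b) p"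
proof -
  have "ev (\<lambda>(a, b). f a b) (q - p) = 0"
    using assms(1) unfolding tensor2_relations_def
    by (rule ev_span) (use assms(2) in \<open>auto simp: blin_def intro: slot_kill\<close>)
  then show ?thesis by (simp add: ev_diff)
qed

lemma ev_tensor3:
  assumes "q - p \<in> tensor3_relations s C" "tlin f"
  shows "ev (\<lambda>(a, b, c). f a b c) q = ev (\<lambda>(a, b, c). f a b c) p"
proof -
  have "ev (\<lambda>(a, b, c). f a b c) (q - p) = 0"
    using assms(1) unfolding tensor3_relations_def
    by (rule ev_span) (use assms(2) in \<open>auto simp: tlin_def blin_def intro: slot_kill\<close>)
  then show ?thesis by (simp add: ev_diff)
qed

lemma rel_refl: "0 \<in> tensor2_relations s C" "0 \<in> tensor3_relations s C"
  by (simp_all add: tensor2_relations_def tensor3_relations_def fr.span_zero)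

lemma class_self: "p \<in> tensor2_class s C p"
  by (simp add: tensor2_class_def rel_refl)

lemma class3_eqD:
  assumes "tensor3_class s C p = tensor3_class s C q"
  shows "p - q \<in> tensor3_relations s C"
proof -
  have "p \<in> tensor3_class s C p" by (simp add: tensor3_class_def rel_refl)
  then have "p \<in> tensor3_class s C q" unfolding assms .
  then show ?thesis by (simp add: tensor3_class_def)
qed

text \<open>The generators only involve vectors of the carrier. Hence every member of a
  comultiplication class is supported there, in particular the arbitrary choice made by
  \<open>sweedler\<close>.\<close>

lemma rel_keys: "tensor2_relations s C \<subseteq> {q. Poly_Mapping.keys q \<subseteq> C \<times> C}"
proof -
  define K where "K = {q :: ('h \<times> 'h) \<Rightarrow>\<^sub>0 'k. Poly_Mapping.keys q \<subseteq> C \<times> C}"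
  have sub: "fr.subspace K"
    unfolding fr.subspace_def
  proof (intro conjI ballI allI)
    fix p q assume "p \<in> K" "q \<in> K"
    then show "p + q \<in> K" using Poly_Mapping.keys_add[of p q] by (auto simp: K_def)
  next
    fix c and p assume "p \<in> K"
    moreover have "Poly_Mapping.keys (free_scale c p) \<subseteq> Poly_Mapping.keys p"
      by (auto simp: in_keys_iff)
    ultimately show "free_scale c p \<in> K" by (auto simp: K_def)
  qed (simp add: K_def)
  have sg: "Poly_Mapping.single (a, b) c \<in> K" if "a \<in> C" "b \<in> C" for a b c
    using that by (auto simp: K_def)
  have "tensor2_relations s C \<subseteq> K"
    unfolding tensor2_relations_def slot_relations_def
    by (rule fr.span_minimal[OF _ sub]) (auto intro!: fr.subspace_diff[OF sub] sg)
  then show ?thesis by (simp add: K_def)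
qed

lemma comult_class: "x \<in> C \<Longrightarrow> q \<in> comult H x \<Longrightarrow> comult H x = tensor2_class s C q"
  and comult_keys: "x \<in> C \<Longrightarrow> q \<in> comult H x \<Longrightarrow> Poly_Mapping.keys q \<subseteq> C \<times> C"
  and sweedler_in: "x \<in> C \<Longrightarrow> sweedler H x \<in> comult H x"
proof -
  assume x: "x \<in> C"
  then obtain p where p: "comult H x = tensor2_class s C p" "Poly_Mapping.keys p \<subseteq> C \<times> C"
    using comult_closed[OF x] by (auto simp: tensor2_space_def)
  show "sweedler H x \<in> comult H x"
    unfolding sweedler_def by (rule someI[of _ p]) (simp add: p class_self)
  have sb: "fr.subspace (tensor2_relations s C)"
    by (simp add: tensor2_relations_def)
  assume q: "q \<in> comult H x"
  then have qp: "q - p \<in> tensor2_relations s C" using p by (simp add: tensor2_class_def)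
  have "r - q \<in> tensor2_relations s C \<longleftrightarrow> r - p \<in> tensor2_relations s C" for r
    using fr.subspace_add[OF sb _ qp, of "r - q"] fr.subspace_diff[OF sb _ qp, of "r - p"] by auto
  then show "comult H x = tensor2_class s C q" using p by (simp add: tensor2_class_def)
  have "Poly_Mapping.keys (q - p) \<subseteq> C \<times> C" using qp rel_keys by blast
  then show "Poly_Mapping.keys q \<subseteq> C \<times> C"
    using Poly_Mapping.keys_add[of "q - p" p] p(2) by auto
qed

lemma sweedler_keys: "x \<in> C \<Longrightarrow> Poly_Mapping.keys (sweedler H x) \<subseteq> C \<times> C"
  using comult_keys sweedler_in by blast

text \<open>The Sweedler sum of the values \<open>f x\<^sub>1 x\<^sub>2\<close>; it depends on the representative of the
  comultiplication unless \<open>f\<close> is bilinear.\<close>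

definition sw :: "('h \<Rightarrow> 'h \<Rightarrow> 'f) \<Rightarrow> 'h \<Rightarrow> 'f"
  where "sw f x = ev (\<lambda>(a, b). f a b) (sweedler H x)"

text \<open>As a congruence rule this hands the simplifier the membership of both components in the
  carrier, which the linearity facts ask for.\<close>

lemma sw_cong [cong]:
  "x = y \<Longrightarrow> y \<in> C \<Longrightarrow> (\<And>a b. a \<in> C \<Longrightarrow> b \<in> C \<Longrightarrow> f a b = g a b) \<Longrightarrow> sw f x = sw g y"
  unfolding sw_def using sweedler_keys[of y] by (auto intro!: ev_cong)

lemma sw_rep: "x \<in> C \<Longrightarrow> p \<in> comult H x \<Longrightarrow> blin f \<Longrightarrow> sw f x = ev (\<lambda>(a, b). f a b) p"
  unfolding sw_def using comult_class[of x p] sweedler_in[of x]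
  by (auto simp: tensor2_class_def intro: ev_tensor2)

lemma sw_addf: "sw (\<lambda>a b. f a b + g a b) x = sw f x + sw g x"
  and sw_scalef: "sw (\<lambda>a b. c * f a b) x = c * sw f x"
  and sw_scalef': "sw (\<lambda>a b. f a b * c) x = sw f x * c"
  and sw_zero [simp]: "sw (\<lambda>a b. 0) x = 0"
  by (simp_all add: sw_def ev_def case_prod_unfold algebra_simps sum.distrib sum_distrib_left)

lemma sw_difff: "sw (\<lambda>a b. f a b - g a b) x = sw f x - sw g x"
  by (simp add: sw_def ev_def case_prod_unfold algebra_simps sum_subtractf)

lemma sw_sumf: "sw (\<lambda>a b. \<Sum>i\<in>I. f i a b) x = (\<Sum>i\<in>I. sw (f i) x)"
  by (simp add: sw_def ev_def case_prod_unfold sum_distrib_left) (rule sum.swap)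

text \<open>Both sums run over fixed finite representatives, so \<open>f\<close> may be
  arbitrary.\<close>

lemma sw_swap: "sw (\<lambda>a b. sw (\<lambda>c d. f a b c d) y) x = sw (\<lambda>c d. sw (\<lambda>a b. f a b c d) x) y"
  unfolding sw_def ev_def case_prod_unfold sum_distrib_left
  by (subst sum.swap) (simp add: mult.left_commute)

lemma sw_lin: assumes "blin f" shows "lin (sw f)"
  unfolding lin_def
proof (intro conjI ballI allI)
  fix x y assume x: "x \<in> C" "y \<in> C"
  have "sweedler H x + sweedler H y \<in> comult H (x + y)"
    using comult_add[OF x] class_self by simp
  then show "sw f (x + y) = sw f x + sw f y"
    using sw_rep[OF C_add[OF x] _ assms] by (simp add: ev_add sw_def)
next
  fix c x assume x: "x \<in> C"
  have "free_scale c (sweedler H x) \<in> comult H (s c x)"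
    using comult_scale[OF x] class_self by simp
  then show "sw f (s c x) = \<iota> c * sw f x"
    using sw_rep[OF C_scale[OF x] _ assms] by (simp add: ev_scale sw_def)
qed

lemma sw_one: "blin f \<Longrightarrow> sw f \<one> = f \<one> \<one>"
  using sw_rep[OF C_one, of "Poly_Mapping.single (\<one>, \<one>) 1" f] comult_one class_self by (simp add: hom_one)

lemma sw_mult:
  assumes "x \<in> C" "y \<in> C" "blin f"
  shows "sw f (x \<otimes> y) = sw (\<lambda>a b. sw (\<lambda>c d. f (a \<otimes> c) (b \<otimes> d)) y) x"
proof -
  have "tensor2_mult H (sweedler H x) (sweedler H y) \<in> comult H (x \<otimes> y)"
    using comult_mult[OF assms(1,2)] class_self by simp
  then have "sw f (x \<otimes> y) = ev (\<lambda>(a, b). f a b) (tensor2_mult H (sweedler H x) (sweedler H y))"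
    using sw_rep assms by simp
  then show ?thesis
    by (simp add: tensor2_mult_def ev_lin_ext hom_one sw_def case_prod_unfold del: split_paired_All)
qed

lemma sw_coassoc:
  assumes "x \<in> C" "tlin f"
  shows "sw (\<lambda>a b. sw (\<lambda>c d. f c d b) a) x = sw (\<lambda>a b. sw (\<lambda>c d. f a c d) b) x"
  using ev_tensor3[OF class3_eqD[OF coassoc[OF assms(1)]] assms(2)]
  by (simp add: ev_lin_ext hom_one sw_def case_prod_unfold)

text \<open>Turns an \<open>H\<close>-valued Sweedler sum into a field-valued one; in this way the
  counit and antipode axioms become statements about \<open>sw\<close>.\<close>

lemma lin_lin_ext:
  assumes "lin \<phi>" "x \<in> C" "\<And>a b. a \<in> C \<Longrightarrow> b \<in> C \<Longrightarrow> G a b \<in> C"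
  shows "\<phi> (lin_ext s (\<lambda>(a, b). G a b) (sweedler H x)) = sw (\<lambda>a b. \<phi> (G a b)) x"
proof -
  have k: "G (fst b) (snd b) \<in> C" if "b \<in> Poly_Mapping.keys (sweedler H x)" for b
    using that sweedler_keys[OF assms(2)] assms(3) by auto
  show ?thesis
    unfolding lin_ext_def sw_def ev_def case_prod_unfold
    by (simp add: k lin_sum[OF assms(1)] lin_scale[OF assms(1)])
qed

abbreviation "\<epsilon> x \<equiv> \<iota> (counit H x)"

lemma sw_counit:
  assumes "x \<in> C" "lin \<phi>"
  shows "sw (\<lambda>a b. \<epsilon> a * \<phi> b) x = \<phi> x" "sw (\<lambda>a b. \<phi> a * \<epsilon> b) x = \<phi> x"
proof -
  have "sw (\<lambda>a b. \<epsilon> a * \<phi> b) x = sw (\<lambda>a b. \<phi> (s (counit H a) b)) x"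
    using assms by (simp add: lin_scale)
  then show "sw (\<lambda>a b. \<epsilon> a * \<phi> b) x = \<phi> x"
    using lin_lin_ext[OF assms(2,1), of "\<lambda>a b. s (counit H a) b"] counit_left[OF assms(1)] by simp
  have "sw (\<lambda>a b. \<phi> a * \<epsilon> b) x = sw (\<lambda>a b. \<phi> (s (counit H b) a)) x"
    using assms by (simp add: lin_scale mult.commute)
  then show "sw (\<lambda>a b. \<phi> a * \<epsilon> b) x = \<phi> x"
    using lin_lin_ext[OF assms(2,1), of "\<lambda>a b. s (counit H b) a"] counit_right[OF assms(1)] by simp
qed

lemma sw_antipode:
  assumes "x \<in> C" "lin \<phi>"
  shows "sw (\<lambda>a b. \<phi> (antipode H a \<otimes> b)) x = \<epsilon> x * \<phi> \<one>"
    "sw (\<lambda>a b. \<phi> (a \<otimes> antipode H b)) x = \<epsilon> x * \<phi> \<one>"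
  using lin_lin_ext[OF assms(2,1), of "\<lambda>a b. antipode H a \<otimes> b"]
    lin_lin_ext[OF assms(2,1), of "\<lambda>a b. a \<otimes> antipode H b"]
    antipode_left[OF assms(1)] antipode_right[OF assms(1)] lin_scale[OF assms(2) C_one]
  by simp_all

end

context hopf_ext
begin

definition hlin :: "('h \<Rightarrow> 'h) \<Rightarrow> bool"
  where "hlin g \<longleftrightarrow> (\<forall>x\<in>C. g x \<in> C) \<and> (\<forall>x\<in>C. \<forall>y\<in>C. g (x + y) = g x + g y) \<and>
    (\<forall>c. \<forall>x\<in>C. g (s c x) = s c (g x))"

text \<open>Syntax-directed rules by which \<open>intro\<close> discharges the linearity obligations
  of coassociativity and of the other Sweedler identities.\<close>

named_theorems linI

lemma lin_comp: "lin \<phi> \<Longrightarrow> hlin g \<Longrightarrow> lin (\<lambda>x. \<phi> (g x))"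
  by (auto simp: lin_def hlin_def)

lemma hlin_intros [linI]:
  "hlin (\<lambda>x. x)"
  "hlin g \<Longrightarrow> y \<in> C \<Longrightarrow> hlin (\<lambda>x. g x \<otimes> y)"
  "hlin g \<Longrightarrow> y \<in> C \<Longrightarrow> hlin (\<lambda>x. y \<otimes> g x)"
  "hlin g \<Longrightarrow> hlin (\<lambda>x. antipode H (g x))"
  by (auto simp: hlin_def mult_add_left mult_add_right mult_scale_left mult_scale_right
      antipode_add antipode_scale)

lemma lin_mult [linI]:
  "lin f \<Longrightarrow> lin (\<lambda>x. c * f x)"
  "lin f \<Longrightarrow> lin (\<lambda>x. f x * c)"
  by (auto simp: lin_def algebra_simps)

lemma lin_eps [linI]: "hlin g \<Longrightarrow> lin (\<lambda>x. \<epsilon> (g x))"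
  by (auto simp: lin_def hlin_def counit_add counit_scale hom_add hom_mult)

lemma lin_plus [linI]: "lin f \<Longrightarrow> lin g \<Longrightarrow> lin (\<lambda>x. f x + g x)"
  by (auto simp: lin_def algebra_simps)

lemma lin_setsum [linI]: "(\<And>i. i \<in> I \<Longrightarrow> lin (f i)) \<Longrightarrow> lin (\<lambda>x. \<Sum>i\<in>I. f i x)"
  by (auto simp: lin_def sum.distrib sum_distrib_left)

lemma lin_sw_in [linI]:
  assumes "\<And>a b. a \<in> C \<Longrightarrow> b \<in> C \<Longrightarrow> lin (\<lambda>x. f x a b)" "y \<in> C"
  shows "lin (\<lambda>x. sw (f x) y)"
  unfolding lin_def
proof (intro conjI ballI allI)
  fix u v assume "u \<in> C" "v \<in> C"
  then have "sw (f (u + v)) y = sw (\<lambda>a b. f u a b + f v a b) y"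
    using assms by (auto intro!: sw_cong simp: lin_def)
  then show "sw (f (u + v)) y = sw (f u) y + sw (f v) y" by (simp add: sw_addf)
next
  fix c u assume "u \<in> C"
  then have "sw (f (s c u)) y = sw (\<lambda>a b. \<iota> c * f u a b) y"
    using assms by (auto intro!: sw_cong simp: lin_def)
  then show "sw (f (s c u)) y = \<iota> c * sw (f u) y" by (simp only: sw_scalef)
qed

lemma blinI [linI]:
  "(\<And>a. a \<in> C \<Longrightarrow> lin (f a)) \<Longrightarrow> (\<And>b. b \<in> C \<Longrightarrow> lin (\<lambda>a. f a b)) \<Longrightarrow> blin f"
  by (simp add: blin_def)

lemma tlinI [linI]:
  "(\<And>a b. a \<in> C \<Longrightarrow> b \<in> C \<Longrightarrow> lin (f a b)) \<Longrightarrow> (\<And>a c. a \<in> C \<Longrightarrow> c \<in> C \<Longrightarrow> lin (\<lambda>b. f a b c)) \<Longrightarrow>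
   (\<And>b c. b \<in> C \<Longrightarrow> c \<in> C \<Longrightarrow> lin (\<lambda>a. f a b c)) \<Longrightarrow> tlin f"
  by (simp add: tlin_def blin_def)

section \<open>The convolution algebra\<close>

text \<open>Functionals are set to 0 outside the carrier, so that they are equal as functions.\<close>

definition restr :: "('h \<Rightarrow> 'f) \<Rightarrow> 'h \<Rightarrow> 'f"
  where "restr f = (\<lambda>x. if x \<in> C then f x else 0)"

definition K :: "('h \<Rightarrow> 'f) set"
  where "K = {\<phi>. lin \<phi> \<and> (\<forall>x. x \<notin> C \<longrightarrow> \<phi> x = 0)}"

definition conv :: "('h \<Rightarrow> 'f) \<Rightarrow> ('h \<Rightarrow> 'f) \<Rightarrow> 'h \<Rightarrow> 'f"  (infixl "\<star>" 70)
  where "\<phi> \<star> \<psi> = restr (sw (\<lambda>a b. \<phi> a * \<psi> b))"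

definition eps :: "'h \<Rightarrow> 'f" where "eps = restr \<epsilon>"

text \<open>The usual left action of \<open>H\<close> on its dual,
  \<open>h \<rightharpoonup> \<phi>\<close>.\<close>

definition hit :: "'h \<Rightarrow> ('h \<Rightarrow> 'f) \<Rightarrow> 'h \<Rightarrow> 'f"
  where "hit h \<phi> = restr (\<lambda>x. \<phi> (x \<otimes> h))"

lemma restr_apply [simp]: "x \<in> C \<Longrightarrow> restr f x = f x"
  by (simp add: restr_def)

lemma restr_lin: "lin (restr f) \<longleftrightarrow> lin f"
  by (simp add: lin_def)

lemma restr_K: "lin f \<Longrightarrow> restr f \<in> K"
  by (simp add: K_def restr_lin) (simp add: restr_def)

lemma K_lin: "\<phi> \<in> K \<Longrightarrow> lin \<phi>"
  by (simp add: K_def)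

lemmas K_comp = lin_comp[OF K_lin]

lemma K_out: "\<phi> \<in> K \<Longrightarrow> x \<notin> C \<Longrightarrow> \<phi> x = 0"
  by (simp add: K_def)

lemma K_eqI: "\<phi> \<in> K \<Longrightarrow> \<psi> \<in> K \<Longrightarrow> (\<And>x. x \<in> C \<Longrightarrow> \<phi> x = \<psi> x) \<Longrightarrow> \<phi> = \<psi>"
  by (rule ext) (metis K_out)

lemma conv_apply: "x \<in> C \<Longrightarrow> (\<phi> \<star> \<psi>) x = sw (\<lambda>a b. \<phi> a * \<psi> b) x"
  by (simp add: conv_def)

lemma eps_apply: "x \<in> C \<Longrightarrow> eps x = \<epsilon> x"
  by (simp add: eps_def)

lemma hit_apply [simp]: "x \<in> C \<Longrightarrow> hit h \<phi> x = \<phi> (x \<otimes> h)"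
  by (simp add: hit_def)

lemma conv_K [simp]: "\<phi> \<in> K \<Longrightarrow> \<psi> \<in> K \<Longrightarrow> \<phi> \<star> \<psi> \<in> K"
  unfolding conv_def by (rule restr_K) (intro sw_lin blinI lin_mult K_lin)

lemma eps_K [simp]: "eps \<in> K"
  unfolding eps_def by (intro restr_K linI)

lemma hit_K [simp]: "h \<in> C \<Longrightarrow> \<phi> \<in> K \<Longrightarrow> hit h \<phi> \<in> K"
  unfolding hit_def by (intro restr_K K_comp linI)

lemma K_subspace: "fv.subspace K"
  by (auto simp: fv.subspace_def K_def lin_def algebra_simps)

lemma K_closed [simp]:
  "0 \<in> K" "\<phi> \<in> K \<Longrightarrow> \<psi> \<in> K \<Longrightarrow> \<phi> + \<psi> \<in> K" "\<phi> \<in> K \<Longrightarrow> \<psi> \<in> K \<Longrightarrow> \<phi> - \<psi> \<in> K" "\<phi> \<in> K \<Longrightarrow> fsc c \<phi> \<in> K"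
  using fv.subspace_0[OF K_subspace] fv.subspace_add[OF K_subspace]
    fv.subspace_diff[OF K_subspace] fv.subspace_scale[OF K_subspace] by auto

lemma K_sum [simp]: "(\<And>i. i \<in> I \<Longrightarrow> f i \<in> K) \<Longrightarrow> (\<Sum>i\<in>I. f i) \<in> K"
  by (rule fv.subspace_sum[OF K_subspace])

lemma blin_mult: "lin \<phi> \<Longrightarrow> lin \<psi> \<Longrightarrow> blin (\<lambda>a b. \<phi> a * \<psi> b)"
  by (intro linI)

lemma conv_add_left: "(\<phi> + \<psi>) \<star> \<chi> = \<phi> \<star> \<chi> + \<psi> \<star> \<chi>"
  and conv_add_right: "\<chi> \<star> (\<phi> + \<psi>) = \<chi> \<star> \<phi> + \<chi> \<star> \<psi>"
  and conv_diff_left: "(\<phi> - \<psi>) \<star> \<chi> = \<phi> \<star> \<chi> - \<psi> \<star> \<chi>"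
  and conv_diff_right: "\<chi> \<star> (\<phi> - \<psi>) = \<chi> \<star> \<phi> - \<chi> \<star> \<psi>"
  by (auto simp: conv_def restr_def fun_eq_iff distrib_left distrib_right left_diff_distrib
      right_diff_distrib sw_addf sw_difff)

lemma conv_scale_left: "fsc c \<phi> \<star> \<chi> = fsc c (\<phi> \<star> \<chi>)"
  by (auto simp: conv_def restr_def fun_eq_iff mult.assoc sw_scalef)

lemma conv_scale_right: "\<chi> \<star> fsc c \<phi> = fsc c (\<chi> \<star> \<phi>)"
proof -
  have "(\<lambda>a b. \<chi> a * (c * \<phi> b)) = (\<lambda>a b. c * (\<chi> a * \<phi> b))"
    by (simp add: mult.left_commute)
  then have "sw (\<lambda>a b. \<chi> a * (c * \<phi> b)) x = c * sw (\<lambda>a b. \<chi> a * \<phi> b) x" for x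
    by (simp only: sw_scalef)
  then show ?thesis by (simp add: conv_def restr_def fun_eq_iff)
qed

lemma conv_zero [simp]: "0 \<star> \<phi> = 0" "\<phi> \<star> 0 = 0"
  by (auto simp: conv_def restr_def fun_eq_iff)

lemma conv_sum_left: "(\<Sum>i\<in>I. f i) \<star> \<phi> = (\<Sum>i\<in>I. f i \<star> \<phi>)"
  and conv_sum_right: "\<phi> \<star> (\<Sum>i\<in>I. f i) = (\<Sum>i\<in>I. \<phi> \<star> f i)"
  by (induction I rule: infinite_finite_induct) (auto simp: conv_add_left conv_add_right)

lemma conv_assoc:
  assumes "\<phi> \<in> K" "\<psi> \<in> K" "\<chi> \<in> K"
  shows "\<phi> \<star> \<psi> \<star> \<chi> = \<phi> \<star> (\<psi> \<star> \<chi>)"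
proof (rule K_eqI)
  fix x assume x: "x \<in> C"
  have "tlin (\<lambda>a b c. \<phi> a * \<psi> b * \<chi> c)"
    by (intro tlinI linI K_lin assms)
  note co = sw_coassoc[OF x this]
  have "(\<phi> \<star> \<psi> \<star> \<chi>) x = sw (\<lambda>a b. sw (\<lambda>c d. \<phi> c * \<psi> d * \<chi> b) a) x"
    using x by (simp add: conv_apply sw_scalef')
  also have "\<dots> = sw (\<lambda>a b. \<phi> a * sw (\<lambda>c d. \<psi> c * \<chi> d) b) x"
    unfolding co by (simp add: mult.assoc sw_scalef x)
  also have "\<dots> = (\<phi> \<star> (\<psi> \<star> \<chi>)) x"
    using x by (simp add: conv_apply)
  finally show "(\<phi> \<star> \<psi> \<star> \<chi>) x = (\<phi> \<star> (\<psi> \<star> \<chi>)) x" .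
qed (use assms in auto)

lemma conv_eps [simp]: "\<phi> \<in> K \<Longrightarrow> eps \<star> \<phi> = \<phi>" "\<phi> \<in> K \<Longrightarrow> \<phi> \<star> eps = \<phi>"
  by (rule K_eqI; simp add: conv_apply eps_apply sw_counit K_lin)+

lemma conv_one: "\<phi> \<in> K \<Longrightarrow> \<psi> \<in> K \<Longrightarrow> (\<phi> \<star> \<psi>) \<one> = \<phi> \<one> * \<psi> \<one>"
  using sw_one[of "\<lambda>a b. \<phi> a * \<psi> b"] by (simp add: conv_apply blin_mult K_lin)

lemma eps_one [simp]: "eps \<one> = 1"
  by (simp add: eps_apply counit_one hom_one)

end

locale fd_hopf_ext = hopf_ext +
  assumes fd: "fin_dim H"
begin

text \<open>Coordinates with respect to a basis of \<open>H\<close>, carried along \<iota>, span all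
  functionals over the larger field and already separate the points of \<open>H\<close>.\<close>

lemma K_fin: "\<exists>B. finite B \<and> K = fv.span B"
  and separates: "x \<in> C \<Longrightarrow> (\<And>\<phi>. \<phi> \<in> K \<Longrightarrow> \<phi> x = 0) \<Longrightarrow> x = 0"
proof -
  obtain B0 where B0: "finite B0" "V.span B0 = C"
    using fd by (auto simp: fin_dim_def)
  obtain B where B: "B \<subseteq> B0" "V.independent B" "B0 \<subseteq> V.span B"
    using V.maximal_independent_subset[of B0] by blast
  have fB: "finite B" using B B0 finite_subset by blast
  have sB: "V.span B = C"
    using B B0 V.span_mono[OF B(1)] V.span_minimal[OF B(3)] by auto
  define crd where "crd b = restr (\<lambda>x. \<iota> (V.representation B x b))" for b
  have crdK: "crd b \<in> K" for b
    unfolding crd_def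
    by (rule restr_K) (auto simp: lin_def V.representation_add[OF B(2)]
        V.representation_scale[OF B(2)] sB hom_add hom_mult)
  have rep: "x = (\<Sum>b\<in>B. s (V.representation B x b) b)" if "x \<in> C" for x
    using V.sum_representation_eq[OF B(2) _ fB order_refl, of x] that sB by simp
  have BC: "B \<subseteq> C" using sB V.span_superset by blast
  have "\<phi> = (\<Sum>b\<in>B. fsc (\<phi> b) (crd b))" if "\<phi> \<in> K" for \<phi>
  proof (rule K_eqI[OF that])
    fix x assume x: "x \<in> C"
    have "\<phi> x = \<phi> (\<Sum>b\<in>B. s (V.representation B x b) b)" using rep[OF x] by simp
    also have "\<dots> = (\<Sum>b\<in>B. \<phi> b * crd b x)"
      using BC x by (subst lin_sum[OF K_lin[OF that]])
        (auto intro!: sum.cong simp: lin_scale[OF K_lin[OF that]] crd_def)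
    finally show "\<phi> x = (\<Sum>b\<in>B. fsc (\<phi> b) (crd b)) x" by simp
  qed (use crdK in simp)
  then have "K \<subseteq> fv.span (crd ` B)"
    by (metis (no_types, lifting) fv.span_base fv.span_scale fv.span_sum imageI subsetI)
  moreover have "fv.span (crd ` B) \<subseteq> K"
    by (rule fv.span_minimal[OF _ K_subspace]) (use crdK in auto)
  ultimately show "\<exists>B. finite B \<and> K = fv.span B" using fB by blast
  assume x: "x \<in> C" and z: "\<And>\<phi>. \<phi> \<in> K \<Longrightarrow> \<phi> x = 0"
  have "V.representation B x b = 0" for b
    using z[OF crdK, of b] x by (simp add: crd_def hom_eq_0)
  then show "x = 0" using rep[OF x] by simp
qed

lemma separates_eq: "x \<in> C \<Longrightarrow> y \<in> C \<Longrightarrow> (\<And>\<phi>. \<phi> \<in> K \<Longrightarrow> \<phi> x = \<phi> y) \<Longrightarrow> x = y"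
  using separates[of "x - y"] by (simp add: lin_diff K_lin)

lemma subspace_interp:
  assumes "fv.subspace W" "W \<subseteq> K"
  shows "\<exists>T w. T \<subseteq> C \<and> interp W T w"
proof -
  obtain B0 where B0: "finite B0" "K = fv.span B0" using K_fin by blast
  obtain B where B: "B \<subseteq> W" "fv.independent B" "W \<subseteq> fv.span B"
    using fv.maximal_independent_subset[of W] by blast
  have "B \<subseteq> fv.span B0" using B(1) assms(2) B0(2) by simp
  then have f: "finite B"
    using fv.independent_span_bound[OF B0(1) B(2)] by simp
  have W: "fv.span B = W" using fv.span_minimal[OF B(1) assms(1)] B(3) by (rule antisym)
  have "\<phi> x = 0" if "\<phi> \<in> B" "x \<notin> C" for \<phi> x
    using that B(1) assms(2) K_out[of \<phi> x] by (simp add: subset_eq)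
  then show ?thesis using ex_interp[OF f, of C] unfolding W by simp
qed

lemma K_interp: "\<exists>T w. T \<subseteq> C \<and> interp K T w"
  by (rule subspace_interp[OF K_subspace order_refl])

lemma lin_expand:
  assumes "interp K T w" "T \<subseteq> C" "lin f" "x \<in> C"
  shows "f x = (\<Sum>t\<in>T. w t x * f t)"
proof -
  have "restr f x = (\<Sum>t\<in>T. restr f t * w t x)"
    by (rule interpD(4)[OF assms(1) restr_K[OF assms(3)]])
  also have "\<dots> = (\<Sum>t\<in>T. w t x * f t)"
    using assms(2) by (intro sum.cong refl) (simp add: mult.commute subset_eq)
  finally show ?thesis using assms(4) by simp
qed

end

section \<open>The antipode reverses the comultiplication\<close>

context hopf_ext
begin

abbreviation "S \<equiv> antipode H"

lemmas sw_lin_comp [linI] = lin_comp[OF sw_lin]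

lemma blin_lin1: "blin f \<Longrightarrow> hlin g \<Longrightarrow> b \<in> C \<Longrightarrow> lin (\<lambda>x. f (g x) b)"
  and blin_lin2: "blin f \<Longrightarrow> hlin g \<Longrightarrow> a \<in> C \<Longrightarrow> lin (\<lambda>x. f a (g x))"
  using lin_comp[of "\<lambda>x. f x b" g] lin_comp[of "f a" g] by (auto simp: blin_def)

text \<open>The maps \<open>\<Delta> \<circ> S\<close> and
  \<open>x \<mapsto> S x2 \<otimes> S x1\<close> are both convolution inverses of \<Delta>. The
  proof evaluates \<open>\<Delta>(S x1) \<Delta>(x2) (S x4 \<otimes> S x3)\<close> in two
  ways.\<close>

lemma sw_comult_antipode:
  assumes x: "x \<in> C" and f: "blin f"
  shows "sw f (S x) = sw (\<lambda>a b. f (S b) (S a)) x"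
proof -
  note l = linI blin_lin1[OF f] blin_lin2[OF f] lin_comp[OF sw_lin[OF f]]
  \<comment> \<open>\<open>g q\<close> multiplies by \<open>S q2 \<otimes> S q1\<close> on the right
    before \<open>f\<close> is applied.\<close>
  define g where "g q = (\<lambda>p p'. sw (\<lambda>d e. f (p \<otimes> S e) (p' \<otimes> S d)) q)" for q
  have gb: "blin (g q)" if "q \<in> C" for q
    unfolding g_def using that by (intro l | simp)+
  \<comment> \<open>The right inverse property
    \<open>\<Delta>(r1) (S r3 \<otimes> S r2) = \<epsilon> r\<close>, multiplied by
    \<open>u \<otimes> v\<close> on the left.\<close>
  have 1: "sw (\<lambda>n q. sw (\<lambda>b c. g q (u \<otimes> b) (v \<otimes> c)) n) r = f u v * \<epsilon> r"
    if uv: "u \<in> C" "v \<in> C" and r: "r \<in> C" for u v r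
  proof -
    have "sw (\<lambda>n q. sw (\<lambda>b c. g q (u \<otimes> b) (v \<otimes> c)) n) r
      = sw (\<lambda>b r'. sw (\<lambda>c q. g q (u \<otimes> b) (v \<otimes> c)) r') r"
      unfolding g_def
      by (rule sw_coassoc[OF r]) (use uv in \<open>(intro l | simp)+\<close>)
    also have "\<dots> = sw (\<lambda>b r'. sw (\<lambda>m e. sw (\<lambda>c d. f (u \<otimes> b \<otimes> S e) (v \<otimes> c \<otimes> S d)) m) r') r"
    proof (rule sw_cong[OF refl r])
      fix b r' assume b: "b \<in> C" "r' \<in> C"
      show "sw (\<lambda>c q. g q (u \<otimes> b) (v \<otimes> c)) r'
        = sw (\<lambda>m e. sw (\<lambda>c d. f (u \<otimes> b \<otimes> S e) (v \<otimes> c \<otimes> S d)) m) r'"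
        unfolding g_def
        by (rule sw_coassoc[OF b(2), symmetric]) (use uv b in \<open>(intro l | simp)+\<close>)
    qed
    also have "\<dots> = sw (\<lambda>b r'. sw (\<lambda>m e. \<epsilon> m * f (u \<otimes> b \<otimes> S e) v) r') r"
    proof -
      have "sw (\<lambda>c d. f (u \<otimes> b \<otimes> S e) (v \<otimes> c \<otimes> S d)) m = \<epsilon> m * f (u \<otimes> b \<otimes> S e) v"
        if "b \<in> C" "e \<in> C" "m \<in> C" for b e m
      proof -
        have "lin (\<lambda>z. f (u \<otimes> b \<otimes> S e) (v \<otimes> z))"
          using that uv by (intro l | simp)+
        from sw_antipode(2)[OF that(3) this] show ?thesis
          using that uv by (simp add: m_assoc)
      qed
      then show ?thesis using r by simp
    qed
    also have "\<dots> = sw (\<lambda>b r'. f (u \<otimes> b \<otimes> S r') v) r"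
    proof -
      have "sw (\<lambda>m e. \<epsilon> m * f (u \<otimes> b \<otimes> S e) v) r' = f (u \<otimes> b \<otimes> S r') v"
        if "b \<in> C" "r' \<in> C" for b r'
        by (rule sw_counit(1)) (use that uv in \<open>(intro l | simp)+\<close>)
      then show ?thesis using r by simp
    qed
    also have "\<dots> = f u v * \<epsilon> r"
    proof -
      have "lin (\<lambda>z. f (u \<otimes> z) v)" using uv by (intro l | simp)+
      from sw_antipode(2)[OF r this] show ?thesis using r uv by (simp add: m_assoc mult.commute)
    qed
    finally show ?thesis .
  qed
  have "sw f (S x) = sw (\<lambda>a r. sw f (S a) * \<epsilon> r) x"
    by (rule sw_counit(2)[symmetric]) (use x in \<open>(intro l | simp)+\<close>)
  also have "\<dots> = sw (\<lambda>a r. sw (\<lambda>u v. f u v * \<epsilon> r) (S a)) x"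
    using x by (simp add: sw_scalef')
  also have "\<dots> = sw (\<lambda>a r. sw (\<lambda>u v. sw (\<lambda>n q. sw (\<lambda>b c. g q (u \<otimes> b) (v \<otimes> c)) n) r) (S a)) x"
    using x by (simp add: 1)
  also have "\<dots> = sw (\<lambda>a r. sw (\<lambda>n q. sw (\<lambda>u v. sw (\<lambda>b c. g q (u \<otimes> b) (v \<otimes> c)) n) (S a)) r) x"
    by (rule sw_cong[OF refl x]) (rule sw_swap)
  also have "\<dots> = sw (\<lambda>a r. sw (\<lambda>n q. sw (g q) (S a \<otimes> n)) r) x"
    using x by (simp add: sw_mult gb)
  also have "\<dots> = sw (\<lambda>m q. sw (\<lambda>a n. sw (g q) (S a \<otimes> n)) m) x"
    by (rule sw_coassoc[OF x, symmetric])
      (unfold g_def, (intro l | simp)+)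
  also have "\<dots> = sw (\<lambda>m q. \<epsilon> m * sw (g q) \<one>) x"
    using x by (simp add: sw_antipode(1) sw_lin gb)
  also have "\<dots> = sw (g x) \<one>"
    by (rule sw_counit(1)[OF x]) (unfold g_def, (intro l | simp)+)
  also have "\<dots> = sw (\<lambda>a b. f (S b) (S a)) x"
    using x by (simp add: sw_one gb) (simp add: g_def)
  finally show ?thesis .
qed

end

locale fd_hopf = fd_hopf_ext H "\<lambda>c. c" for H :: "('k::field, 'h::ab_group_add) hopf" (structure)
begin

notation conv (infixl "\<star>" 70)

lemma antipode_one [simp]: "S \<one> = \<one>"
proof (rule separates_eq)
  fix \<phi> assume p: "\<phi> \<in> K"
  have "blin (\<lambda>a b. \<phi> (S a \<otimes> b))" by (intro linI K_comp[OF p] | simp)+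
  from sw_one[OF this] have "sw (\<lambda>a b. \<phi> (S a \<otimes> b)) \<one> = \<phi> (S \<one>)" by simp
  then show "\<phi> (S \<one>) = \<phi> \<one>"
    unfolding sw_antipode(1)[OF C_one K_lin[OF p]] counit_one by simp
qed auto

end

section \<open>The Haar integral\<close>

text \<open>In convolution terms \<open>lam\<close> is a two-sided integral of the dual algebra
  \<open>K\<close>, normalised to be idempotent. Cosemisimplicity supplies it in
  \<open>ex_haar\<close>.\<close>

locale haar = fd_hopf H for H :: "('k::field, 'h::ab_group_add) hopf" (structure) +
  fixes lam :: "'h \<Rightarrow> 'k"
  assumes lam_K [simp]: "lam \<in> K" and lam_one [simp]: "lam \<one> = 1"
    and lam_conv: "\<phi> \<in> K \<Longrightarrow> conv lam \<phi> = fsc (\<phi> \<one>) lam"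
    and conv_lam: "\<phi> \<in> K \<Longrightarrow> conv \<phi> lam = fsc (\<phi> \<one>) lam"
begin

notation conv (infixl "\<star>" 70)

lemmas lam_lin = lin_comp[OF K_lin[OF lam_K]]

lemma lam_inv:
  assumes "x \<in> C" "lin \<psi>"
  shows "sw (\<lambda>a b. lam a * \<psi> b) x = lam x * \<psi> \<one>" "sw (\<lambda>a b. \<psi> a * lam b) x = lam x * \<psi> \<one>"
  using fun_cong[OF lam_conv[OF restr_K[OF assms(2)]], of x]
    fun_cong[OF conv_lam[OF restr_K[OF assms(2)]], of x] assms(1)
  by (simp_all add: conv_apply mult.commute)

text \<open>Invariance of \<open>lam\<close> replaces \<open>lam (x y1)\<close> by
  \<open>lam (x1 y1)\<close> together with the factor \<open>x2 y2\<close>, and then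
  \<open>y2 S y3\<close> cancels.\<close>

lemma lam_shift_left:
  assumes x: "x \<in> C" and y: "y \<in> C" and p: "lin \<phi>"
  shows "sw (\<lambda>a b. lam (a \<otimes> y) * \<phi> b) x = sw (\<lambda>a b. lam (x \<otimes> a) * \<phi> (S b)) y"
proof -
  note l = linI lam_lin lin_comp[OF p]
  have 1: "lam (x \<otimes> a) * \<phi> (S b) = sw (\<lambda>u v. sw (\<lambda>c d. lam (u \<otimes> c) * \<phi> (v \<otimes> d \<otimes> S b)) a) x"
    if ab: "a \<in> C" "b \<in> C" for a b
  proof -
    have "lin (\<lambda>v. \<phi> (v \<otimes> S b))" using ab by (intro l | simp)+
    from lam_inv(1)[OF _ this, of "x \<otimes> a"]
    have "lam (x \<otimes> a) * \<phi> (S b) = sw (\<lambda>u v. lam u * \<phi> (v \<otimes> S b)) (x \<otimes> a)"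
      using ab x by simp
    also have "\<dots> = sw (\<lambda>u v. sw (\<lambda>c d. lam (u \<otimes> c) * \<phi> (v \<otimes> d \<otimes> S b)) a) x"
      by (rule sw_mult[OF x ab(1)]) (use ab in \<open>(intro l | simp)+\<close>)
    finally show ?thesis .
  qed
  have "sw (\<lambda>a b. lam (x \<otimes> a) * \<phi> (S b)) y
    = sw (\<lambda>a b. sw (\<lambda>u v. sw (\<lambda>c d. lam (u \<otimes> c) * \<phi> (v \<otimes> d \<otimes> S b)) a) x) y"
    by (rule sw_cong[OF refl y]) (rule 1)
  also have "\<dots> = sw (\<lambda>u v. sw (\<lambda>a b. sw (\<lambda>c d. lam (u \<otimes> c) * \<phi> (v \<otimes> d \<otimes> S b)) a) y) x"
    by (rule sw_swap)
  also have "\<dots> = sw (\<lambda>u v. lam (u \<otimes> y) * \<phi> v) x"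
  proof (rule sw_cong[OF refl x])
    fix u v assume uv: "u \<in> C" "v \<in> C"
    have "sw (\<lambda>a b. sw (\<lambda>c d. lam (u \<otimes> c) * \<phi> (v \<otimes> d \<otimes> S b)) a) y
      = sw (\<lambda>c r. sw (\<lambda>d b. lam (u \<otimes> c) * \<phi> (v \<otimes> d \<otimes> S b)) r) y"
      by (rule sw_coassoc[OF y]) (use uv in \<open>(intro l | simp)+\<close>)
    also have "\<dots> = sw (\<lambda>c r. lam (u \<otimes> c) * \<phi> v * \<epsilon> r) y"
    proof (rule sw_cong[OF refl y])
      fix c r assume cr: "c \<in> C" "r \<in> C"
      have "lin (\<lambda>z. \<phi> (v \<otimes> z))" using uv by (intro l | simp)+
      from sw_antipode(2)[OF cr(2) this]
      show "sw (\<lambda>d b. lam (u \<otimes> c) * \<phi> (v \<otimes> d \<otimes> S b)) r = lam (u \<otimes> c) * \<phi> v * \<epsilon> r"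
        using uv cr by (simp add: sw_scalef m_assoc)
    qed
    also have "\<dots> = lam (u \<otimes> y) * \<phi> v"
      by (rule sw_counit(2)[OF y]) (use uv in \<open>(intro l | simp)+\<close>)
    finally show "sw (\<lambda>a b. sw (\<lambda>c d. lam (u \<otimes> c) * \<phi> (v \<otimes> d \<otimes> S b)) a) y = lam (u \<otimes> y) * \<phi> v" .
  qed
  finally show ?thesis by simp
qed

lemma lam_shift_right:
  assumes x: "x \<in> C" and y: "y \<in> C" and p: "lin \<phi>"
  shows "sw (\<lambda>a b. \<phi> a * lam (x \<otimes> b)) y = sw (\<lambda>a b. \<phi> (S a) * lam (b \<otimes> y)) x"
proof -
  note l = linI lam_lin lin_comp[OF p]
  have 1: "\<phi> (S a) * lam (b \<otimes> y) = sw (\<lambda>u v. sw (\<lambda>c d. \<phi> (S a \<otimes> (u \<otimes> c)) * lam (v \<otimes> d)) y) b"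
    if ab: "a \<in> C" "b \<in> C" for a b
  proof -
    have "lin (\<lambda>v. \<phi> (S a \<otimes> v))" using ab by (intro l | simp)+
    from lam_inv(2)[OF _ this, of "b \<otimes> y"]
    have "\<phi> (S a) * lam (b \<otimes> y) = sw (\<lambda>u v. \<phi> (S a \<otimes> u) * lam v) (b \<otimes> y)"
      using ab y by simp
    also have "\<dots> = sw (\<lambda>u v. sw (\<lambda>c d. \<phi> (S a \<otimes> (u \<otimes> c)) * lam (v \<otimes> d)) y) b"
      by (rule sw_mult[OF ab(2) y]) (use ab in \<open>(intro l | simp)+\<close>)
    finally show ?thesis .
  qed
  have "sw (\<lambda>a b. \<phi> (S a) * lam (b \<otimes> y)) x
    = sw (\<lambda>a b. sw (\<lambda>u v. sw (\<lambda>c d. \<phi> (S a \<otimes> (u \<otimes> c)) * lam (v \<otimes> d)) y) b) x"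
    by (rule sw_cong[OF refl x]) (rule 1)
  also have "\<dots> = sw (\<lambda>m v. sw (\<lambda>a u. sw (\<lambda>c d. \<phi> (S a \<otimes> (u \<otimes> c)) * lam (v \<otimes> d)) y) m) x"
    by (rule sw_coassoc[OF x, symmetric]) (use y in \<open>(intro l | simp)+\<close>)
  also have "\<dots> = sw (\<lambda>m v. \<epsilon> m * sw (\<lambda>c d. \<phi> c * lam (v \<otimes> d)) y) x"
  proof (rule sw_cong[OF refl x])
    fix m v assume mv: "m \<in> C" "v \<in> C"
    have "sw (\<lambda>a u. sw (\<lambda>c d. \<phi> (S a \<otimes> (u \<otimes> c)) * lam (v \<otimes> d)) y) m
      = sw (\<lambda>c d. sw (\<lambda>a u. \<phi> (S a \<otimes> (u \<otimes> c)) * lam (v \<otimes> d)) m) y"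
      by (rule sw_swap)
    also have "\<dots> = sw (\<lambda>c d. \<epsilon> m * (\<phi> c * lam (v \<otimes> d))) y"
    proof (rule sw_cong[OF refl y])
      fix c d assume cd: "c \<in> C" "d \<in> C"
      have "lin (\<lambda>z. \<phi> (z \<otimes> c))" using cd by (intro l | simp)+
      from sw_antipode(1)[OF mv(1) this]
      show "sw (\<lambda>a u. \<phi> (S a \<otimes> (u \<otimes> c)) * lam (v \<otimes> d)) m = \<epsilon> m * (\<phi> c * lam (v \<otimes> d))"
        using mv cd by (simp add: sw_scalef' flip: m_assoc)
    qed
    finally show "sw (\<lambda>a u. sw (\<lambda>c d. \<phi> (S a \<otimes> (u \<otimes> c)) * lam (v \<otimes> d)) y) m
      = \<epsilon> m * sw (\<lambda>c d. \<phi> c * lam (v \<otimes> d)) y" by (simp only: sw_scalef)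
  qed
  also have "\<dots> = sw (\<lambda>c d. \<phi> c * lam (x \<otimes> d)) y"
    by (rule sw_counit(1)[OF x]) (use y in \<open>(intro l | simp)+\<close>)
  finally show ?thesis by simp
qed

lemma lam_shift_antipode:
  assumes x: "x \<in> C" and y: "y \<in> C" and p: "lin \<phi>"
  shows "sw (\<lambda>a b. \<phi> a * lam (b \<otimes> S y)) x = sw (\<lambda>a b. lam (x \<otimes> S a) * \<phi> b) y"
proof -
  note l = linI lam_lin lin_comp[OF p]
  have 1: "lam (x \<otimes> S a) * \<phi> b = sw (\<lambda>u v. sw (\<lambda>c d. \<phi> (u \<otimes> (S d \<otimes> b)) * lam (v \<otimes> S c)) a) x"
    if ab: "a \<in> C" "b \<in> C" for a b
  proof -
    have "lin (\<lambda>u. \<phi> (u \<otimes> b))" using ab by (intro l | simp)+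
    from lam_inv(2)[OF _ this, of "x \<otimes> S a"]
    have "lam (x \<otimes> S a) * \<phi> b = sw (\<lambda>u v. \<phi> (u \<otimes> b) * lam v) (x \<otimes> S a)"
      using ab x by simp
    also have "\<dots> = sw (\<lambda>u v. sw (\<lambda>c d. \<phi> (u \<otimes> c \<otimes> b) * lam (v \<otimes> d)) (S a)) x"
      by (rule sw_mult[OF x]) (use ab in \<open>(intro l | simp)+\<close>)
    also have "\<dots> = sw (\<lambda>u v. sw (\<lambda>c d. \<phi> (u \<otimes> S d \<otimes> b) * lam (v \<otimes> S c)) a) x"
      by (rule sw_cong[OF refl x], rule sw_comult_antipode[OF ab(1)]) (use ab in \<open>(intro l | simp)+\<close>)
    finally show ?thesis using ab x by (simp add: m_assoc)
  qed
  have "sw (\<lambda>a b. lam (x \<otimes> S a) * \<phi> b) y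
    = sw (\<lambda>a b. sw (\<lambda>u v. sw (\<lambda>c d. \<phi> (u \<otimes> (S d \<otimes> b)) * lam (v \<otimes> S c)) a) x) y"
    by (rule sw_cong[OF refl y]) (rule 1)
  also have "\<dots> = sw (\<lambda>u v. sw (\<lambda>a b. sw (\<lambda>c d. \<phi> (u \<otimes> (S d \<otimes> b)) * lam (v \<otimes> S c)) a) y) x"
    by (rule sw_swap)
  also have "\<dots> = sw (\<lambda>u v. \<phi> u * lam (v \<otimes> S y)) x"
  proof (rule sw_cong[OF refl x])
    fix u v assume uv: "u \<in> C" "v \<in> C"
    have "sw (\<lambda>a b. sw (\<lambda>c d. \<phi> (u \<otimes> (S d \<otimes> b)) * lam (v \<otimes> S c)) a) y
      = sw (\<lambda>c r. sw (\<lambda>d b. \<phi> (u \<otimes> (S d \<otimes> b)) * lam (v \<otimes> S c)) r) y"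
      by (rule sw_coassoc[OF y]) (use uv in \<open>(intro l | simp)+\<close>)
    also have "\<dots> = sw (\<lambda>c r. \<phi> u * lam (v \<otimes> S c) * \<epsilon> r) y"
    proof (rule sw_cong[OF refl y])
      fix c r assume cr: "c \<in> C" "r \<in> C"
      have "lin (\<lambda>z. \<phi> (u \<otimes> z))" using uv by (intro l | simp)+
      from sw_antipode(1)[OF cr(2) this]
      show "sw (\<lambda>d b. \<phi> (u \<otimes> (S d \<otimes> b)) * lam (v \<otimes> S c)) r = \<phi> u * lam (v \<otimes> S c) * \<epsilon> r"
        using uv cr by (simp add: sw_scalef')
    qed
    also have "\<dots> = \<phi> u * lam (v \<otimes> S y)"
      by (rule sw_counit(2)[OF y]) (use uv in \<open>(intro l | simp)+\<close>)
    finally show "sw (\<lambda>a b. sw (\<lambda>c d. \<phi> (u \<otimes> (S d \<otimes> b)) * lam (v \<otimes> S c)) a) y = \<phi> u * lam (v \<otimes> S y)" .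
  qed
  finally show ?thesis by simp
qed

end

section \<open>Nondegeneracy of the integral and regularity of the dual\<close>

context fd_hopf
begin

text \<open>The points \<open>T\<close> dual to a basis of \<open>W\<close> span \<open>H\<close>,
  since \<open>x\<close> and its expansion agree on \<open>W\<close>. So every functional is
  determined by its values on \<open>T\<close> and expands in the basis of \<open>W\<close>.\<close>

lemma subspace_separating:
  assumes W: "fv.subspace W" "W \<subseteq> K" and sep: "\<And>x. x \<in> C \<Longrightarrow> (\<And>\<phi>. \<phi> \<in> W \<Longrightarrow> \<phi> x = 0) \<Longrightarrow> x = 0"
  shows "W = K"
proof
  obtain T w where T: "T \<subseteq> C" and I: "interp W T w" using subspace_interp[OF W] by blast
  show "K \<subseteq> W"
  proof
    fix \<phi> assume p: "\<phi> \<in> K"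
    have e: "x = (\<Sum>t\<in>T. s (w t x) t)" if x: "x \<in> C" for x
    proof -
      have y: "(\<Sum>t\<in>T. s (w t x) t) \<in> C" using T by (intro C_sum C_scale) auto
      have "\<psi> (x - (\<Sum>t\<in>T. s (w t x) t)) = 0" if "\<psi> \<in> W" for \<psi>
      proof -
        have l: "lin \<psi>" using that W(2) K_lin by blast
        have "\<psi> (\<Sum>t\<in>T. s (w t x) t) = (\<Sum>t\<in>T. \<psi> t * w t x)"
          using T by (subst lin_sum[OF l]) (auto intro!: sum.cong simp: lin_scale[OF l] mult.commute subset_eq)
        also have "\<dots> = \<psi> x" by (rule interpD(4)[OF I that, symmetric])
        finally show ?thesis using lin_diff[OF l x y] by simp
      qed
      then show ?thesis using sep[of "x - (\<Sum>t\<in>T. s (w t x) t)"] x y by simp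
    qed
    have "\<phi> = (\<Sum>t\<in>T. fsc (\<phi> t) (w t))"
    proof (rule K_eqI[OF p])
      fix x assume x: "x \<in> C"
      have "\<phi> x = \<phi> (\<Sum>t\<in>T. s (w t x) t)" using e[OF x] by simp
      also have "\<dots> = (\<Sum>t\<in>T. fsc (\<phi> t) (w t)) x"
        using T by (subst lin_sum[OF K_lin[OF p]])
          (auto intro!: sum.cong simp: lin_scale[OF K_lin[OF p]] mult.commute subset_eq)
      finally show "\<phi> x = (\<Sum>t\<in>T. fsc (\<phi> t) (w t)) x" .
    qed (use interpD(2)[OF I] W(2) in \<open>auto intro!: K_sum K_closed(4)\<close>)
    also have "\<dots> \<in> W"
      using interpD(2)[OF I] by (intro fv.subspace_sum[OF W(1)] fv.subspace_scale[OF W(1)])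
    finally show "\<phi> \<in> W" .
  qed
qed (use W in blast)

text \<open>The right action \<open>y \<leftharpoonup> \<phi>\<close> of the dual on
  \<open>H\<close>; \<open>rslice\<close> is the left action
  \<open>\<phi> \<rightharpoonup> y\<close>. Slices reduce statements about comultiplication to
  statements about vectors.\<close>

definition lslice :: "('h \<Rightarrow> 'k) \<Rightarrow> 'h \<Rightarrow> 'h"
  where "lslice \<phi> y = lin_ext s (\<lambda>(a, b). s (\<phi> a) b) (sweedler H y)"

definition rslice :: "('h \<Rightarrow> 'k) \<Rightarrow> 'h \<Rightarrow> 'h"
  where "rslice \<phi> y = lin_ext s (\<lambda>(a, b). s (\<phi> b) a) (sweedler H y)"

lemma slice_C [simp]: "y \<in> C \<Longrightarrow> lslice \<phi> y \<in> C" "y \<in> C \<Longrightarrow> rslice \<phi> y \<in> C"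
  unfolding lslice_def rslice_def lin_ext_def using sweedler_keys[of y]
  by (auto intro!: C_sum C_scale)

lemma lin_slice:
  assumes "y \<in> C" "lin \<psi>"
  shows "\<psi> (lslice \<phi> y) = sw (\<lambda>a b. \<phi> a * \<psi> b) y" "\<psi> (rslice \<phi> y) = sw (\<lambda>a b. \<psi> a * \<phi> b) y"
  using lin_lin_ext[OF assms(2,1), of "\<lambda>a b. s (\<phi> a) b"] lin_lin_ext[OF assms(2,1), of "\<lambda>a b. s (\<phi> b) a"]
  by (simp_all add: lslice_def rslice_def lin_scale[OF assms(2)] mult.commute assms(1))

end

context haar
begin

text \<open>The vectors \<open>y\<close> killed in this way are stable under \<open>lslice\<close>
  by \<open>lam_shift_right\<close>, and the counit vanishes on them because
  \<open>\<epsilon> u = lam (S u1 u2)\<close>. Since \<open>\<phi> y\<close> is the counit of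
  \<open>lslice \<phi> y\<close>, no functional sees \<open>y\<close>.\<close>

lemma lam_nondeg_right:
  assumes y: "y \<in> C" and z: "\<And>x. x \<in> C \<Longrightarrow> lam (x \<otimes> y) = 0"
  shows "y = 0"
proof (rule separates[OF y])
  fix \<phi> assume p: "\<phi> \<in> K"
  obtain T w where T: "T \<subseteq> C" and I: "interp K T w" using K_interp by blast
  have ls: "lam (x \<otimes> lslice \<psi> u) = 0" if "x \<in> C" "u \<in> C" "\<psi> \<in> K" "\<And>x. x \<in> C \<Longrightarrow> lam (x \<otimes> u) = 0"
    for x u \<psi>
  proof -
    have "lin (\<lambda>b. lam (x \<otimes> b))" using that by (intro linI lam_lin)
    from lin_slice(1)[OF that(2) this] that show ?thesis
      using lam_shift_right[OF that(1,2) K_lin[OF that(3)]] by simp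
  qed
  have "counit H u = 0" if u: "u \<in> C" "\<And>x. x \<in> C \<Longrightarrow> lam (x \<otimes> u) = 0" for u
  proof -
    have "counit H u = sw (\<lambda>a b. lam (S a \<otimes> b)) u"
      using sw_antipode(1)[OF u(1) K_lin[OF lam_K]] by simp
    also have "\<dots> = sw (\<lambda>a b. \<Sum>t\<in>T. w t a * lam (S t \<otimes> b)) u"
    proof (rule sw_cong[OF refl u(1)])
      fix a b assume ab: "a \<in> C" "b \<in> C"
      have "lin (\<lambda>a. lam (S a \<otimes> b))" using ab by (intro linI lam_lin)
      from lin_expand[OF I T this ab(1)] show "lam (S a \<otimes> b) = (\<Sum>t\<in>T. w t a * lam (S t \<otimes> b))" .
    qed
    also have "\<dots> = (\<Sum>t\<in>T. sw (\<lambda>a b. w t a * lam (S t \<otimes> b)) u)" by (rule sw_sumf)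
    also have "\<dots> = 0"
    proof (rule sum.neutral, rule ballI)
      fix t assume t: "t \<in> T"
      have "lin (\<lambda>b. lam (S t \<otimes> b))" using t T by (intro linI lam_lin) auto
      from lin_slice(1)[OF u(1) this, of "w t"] ls[OF C_antipode u(1) interpD(2)[OF I t] u(2), of t]
      show "sw (\<lambda>a b. w t a * lam (S t \<otimes> b)) u = 0" using t T by (auto simp: subset_eq)
    qed
    finally show ?thesis .
  qed
  from this[OF slice_C(1)[OF y] ls[OF _ y p z]] have "counit H (lslice \<phi> y) = 0" by simp
  moreover have "lin (counit H)" using lin_eps[OF hlin_intros(1)] by simp
  from lin_slice(1)[OF y this] have "counit H (lslice \<phi> y) = \<phi> y"
    using sw_counit(2)[OF y K_lin[OF p]] by simp
  ultimately show "\<phi> y = 0" by simp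
qed

lemma lam_nondeg_left:
  assumes x: "x \<in> C" and z: "\<And>y. y \<in> C \<Longrightarrow> lam (x \<otimes> y) = 0"
  shows "x = 0"
proof (rule separates[OF x])
  fix \<phi> assume p: "\<phi> \<in> K"
  obtain T w where T: "T \<subseteq> C" and I: "interp K T w" using K_interp by blast
  have rs: "lam (rslice \<psi> u \<otimes> y) = 0" if "y \<in> C" "u \<in> C" "\<psi> \<in> K" "\<And>x. x \<in> C \<Longrightarrow> lam (u \<otimes> x) = 0"
    for y u \<psi>
  proof -
    have "lin (\<lambda>a. lam (a \<otimes> y))" using that by (intro linI lam_lin)
    from lin_slice(2)[OF that(2) this] that show ?thesis
      using lam_shift_left[OF that(2,1) K_lin[OF that(3)]] by simp
  qed
  have "counit H u = 0" if u: "u \<in> C" "\<And>x. x \<in> C \<Longrightarrow> lam (u \<otimes> x) = 0" for u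
  proof -
    have "counit H u = sw (\<lambda>a b. lam (a \<otimes> S b)) u"
      using sw_antipode(2)[OF u(1) K_lin[OF lam_K]] by simp
    also have "\<dots> = sw (\<lambda>a b. \<Sum>t\<in>T. lam (a \<otimes> S t) * w t b) u"
    proof (rule sw_cong[OF refl u(1)])
      fix a b assume ab: "a \<in> C" "b \<in> C"
      have "lin (\<lambda>b. lam (a \<otimes> S b))" using ab by (intro linI lam_lin)
      from lin_expand[OF I T this ab(2)] show "lam (a \<otimes> S b) = (\<Sum>t\<in>T. lam (a \<otimes> S t) * w t b)"
        by (simp only: mult.commute)
    qed
    also have "\<dots> = (\<Sum>t\<in>T. sw (\<lambda>a b. lam (a \<otimes> S t) * w t b) u)" by (rule sw_sumf)
    also have "\<dots> = 0"
    proof (rule sum.neutral, rule ballI)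
      fix t assume t: "t \<in> T"
      have "lin (\<lambda>a. lam (a \<otimes> S t))" using t T by (intro linI lam_lin) auto
      from lin_slice(2)[OF u(1) this, of "w t"] rs[OF C_antipode u(1) interpD(2)[OF I t] u(2), of t]
      show "sw (\<lambda>a b. lam (a \<otimes> S t) * w t b) u = 0" using t T by (auto simp: subset_eq)
    qed
    finally show ?thesis .
  qed
  from this[OF slice_C(2)[OF x] rs[OF _ x p z]] have "counit H (rslice \<phi> x) = 0" by simp
  moreover have "lin (counit H)" using lin_eps[OF hlin_intros(1)] by simp
  from lin_slice(2)[OF x this] have "counit H (rslice \<phi> x) = \<phi> x"
    using sw_counit(1)[OF x K_lin[OF p]] by simp
  ultimately show "\<phi> x = 0" by simp
qed

text \<open>The Frobenius property. The functionals \<open>lam (x _)\<close> form a subspace of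
  \<open>K\<close>, which separates points by nondegeneracy in the other argument.\<close>

lemma lam_represents:
  assumes p: "\<phi> \<in> K"
  shows "\<exists>x\<in>C. \<forall>y\<in>C. \<phi> y = lam (x \<otimes> y)" "\<exists>y\<in>C. \<forall>x\<in>C. \<phi> x = lam (x \<otimes> y)"
proof -
  note ll = lin_add[OF K_lin[OF lam_K]] lin_scale[OF K_lin[OF lam_K]] lin_zero[OF K_lin[OF lam_K]]
  have z: "0 \<otimes> y = 0" "y \<otimes> 0 = 0" if "y \<in> C" for y
    using mult_scale_left[of 0 y 0] mult_scale_right[of y 0 0] that by simp_all
  let ?W = "{restr (\<lambda>y. lam (x \<otimes> y)) |x. x \<in> C}"
  have "fv.subspace ?W"
    unfolding fv.subspace_def
  proof (intro conjI ballI allI)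
    show "0 \<in> ?W" by (auto intro!: exI[of _ 0] simp: restr_def z ll fun_eq_iff)
  next
    fix f g assume "f \<in> ?W" "g \<in> ?W"
    then obtain x y where "f = restr (\<lambda>z. lam (x \<otimes> z))" "x \<in> C" "g = restr (\<lambda>z. lam (y \<otimes> z))" "y \<in> C"
      by blast
    then show "f + g \<in> ?W"
      by (auto intro!: exI[of _ "x + y"] simp: restr_def mult_add_left ll fun_eq_iff)
  next
    fix c f assume "f \<in> ?W"
    then obtain x where "f = restr (\<lambda>z. lam (x \<otimes> z))" "x \<in> C" by blast
    then show "fsc c f \<in> ?W"
      by (auto intro!: exI[of _ "s c x"] simp: restr_def mult_scale_left ll fun_eq_iff)
  qed
  moreover have "?W \<subseteq> K" by (auto intro!: restr_K linI lam_lin)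
  moreover have "y = 0" if y: "y \<in> C" and 0: "\<And>\<phi>. \<phi> \<in> ?W \<Longrightarrow> \<phi> y = 0" for y
  proof (rule lam_nondeg_right[OF y])
    fix x assume x: "x \<in> C"
    then have "restr (\<lambda>y. lam (x \<otimes> y)) y = 0" by (intro 0) blast
    then show "lam (x \<otimes> y) = 0" using y by simp
  qed
  ultimately have "?W = K" by (rule subspace_separating)
  then have "\<phi> \<in> ?W" using p by simp
  then show "\<exists>x\<in>C. \<forall>y\<in>C. \<phi> y = lam (x \<otimes> y)" by auto
  let ?V = "{restr (\<lambda>x. lam (x \<otimes> y)) |y. y \<in> C}"
  have "fv.subspace ?V"
    unfolding fv.subspace_def
  proof (intro conjI ballI allI)
    show "0 \<in> ?V" by (auto intro!: exI[of _ 0] simp: restr_def z ll fun_eq_iff)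
  next
    fix f g assume "f \<in> ?V" "g \<in> ?V"
    then obtain x y where "f = restr (\<lambda>z. lam (z \<otimes> x))" "x \<in> C" "g = restr (\<lambda>z. lam (z \<otimes> y))" "y \<in> C"
      by blast
    then show "f + g \<in> ?V"
      by (auto intro!: exI[of _ "x + y"] simp: restr_def mult_add_right ll fun_eq_iff)
  next
    fix c f assume "f \<in> ?V"
    then obtain x where "f = restr (\<lambda>z. lam (z \<otimes> x))" "x \<in> C" by blast
    then show "fsc c f \<in> ?V"
      by (auto intro!: exI[of _ "s c x"] simp: restr_def mult_scale_right ll fun_eq_iff)
  qed
  moreover have "?V \<subseteq> K" by (auto intro!: restr_K linI lam_lin)
  moreover have "x = 0" if x: "x \<in> C" and 0: "\<And>\<phi>. \<phi> \<in> ?V \<Longrightarrow> \<phi> x = 0" for x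
  proof (rule lam_nondeg_left[OF x])
    fix y assume y: "y \<in> C"
    then have "restr (\<lambda>x. lam (x \<otimes> y)) x = 0" by (intro 0) blast
    then show "lam (x \<otimes> y) = 0" using x by simp
  qed
  ultimately have "?V = K" by (rule subspace_separating)
  then have "\<phi> \<in> ?V" using p by simp
  then show "\<exists>y\<in>C. \<forall>x\<in>C. \<phi> x = lam (x \<otimes> y)" by auto
qed

text \<open>\<open>L\<close> represents the counit; since the counit is multiplicative,
  \<open>L h\<close> and \<open>\<epsilon> h L\<close> have the same pairings under
  \<open>lam\<close>.\<close>

lemma ex_integral: "\<exists>L\<in>C. (\<forall>y\<in>C. lam (L \<otimes> y) = counit H y) \<and> (\<forall>h\<in>C. L \<otimes> h = s (counit H h) L)"
proof -
  obtain L where L: "L \<in> C" "\<And>y. y \<in> C \<Longrightarrow> eps y = lam (L \<otimes> y)"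
    using lam_represents(1)[OF eps_K] by blast
  have e: "lam (L \<otimes> y) = counit H y" if "y \<in> C" for y using L(2)[OF that] that by (simp add: eps_apply)
  have "L \<otimes> h - s (counit H h) L = 0" if h: "h \<in> C" for h
  proof (rule lam_nondeg_left)
    fix y assume y: "y \<in> C"
    have "lin (\<lambda>x. lam (x \<otimes> y))" using y by (intro linI lam_lin)
    from lin_diff[OF this, of "L \<otimes> h" "s (counit H h) L"] lin_scale[OF this, of L "counit H h"]
    show "lam ((L \<otimes> h - s (counit H h) L) \<otimes> y) = 0"
      using h y L(1) by (simp add: m_assoc e counit_mult)
  qed (use h L in simp)
  then have "L \<otimes> h = s (counit H h) L" if "h \<in> C" for h using that by simp
  then show ?thesis using L(1) e by blast
qed

text \<open>Maschke's averaging made explicit: the expansion of the left ideal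
  \<open>K \<phi>\<close> in its echelon basis is averaged with \<open>lam\<close>, and the
  functionals \<open>\<chi> t\<close> that write this basis as multiples of \<phi> assemble to the
  quasi-inverse \<psi>.\<close>

lemma regular:
  assumes p: "\<phi> \<in> K"
  shows "\<exists>\<psi>\<in>K. \<phi> \<star> \<psi> \<star> \<phi> = \<phi>"
proof -
  define W where "W = {\<chi> \<star> \<phi> |\<chi>. \<chi> \<in> K}"
  have "fv.subspace W"
    unfolding fv.subspace_def W_def
  proof (intro conjI ballI allI)
    show "0 \<in> {\<chi> \<star> \<phi> |\<chi>. \<chi> \<in> K}" by (auto intro!: exI[of _ 0])
  qed (auto simp flip: conv_add_left conv_scale_left intro: K_closed)
  moreover have "W \<subseteq> K" using p by (auto simp: W_def)
  ultimately obtain T w where T: "T \<subseteq> C" and I: "interp W T w" using subspace_interp by blast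
  \<comment> \<open>\<open>lam_shift_antipode\<close> lets \<phi> pass from the variable
    \<open>h\<close> of this kernel to the point \<open>t\<close>.\<close>
  define \<kappa> where "\<kappa> t = restr (\<lambda>h. lam (h \<otimes> S t))" for t
  have \<kappa>K: "\<kappa> t \<in> K" if "t \<in> C" for t unfolding \<kappa>_def using that by (intro restr_K linI lam_lin) auto
  have "\<exists>\<chi>\<in>K. w t = \<chi> \<star> \<phi>" if "t \<in> T" for t using interpD(2)[OF I that] by (auto simp: W_def)
  then obtain \<chi> where \<chi>: "\<And>t. t \<in> T \<Longrightarrow> \<chi> t \<in> K" "\<And>t. t \<in> T \<Longrightarrow> w t = \<chi> t \<star> \<phi>" by metis
  define \<psi> where "\<psi> = (\<Sum>t\<in>T. \<kappa> t \<star> \<chi> t)"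
  have wK: "w t \<in> K" if "t \<in> T" for t using that \<chi> p by simp
  have kK: "\<kappa> t \<in> K" if "t \<in> T" for t using that T \<kappa>K by blast
  have \<psi>K: "\<psi> \<in> K" unfolding \<psi>_def using \<chi>(1) kK by (intro K_sum conv_K)
  have "\<phi> \<star> \<psi> \<star> \<phi> = (\<Sum>t\<in>T. \<phi> \<star> \<kappa> t \<star> w t)"
    unfolding \<psi>_def conv_sum_left conv_sum_right
    using \<chi> kK p by (intro sum.cong refl) (simp add: conv_assoc)
  also have "\<dots> = \<phi>"
  proof (rule K_eqI[OF _ p])
    fix h assume h: "h \<in> C"
    \<comment> \<open>As a function of \<open>r\<close> this is an element of the left ideal
      \<open>W\<close>, so its values on \<open>T\<close> reproduce it.\<close>
    have eta: "(\<Sum>t\<in>T. sw (\<lambda>a b. lam (q \<otimes> S a) * \<phi> b) t * w t r) = sw (\<lambda>a b. lam (q \<otimes> S a) * \<phi> b) r"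
      if "q \<in> C" "r \<in> C" for q r
    proof -
      let ?e = "restr (\<lambda>a. lam (q \<otimes> S a))"
      have "?e \<in> K" using that by (intro restr_K linI lam_lin)
      then have "?e \<star> \<phi> \<in> W" by (auto simp: W_def)
      from interpD(4)[OF I this, of r]
      have "(?e \<star> \<phi>) r = (\<Sum>t\<in>T. (?e \<star> \<phi>) t * w t r)" .
      moreover have "(?e \<star> \<phi>) u = sw (\<lambda>a b. lam (q \<otimes> S a) * \<phi> b) u" if "u \<in> C" for u
        using that by (simp add: conv_apply)
      ultimately show ?thesis using T that by (auto simp: subset_eq cong: sum.cong)
    qed
    have "(\<phi> \<star> \<kappa> t \<star> w t) h = sw (\<lambda>q r. sw (\<lambda>a b. lam (q \<otimes> S a) * \<phi> b) t * w t r) h" if t: "t \<in> T" for t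
    proof -
      have tC: "t \<in> C" using t T by blast
      have "(\<phi> \<star> \<kappa> t) q = sw (\<lambda>a b. lam (q \<otimes> S a) * \<phi> b) t" if "q \<in> C" for q
      proof -
        have "(\<phi> \<star> \<kappa> t) q = sw (\<lambda>a b. \<phi> a * lam (b \<otimes> S t)) q"
          using that by (simp add: conv_apply \<kappa>_def)
        also have "\<dots> = sw (\<lambda>a b. lam (q \<otimes> S a) * \<phi> b) t"
          by (rule lam_shift_antipode[OF that tC K_lin[OF p]])
        finally show ?thesis .
      qed
      then show ?thesis using h by (simp add: conv_apply[of h])
    qed
    then have "(\<Sum>t\<in>T. \<phi> \<star> \<kappa> t \<star> w t) h = sw (\<lambda>q r. \<Sum>t\<in>T. sw (\<lambda>a b. lam (q \<otimes> S a) * \<phi> b) t * w t r) h"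
      by (simp add: sw_sumf)
    also have "\<dots> = sw (\<lambda>q r. sw (\<lambda>a b. lam (q \<otimes> S a) * \<phi> b) r) h"
      by (rule sw_cong[OF refl h]) (rule eta)
    also have "\<dots> = sw (\<lambda>m b. sw (\<lambda>q a. lam (q \<otimes> S a) * \<phi> b) m) h"
      by (rule sw_coassoc[OF h, symmetric]) (intro linI lam_lin K_comp[OF p] K_lin[OF p] | simp)+
    also have "\<dots> = sw (\<lambda>m b. counit H m * \<phi> b) h"
    proof (rule sw_cong[OF refl h])
      fix m b assume "m \<in> C" "b \<in> C"
      then show "sw (\<lambda>q a. lam (q \<otimes> S a) * \<phi> b) m = counit H m * \<phi> b"
        using sw_antipode(2)[OF _ K_lin[OF lam_K], of m] by (simp add: sw_scalef')
    qed
    also have "\<dots> = \<phi> h" using sw_counit(1)[OF h K_lin[OF p]] by simp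
    finally show "(\<Sum>t\<in>T. \<phi> \<star> \<kappa> t \<star> w t) h = \<phi> h" .
  qed (use p kK wK in auto)
  finally show ?thesis using \<psi>K by blast
qed

end

section \<open>The squared antipode as a Nakayama automorphism, its order and its trace\<close>

locale haar_integral = haar H lam for H :: "('k::field, 'h::ab_group_add) hopf" (structure) and lam +
  fixes L
  assumes L [simp]: "L \<in> C" and lam_L: "y \<in> C \<Longrightarrow> lam (L \<otimes> y) = counit H y"
    and L_mult: "h \<in> C \<Longrightarrow> L \<otimes> h = s (counit H h) L"
begin

notation conv (infixl "\<star>" 70)

lemma lam_L1: "lam L = 1"
  using lam_L[of \<one>] by (simp add: counit_one)

text \<open>The shift formulas at \<open>x = L\<close>, where \<open>lam (L _)\<close> is the
  counit: \<open>L\<close> and \<open>lam\<close> together recover the antipode.\<close>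

lemma L_antipode:
  assumes y: "y \<in> C" and p: "lin \<phi>"
  shows "sw (\<lambda>a b. lam (a \<otimes> y) * \<phi> b) L = \<phi> (S y)" "sw (\<lambda>a b. \<phi> (S a) * lam (b \<otimes> y)) L = \<phi> y"
proof -
  have "lin (\<lambda>b. \<phi> (S b))" by (intro linI lin_comp[OF p])
  from sw_counit(1)[OF y this] show "sw (\<lambda>a b. lam (a \<otimes> y) * \<phi> b) L = \<phi> (S y)"
    using lam_shift_left[OF L y p] y by (simp add: lam_L)
  show "sw (\<lambda>a b. \<phi> (S a) * lam (b \<otimes> y)) L = \<phi> y"
    using lam_shift_right[OF L y p] sw_counit(2)[OF y p] y by (simp add: lam_L)
qed

definition Q :: "('h \<Rightarrow> 'k) \<Rightarrow> 'h \<Rightarrow> 'k" where "Q \<phi> = restr (\<lambda>x. \<phi> (S (S x)))"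

lemma Q_K [simp]: "\<phi> \<in> K \<Longrightarrow> Q \<phi> \<in> K"
  unfolding Q_def by (intro restr_K linI K_comp)

lemma Q_apply: "x \<in> C \<Longrightarrow> Q \<phi> x = \<phi> (S (S x))"
  by (simp add: Q_def)

lemma Q_linear: "Q (\<phi> + \<psi>) = Q \<phi> + Q \<psi>" "Q (\<phi> - \<psi>) = Q \<phi> - Q \<psi>" "Q (fsc c \<phi>) = fsc c (Q \<phi>)" "Q 0 = 0"
  by (auto simp: Q_def restr_def fun_eq_iff)

text \<open>With \<open>\<phi> = lam (_ y)\<close>, both sides are \<open>\<psi> (S y)\<close>. So
  \<open>Q\<close>, dual to the squared antipode, is the Nakayama automorphism of the Frobenius form
  \<open>(\<phi> \<star> \<psi>) L\<close>.\<close>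

lemma Q_form:
  assumes p: "\<phi> \<in> K" "\<psi> \<in> K"
  shows "(\<phi> \<star> \<psi>) L = (Q \<psi> \<star> \<phi>) L"
proof -
  obtain y where y: "y \<in> C" "\<And>x. x \<in> C \<Longrightarrow> \<phi> x = lam (x \<otimes> y)"
    using lam_represents(2)[OF p(1)] by blast
  have "(\<phi> \<star> \<psi>) L = \<psi> (S y)"
    using L_antipode(1)[OF y(1) K_lin[OF p(2)]] by (simp add: conv_apply y)
  moreover have l: "lin (\<lambda>x. \<psi> (S x))" by (intro linI K_comp[OF p(2)])
  have "(Q \<psi> \<star> \<phi>) L = \<psi> (S y)"
    using L_antipode(2)[OF y(1) l] by (simp add: conv_apply y Q_apply)
  ultimately show ?thesis by simp
qed

text \<open>The modular function: \<open>h L\<close> is \<open>al h\<close> times \<open>L\<close>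
  by \<open>mult_L\<close>, the scalar being read off with \<open>lam L = 1\<close>. Its convolution
  inverse is \<open>ial\<close>.\<close>

definition al :: "'h \<Rightarrow> 'k" where "al = restr (\<lambda>h. lam (h \<otimes> L))"
definition ial :: "'h \<Rightarrow> 'k" where "ial = restr (\<lambda>h. al (S h))"

lemma al_K [simp]: "al \<in> K" unfolding al_def by (intro restr_K linI lam_lin) auto
lemma ial_K [simp]: "ial \<in> K" unfolding ial_def by (intro restr_K linI K_comp[OF al_K])

lemma mult_L:
  assumes h: "h \<in> C" shows "h \<otimes> L = s (al h) L"
proof -
  have "h \<otimes> L - s (al h) L = 0"
  proof (rule lam_nondeg_left)
    fix y assume y: "y \<in> C"
    have "lin (\<lambda>x. lam (x \<otimes> y))" using y by (intro linI lam_lin)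
    from lin_diff[OF this, of "h \<otimes> L" "s (al h) L"] lin_scale[OF this, of L "al h"]
    have "lam ((h \<otimes> L - s (al h) L) \<otimes> y) = lam (h \<otimes> (L \<otimes> y)) - al h * lam (L \<otimes> y)"
      using h y by (simp add: m_assoc)
    also have "lam (h \<otimes> (L \<otimes> y)) = counit H y * lam (h \<otimes> L)"
      using h y by (simp add: L_mult mult_scale_right lin_scale[OF K_lin[OF lam_K]])
    finally show "lam ((h \<otimes> L - s (al h) L) \<otimes> y) = 0"
      using h y by (simp add: lam_L al_def)
  qed (use h in simp)
  then show ?thesis by simp
qed

lemma al_one: "al \<one> = 1"
  by (simp add: al_def lam_L1)

lemma al_mult:
  assumes "g \<in> C" "h \<in> C" shows "al (g \<otimes> h) = al g * al h"
proof -
  have "al (g \<otimes> h) = lam (g \<otimes> (h \<otimes> L))" using assms by (simp add: al_def m_assoc)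
  also have "\<dots> = al h * lam (g \<otimes> L)"
    unfolding mult_L[OF assms(2)] using assms by (simp add: mult_scale_right lin_scale[OF K_lin[OF lam_K]])
  also have "lam (g \<otimes> L) = al g" using assms by (simp add: al_def)
  finally show ?thesis by simp
qed

lemma al_ial: "al \<star> ial = eps" "ial \<star> al = eps"
proof -
  have "al \<star> ial = eps"
  proof (rule K_eqI)
    fix x assume x: "x \<in> C"
    have "(al \<star> ial) x = sw (\<lambda>a b. al (a \<otimes> S b)) x"
      using x by (simp add: conv_apply ial_def al_mult)
    then show "(al \<star> ial) x = eps x"
      using sw_antipode(2)[OF x K_lin[OF al_K]] x by (simp add: al_one eps_apply)
  qed auto
  moreover have "ial \<star> al = eps"
  proof (rule K_eqI)
    fix x assume x: "x \<in> C"
    have "(ial \<star> al) x = sw (\<lambda>a b. al (S a \<otimes> b)) x"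
      using x by (simp add: conv_apply ial_def al_mult)
    then show "(ial \<star> al) x = eps x"
      using sw_antipode(1)[OF x K_lin[OF al_K]] x by (simp add: al_one eps_apply)
  qed auto
  ultimately show "al \<star> ial = eps" "ial \<star> al = eps" by auto
qed

text \<open>Radford's formula for the fourth power of the antipode, in the unimodular case.\<close>

lemma Q_Q_al:
  assumes p: "\<phi> \<in> K"
  shows "al \<star> \<phi> = Q (Q \<phi>) \<star> al"
proof (rule K_eqI)
  fix x assume x: "x \<in> C"
  let ?l = "restr (\<lambda>y. lam (x \<otimes> y))" and ?p = "restr (\<lambda>y. \<phi> (S y))"
  have K': "?l \<in> K" "?p \<in> K"
    using x by (auto intro!: restr_K linI lam_lin K_comp[OF p])
  have "(al \<star> \<phi>) x = sw (\<lambda>a b. lam (a \<otimes> L) * \<phi> b) x"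
    using x by (simp add: conv_apply al_def)
  also have "\<dots> = (?l \<star> ?p) L"
    using lam_shift_left[OF x L K_lin[OF p]] by (simp add: conv_apply)
  also have "\<dots> = (Q ?p \<star> ?l) L" by (rule Q_form[OF K'])
  also have "\<dots> = sw (\<lambda>a b. \<phi> (S (S (S a))) * lam (x \<otimes> b)) L"
    by (simp add: conv_apply Q_apply)
  also have "\<dots> = sw (\<lambda>a b. \<phi> (S (S (S (S a)))) * lam (b \<otimes> L)) x"
    by (rule lam_shift_right[OF x L]) (intro linI K_comp[OF p])
  also have "\<dots> = (Q (Q \<phi>) \<star> al) x"
    using x by (simp add: conv_apply Q_apply al_def)
  finally show "(al \<star> \<phi>) x = (Q (Q \<phi>) \<star> al) x" .
qed (use p in auto)

lemma Q_Q: "\<phi> \<in> K \<Longrightarrow> Q (Q \<phi>) = al \<star> \<phi> \<star> ial"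
  by (simp add: Q_Q_al conv_assoc al_ial)

text \<open>By Radford's formula every functional is of the form \<open>Q (Q _)\<close>, so it
  factors through the fourth power of \<open>S\<close>.\<close>

lemma antipode_inj: assumes y: "y \<in> C" "S y = 0" shows "y = 0"
proof (rule separates[OF y(1)])
  fix \<phi> assume p: "\<phi> \<in> K"
  have S0: "S 0 = 0" using antipode_scale[of 0 0] by simp
  have "\<phi> = Q (Q (ial \<star> \<phi> \<star> al))"
    using p by (simp add: Q_Q conv_assoc al_ial flip: conv_assoc[of al ial])
  then have "\<phi> y = Q (Q (ial \<star> \<phi> \<star> al)) y" by simp
  also have "\<dots> = (ial \<star> \<phi> \<star> al) 0" using y by (simp add: Q_apply S0)
  also have "\<dots> = 0" using p by (intro lin_zero K_lin) auto
  finally show "\<phi> y = 0" .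
qed

lemma form_nondeg:
  assumes X: "X \<in> K" and z: "\<And>\<phi>. \<phi> \<in> K \<Longrightarrow> (X \<star> \<phi>) L = 0"
  shows "X = 0"
proof -
  obtain y where y: "y \<in> C" "\<And>x. x \<in> C \<Longrightarrow> X x = lam (x \<otimes> y)"
    using lam_represents(2)[OF X] by blast
  have "\<phi> (S y) = 0" if "\<phi> \<in> K" for \<phi>
    using L_antipode(1)[OF y(1) K_lin[OF that]] z[OF that] by (simp add: conv_apply y)
  then have "S y = 0" using separates[of "S y"] y by simp
  then have "y = 0" using antipode_inj y by blast
  moreover have "x \<otimes> 0 = 0" if "x \<in> C" for x using mult_scale_right[of x 0 0] that by simp
  ultimately show ?thesis
    using y(2) by (intro K_eqI[OF X]) (auto simp: lin_zero[OF K_lin[OF lam_K]])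
qed

text \<open>Three-factor cyclicity of the form: moving \<open>\<phi> \<star> \<psi>\<close> around
  at once or one factor at a time gives the same pairing with every \<chi>.\<close>

lemma Q_conv:
  assumes p: "\<phi> \<in> K" "\<psi> \<in> K"
  shows "Q (\<phi> \<star> \<psi>) = Q \<phi> \<star> Q \<psi>"
proof -
  have "((Q (\<phi> \<star> \<psi>) - Q \<phi> \<star> Q \<psi>) \<star> \<chi>) L = 0" if c: "\<chi> \<in> K" for \<chi>
  proof -
    have "(Q (\<phi> \<star> \<psi>) \<star> \<chi>) L = (\<chi> \<star> (\<phi> \<star> \<psi>)) L" using Q_form[OF c, of "\<phi> \<star> \<psi>"] p by simp
    also have "\<dots> = (\<chi> \<star> \<phi> \<star> \<psi>) L" using p c by (simp add: conv_assoc)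
    also have "\<dots> = (Q \<psi> \<star> (\<chi> \<star> \<phi>)) L" by (rule Q_form) (use p c in auto)
    also have "\<dots> = (Q \<psi> \<star> \<chi> \<star> \<phi>) L" using p c by (simp add: conv_assoc)
    also have "\<dots> = (Q \<phi> \<star> (Q \<psi> \<star> \<chi>)) L" by (rule Q_form) (use p c in auto)
    also have "\<dots> = (Q \<phi> \<star> Q \<psi> \<star> \<chi>) L" using p c by (simp add: conv_assoc)
    finally show ?thesis by (simp add: conv_diff_left)
  qed
  from form_nondeg[OF _ this] show ?thesis using p by simp
qed

lemma Q_eps: "Q eps = eps"
proof -
  have "((Q eps - eps) \<star> \<phi>) L = 0" if "\<phi> \<in> K" for \<phi>
    using Q_form[OF that eps_K] that by (simp add: conv_diff_left)
  from form_nondeg[OF _ this] show ?thesis by simp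
qed

definition cpow :: "('h \<Rightarrow> 'k) \<Rightarrow> nat \<Rightarrow> 'h \<Rightarrow> 'k" where "cpow \<phi> n = (conv \<phi> ^^ n) eps"

lemma cpow_simps [simp]: "cpow \<phi> 0 = eps" "cpow \<phi> (Suc n) = \<phi> \<star> cpow \<phi> n"
  by (simp_all add: cpow_def)

lemma cpow_K [simp]: "\<phi> \<in> K \<Longrightarrow> cpow \<phi> n \<in> K"
  by (induction n) auto

lemma cpow_add: "\<phi> \<in> K \<Longrightarrow> cpow \<phi> (m + n) = cpow \<phi> m \<star> cpow \<phi> n"
  by (induction m) (auto simp: conv_assoc)

lemma cpow_Suc2: "\<phi> \<in> K \<Longrightarrow> cpow \<phi> (Suc n) = cpow \<phi> n \<star> \<phi>"
  using cpow_add[of \<phi> n 1] by simp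

lemma Q_iter: "\<phi> \<in> K \<Longrightarrow> (Q ^^ (2 * n)) \<phi> = cpow al n \<star> \<phi> \<star> cpow ial n"
proof (induction n)
  case (Suc n)
  have "(Q ^^ (2 * Suc n)) \<phi> = Q (Q ((Q ^^ (2 * n)) \<phi>))" by simp
  also have "\<dots> = al \<star> (cpow al n \<star> \<phi> \<star> cpow ial n) \<star> ial"
    using Suc by (simp add: Q_Q)
  also have "\<dots> = cpow al (Suc n) \<star> \<phi> \<star> (cpow ial n \<star> ial)"
    using Suc.prems by (simp add: conv_assoc)
  also have "\<dots> = cpow al (Suc n) \<star> \<phi> \<star> cpow ial (Suc n)"
    by (simp only: cpow_Suc2[OF ial_K])
  finally show ?case .
qed simp

lemma cpow_al_mult: "g \<in> C \<Longrightarrow> h \<in> C \<Longrightarrow> cpow al n (g \<otimes> h) = cpow al n g * cpow al n h"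
proof (induction n arbitrary: g h)
  case 0
  then show ?case by (simp add: eps_apply counit_mult)
next
  case (Suc n)
  have b: "blin (\<lambda>a b. al a * cpow al n b)" by (intro blin_mult K_lin) auto
  have "cpow al (Suc n) (g \<otimes> h) = sw (\<lambda>a b. sw (\<lambda>c d. al (a \<otimes> c) * cpow al n (b \<otimes> d)) h) g"
    using Suc.prems by (simp add: conv_apply sw_mult b)
  also have "\<dots> = sw (\<lambda>a b. sw (\<lambda>c d. (al a * cpow al n b) * (al c * cpow al n d)) h) g"
    using Suc by (simp add: al_mult algebra_simps)
  also have "\<dots> = cpow al (Suc n) g * cpow al (Suc n) h"
    using Suc.prems by (simp add: conv_apply sw_scalef sw_scalef')
  finally show ?case .
qed

lemma cpow_al_one: "cpow al n \<one> = 1"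
  by (induction n) (auto simp: conv_one al_one)

text \<open>Distinct characters of the algebra \<open>H\<close> are linearly independent, so \<open>al\<close> has finite order.\<close>

lemma al_finite_order: "\<exists>n>0. cpow al n = eps"
proof -
  have "finite (range (cpow al))"
  proof (rule ccontr)
    assume inf: "infinite (range (cpow al))"
    obtain B where B: "finite B" "K = fv.span B" using K_fin by blast
    obtain X where X: "X \<subseteq> range (cpow al)" "finite X" "card X = Suc (card B)"
      using infinite_arbitrarily_large[OF inf] by blast
    have ch: "\<chi> \<in> K" "\<chi> \<one> = 1" "\<And>g h. g \<in> C \<Longrightarrow> h \<in> C \<Longrightarrow> \<chi> (g \<otimes> h) = \<chi> g * \<chi> h" if "\<chi> \<in> X" for \<chi>
      using that X(1) cpow_al_mult cpow_al_one by auto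
    \<comment> \<open>Characters are multiplicative, so an element that separates \<chi> from a
      finite set is a product of elements separating it from one character at a time.\<close>
    have pt: "\<exists>x\<in>C. \<chi> x = 1 \<and> (\<forall>\<chi>'\<in>Y. \<chi>' x = 0)" if "finite Y" "Y \<subseteq> X" "\<chi> \<in> X" "\<chi> \<notin> Y" for Y \<chi>
      using that
    proof (induction Y rule: finite_induct)
      case empty
      then show ?case using ch by (intro bexI[of _ \<one>]) auto
    next
      case (insert \<chi>' Y)
      then obtain x where x: "x \<in> C" "\<chi> x = 1" "\<forall>\<chi>'\<in>Y. \<chi>' x = 0" by auto
      have c': "\<chi>' \<in> X" using insert by auto
      have "\<chi> \<noteq> \<chi>'" using insert by auto
      then obtain h where h: "h \<in> C" "\<chi> h \<noteq> \<chi>' h"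
        using K_eqI[OF ch(1)[OF insert.prems(2)] ch(1)[OF c']] by blast
      define z where "z = s (1 / (\<chi> h - \<chi>' h)) (h - s (\<chi>' h) \<one>)"
      have z: "z \<in> C" using h by (simp add: z_def)
      have zv: "\<eta> z = (\<eta> h - \<chi>' h) / (\<chi> h - \<chi>' h)" if "\<eta> \<in> X" for \<eta>
        using h ch(2)[OF that]
        by (simp add: z_def lin_scale[OF K_lin[OF ch(1)[OF that]]] lin_diff[OF K_lin[OF ch(1)[OF that]]])
      have m: "\<eta> (x \<otimes> z) = \<eta> x * \<eta> z" if "\<eta> \<in> X" for \<eta>
        using ch(3)[OF that x(1) z] .
      have "\<chi> (x \<otimes> z) = 1" using m[of \<chi>] zv[of \<chi>] x h insert.prems by simp
      moreover have "\<chi>' (x \<otimes> z) = 0" using m[OF c'] zv[OF c'] by simp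
      moreover have "\<eta> (x \<otimes> z) = 0" if "\<eta> \<in> Y" for \<eta>
        using m[of \<eta>] that x(3) insert.prems(1) by (simp add: subset_eq)
      ultimately show ?case using x z by (intro bexI[of _ "x \<otimes> z"]) auto
    qed
    have "fv.independent X"
    proof
      assume "fv.dependent X"
      then obtain u where u: "\<exists>\<chi>\<in>X. u \<chi> \<noteq> 0" "(\<Sum>\<chi>\<in>X. fsc (u \<chi>) \<chi>) = 0"
        using fv.dependent_finite[OF X(2)] by blast
      then obtain \<chi> where c: "\<chi> \<in> X" "u \<chi> \<noteq> 0" by blast
      obtain x where x: "x \<in> C" "\<chi> x = 1" "\<forall>\<chi>'\<in>X - {\<chi>}. \<chi>' x = 0"
        using pt[of "X - {\<chi>}" \<chi>] X c by auto
      have "0 = (\<Sum>\<chi>\<in>X. fsc (u \<chi>) \<chi>) x" using u(2) by simp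
      also have "\<dots> = (\<Sum>\<chi>'\<in>X. if \<chi>' = \<chi> then u \<chi> else 0)"
        using x by (auto intro!: sum.cong)
      also have "\<dots> = u \<chi>" using c X by simp
      finally show False using c by simp
    qed
    moreover have "X \<subseteq> fv.span B" using ch(1) B(2) by auto
    ultimately have "card X \<le> card B" using fv.independent_span_bound[OF B(1)] by blast
    then show False using X by simp
  qed
  then have "\<not> inj (cpow al)" using finite_imageD[of "cpow al" UNIV] infinite_UNIV_nat by blast
  then obtain i j where ij: "cpow al i = cpow al j" "i < j"
    unfolding inj_def by (metis linorder_neqE_nat)
  have inv: "cpow ial n \<star> cpow al n = eps" for n
  proof (induction n)
    case (Suc n)
    have "cpow ial (Suc n) \<star> cpow al (Suc n) = cpow ial n \<star> (ial \<star> al) \<star> cpow al n"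
      using cpow_Suc2[OF ial_K, of n] by (simp add: conv_assoc)
    then show ?case using Suc by (simp add: al_ial)
  qed simp
  have "eps = cpow ial i \<star> cpow al j" using inv[of i] ij(1) by simp
  also have "\<dots> = cpow ial i \<star> cpow al i \<star> cpow al (j - i)"
    using ij(2) cpow_add[OF al_K, of i "j - i"] by (simp add: conv_assoc)
  also have "\<dots> = cpow al (j - i)" by (simp add: inv)
  finally show ?thesis using ij(2) by (intro exI[of _ "j - i"]) auto
qed

lemma Q_finite_order: "\<exists>M>0. \<forall>\<phi>\<in>K. (Q ^^ M) \<phi> = \<phi>"
proof -
  obtain n where n: "n > 0" "cpow al n = eps" using al_finite_order by blast
  have "cpow ial n = cpow al n \<star> cpow ial n" using n by simp
  also have "cpow al m \<star> cpow ial m = eps" for m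
  proof (induction m)
    case (Suc m)
    have "cpow al (Suc m) \<star> cpow ial (Suc m) = cpow al m \<star> (al \<star> ial) \<star> cpow ial m"
      using cpow_Suc2[OF al_K, of m] by (simp add: conv_assoc)
    then show ?case using Suc by (simp add: al_ial)
  qed simp
  finally show ?thesis using n Q_iter[of _ n] by (intro exI[of _ "2 * n"]) auto
qed

text \<open>As \<open>Q\<close> has finite order, \<open>lam = Q \<psi>\<close> for some \<psi>.
  Then \<open>lam \<star> Q lam = Q (\<psi> \<star> lam)\<close> is \<open>Q lam\<close>, while
  invariance of \<open>lam\<close> makes it \<open>lam\<close>.\<close>

lemma Q_lam: "Q lam = lam"
proof -
  obtain M where M: "M > 0" "\<And>\<phi>. \<phi> \<in> K \<Longrightarrow> (Q ^^ M) \<phi> = \<phi>" using Q_finite_order by blast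
  then obtain m where m: "M = Suc m" by (cases M) auto
  have it: "(Q ^^ m) lam \<in> K" by (induction m) auto
  define \<psi> where "\<psi> = (Q ^^ m) lam"
  have \<psi>: "\<psi> \<in> K" "Q \<psi> = lam" using it M(2)[OF lam_K] by (auto simp: \<psi>_def m)
  have o: "Q \<phi> \<one> = \<phi> \<one>" for \<phi> by (simp add: Q_apply)
  have "lam \<star> Q lam = Q (\<psi> \<star> lam)" using \<psi> by (simp add: Q_conv)
  also have "\<dots> = fsc (\<psi> \<one>) (Q lam)" using \<psi> by (simp add: conv_lam Q_linear)
  also have "\<psi> \<one> = 1" using o[of \<psi>] \<psi> by simp
  finally have "lam \<star> Q lam = Q lam" by simp
  moreover have "lam \<star> Q lam = lam" by (simp add: lam_conv o)
  ultimately show ?thesis by simp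
qed

text \<open>The Larson-Radford trace formula; the left side is the trace of \<open>Q\<close> in the
  dual bases \<open>T\<close> and \<open>w\<close>. By \<open>L_antipode\<close> it becomes
  \<open>lam (L1 S L2)\<close>, which the antipode axiom evaluates.\<close>

lemma trace_Q:
  assumes T: "T \<subseteq> C" and I: "interp K T w"
  shows "(\<Sum>t\<in>T. Q (w t) t) = counit H L"
proof -
  have tC: "t \<in> C" if "t \<in> T" for t using that T by blast
  have "Q (w t) t = sw (\<lambda>a b. w t (S b) * lam (a \<otimes> t)) L" if t: "t \<in> T" for t
  proof -
    have "lin (\<lambda>z. w t (S z))" by (intro linI K_comp interpD(2)[OF I t])
    from L_antipode(1)[OF tC[OF t] this] show ?thesis using tC[OF t] by (simp add: Q_apply mult.commute)
  qed
  then have "(\<Sum>t\<in>T. Q (w t) t) = sw (\<lambda>a b. \<Sum>t\<in>T. w t (S b) * lam (a \<otimes> t)) L"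
    by (simp add: sw_sumf)
  also have "\<dots> = sw (\<lambda>a b. lam (a \<otimes> S b)) L"
  proof (rule sw_cong[OF refl L])
    fix a b assume ab: "a \<in> C" "b \<in> C"
    have "lin (\<lambda>t. lam (a \<otimes> t))" using ab by (intro linI lam_lin)
    from lin_expand[OF I T this, of "S b"] show "(\<Sum>t\<in>T. w t (S b) * lam (a \<otimes> t)) = lam (a \<otimes> S b)"
      using ab by simp
  qed
  also have "\<dots> = counit H L" using sw_antipode(2)[OF L K_lin[OF lam_K]] by simp
  finally show ?thesis .
qed

text \<open>The product \<open>L h L\<close> computed in two ways shows that the modular function is
  the counit.\<close>

lemma counit_L_imp_unimodular:
  assumes "counit H L \<noteq> 0" "h \<in> C"
  shows "h \<otimes> L = s (counit H h) L"
proof -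
  have nz: "L \<noteq> 0" using lam_L1 lin_zero[OF K_lin[OF lam_K]] by auto
  have "s (al h * counit H L) L = L \<otimes> (h \<otimes> L)"
    unfolding mult_L[OF assms(2)] mult_scale_right[OF L L] L_mult[OF L] by simp
  also have "\<dots> = L \<otimes> h \<otimes> L" using assms(2) by (simp add: m_assoc)
  also have "\<dots> = s (counit H h * counit H L) L"
    unfolding L_mult[OF assms(2)] mult_scale_left[OF L L] L_mult[OF L] by simp
  finally have "al h = counit H h" using nz assms(1) by (simp only: V.scale_cancel_right) auto
  then show ?thesis using mult_L[OF assms(2)] by simp
qed

end

section \<open>Roots of unity in an algebraically closed field\<close>

lemma map_poly_of_rat_hom:
  "map_poly (of_rat :: rat \<Rightarrow> 'a::field_char_0) (p + q) = map_poly of_rat p + map_poly of_rat q"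
  "map_poly (of_rat :: rat \<Rightarrow> 'a::field_char_0) (p * q) = map_poly of_rat p * map_poly of_rat q"
  "map_poly (of_rat :: rat \<Rightarrow> 'a::field_char_0) (p - q) = map_poly of_rat p - map_poly of_rat q"
  by (auto intro!: poly_eqI simp: coeff_map_poly of_rat_add of_rat_diff coeff_mult of_rat_sum of_rat_mult)

text \<open>A primitive \<open>M\<close>-th root of unity \<open>\<zeta>\<close> with the same rational relations as \<open>cis (2\<pi>/M)\<close>:
  both are roots of one irreducible polynomial over the rationals.\<close>

lemma ex_root_of_unity:
  assumes M: "M > 0"
  defines "\<omega> \<equiv> cis (2 * pi / real M)"
  shows "\<exists>\<zeta> :: 'k :: {alg_closed_field, field_char_0}. \<zeta> ^ M = 1 \<and> inj_on (\<lambda>i. \<zeta> ^ i) {..<M} \<and>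
    (\<forall>E (e :: 'b \<Rightarrow> nat). finite E \<longrightarrow> (\<Sum>x\<in>E. \<zeta> ^ e x) = 0 \<longrightarrow> (\<Sum>x\<in>E. \<omega> ^ e x) = 0)"
proof -
  define ev where "ev z f = poly (map_poly of_rat f) z" for z :: complex and f
  define ek where "ek z f = poly (map_poly of_rat f) z" for z :: 'k and f
  have [simp]: "ev z (f + g) = ev z f + ev z g" "ev z (f * g) = ev z f * ev z g" for z f g
    by (simp_all add: ev_def map_poly_of_rat_hom)
  have [simp]: "ek z (f + g) = ek z f + ek z g" "ek z (f * g) = ek z f * ek z g" for z f g
    by (simp_all add: ek_def map_poly_of_rat_hom)
  have mon: "ev z (monom 1 i) = z ^ i" "ek z' (monom 1 i) = z' ^ i" for z z' i
    by (simp_all add: ev_def ek_def map_poly_monom poly_monom)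
  have cst: "ev z [:c:] = of_rat c" "ek z' [:c:] = of_rat c" for z z' c
    by (simp_all add: ev_def ek_def map_poly_pCons)
  have wM: "\<omega> ^ M = 1"
    using M by (simp add: \<omega>_def DeMoivre)
  have inj\<omega>: "i = j" if "\<omega> ^ i = \<omega> ^ j" "i < M" "j < M" for i j
  proof -
    have "inj_on (\<lambda>k. cis (2 * pi * real k / real M)) {..<M}"
      using bij_betw_roots_unity[OF M] by (rule bij_betw_imp_inj_on)
    then show ?thesis using that
      by (auto simp: inj_on_def \<omega>_def DeMoivre mult_ac)
  qed
  define f0 :: "rat poly" where "f0 = monom 1 M + [:-1:]"
  have f0: "f0 \<noteq> 0" "ev \<omega> f0 = 0"
  proof -
    have "coeff f0 M = 1" using M by (cases M) (auto simp: f0_def)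
    then show "f0 \<noteq> 0" by auto
    show "ev \<omega> f0 = 0" by (simp add: f0_def mon cst wM)
  qed
  obtain p where p: "p \<noteq> 0" "ev \<omega> p = 0" and pm: "\<And>f. f \<noteq> 0 \<Longrightarrow> ev \<omega> f = 0 \<Longrightarrow> degree p \<le> degree f"
    using ex_has_least_nat[of "\<lambda>f. f \<noteq> 0 \<and> ev \<omega> f = 0" f0 degree] f0 by blast
  have dvd: "p dvd f" if "ev \<omega> f = 0" for f
  proof -
    have "ev \<omega> (f mod p) = 0"
      using that p(2) \<open>\<And>z f g. ev z (f + g) = ev z f + ev z g\<close>[of \<omega> "p * (f div p)" "f mod p"] by simp
    then have "f mod p = 0" using pm[of "f mod p"] degree_mod_less[OF p(1), of f] by force
    then show ?thesis by (simp add: dvd_eq_mod_eq_0)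
  qed
  have "degree p > 0"
  proof (rule ccontr)
    assume "\<not> degree p > 0"
    then obtain c where "p = [:c:]" using degree_eq_zeroE[of p] by auto
    then show False using p cst by auto
  qed
  then have "degree (map_poly (of_rat :: rat \<Rightarrow> 'k) p) > 0"
    by (simp add: degree_map_poly)
  then obtain \<zeta> :: 'k where z: "ek \<zeta> p = 0"
    using alg_closed_imp_poly_has_root unfolding ek_def by blast
  have zf: "ek \<zeta> f = 0" if "ev \<omega> f = 0" for f
    using dvd[OF that] z by (auto elim!: dvdE)
  \<comment> \<open>The other direction of conjugacy: \<open>p\<close> has least degree, so a
    polynomial not vanishing at \<omega> is coprime to it, and a Bezout identity excludes a zero at
    \<zeta>.\<close>
  have fz: "ev \<omega> f = 0" if f: "ek \<zeta> f = 0" for f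
  proof (rule ccontr)
    assume nf: "ev \<omega> f \<noteq> 0"
    define d where "d = gcd f p"
    obtain e where e: "p = d * e" unfolding d_def by (meson dvdE gcd_dvd2)
    have "ev \<omega> d \<noteq> 0" using nf by (metis \<open>\<And>z g f. ev z (f * g) = ev z f * ev z g\<close> d_def dvdE gcd_dvd1 mult_zero_left)
    then have "ev \<omega> e = 0" using p(2) e by simp
    moreover have nz: "d \<noteq> 0" "e \<noteq> 0" using e p(1) by auto
    ultimately have "degree p \<le> degree e" using pm by blast
    then have "degree d = 0" using e nz by (simp add: degree_mult_eq)
    then obtain c where c: "d = [:c:]" "c \<noteq> 0" using degree_eq_zeroE[of d] nz by (metis pCons_0_0)
    have "ek \<zeta> d = 0"
      using bezout_coefficients_fst_snd[of f p] f z unfolding d_def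
      by (metis \<open>\<And>z g f. ek z (f + g) = ek z f + ek z g\<close> \<open>\<And>z g f. ek z (f * g) = ek z f * ek z g\<close> add_0 mult_zero_right)
    then show False using c cst by simp
  qed
  have "\<zeta> ^ M = 1"
    using zf[OF f0(2)] by (simp add: f0_def mon cst)
  moreover have "inj_on (\<lambda>i. \<zeta> ^ i) {..<M}"
  proof (rule inj_onI)
    fix i j assume ij: "i \<in> {..<M}" "j \<in> {..<M}" "\<zeta> ^ i = \<zeta> ^ j"
    have "ek \<zeta> (monom 1 i - monom 1 j) = 0"
      using ij by (simp add: ek_def map_poly_of_rat_hom map_poly_monom poly_monom)
    from fz[OF this] have "\<omega> ^ i = \<omega> ^ j"
      by (simp add: ev_def map_poly_of_rat_hom map_poly_monom poly_monom)
    then show "i = j" using inj\<omega> ij by auto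
  qed
  moreover have "(\<Sum>x\<in>E. \<omega> ^ e x) = 0" if "finite E" "(\<Sum>x\<in>E. \<zeta> ^ e x) = 0" for E and e :: "'b \<Rightarrow> nat"
  proof -
    have "ek \<zeta> (\<Sum>x\<in>E. monom 1 (e x)) = (\<Sum>x\<in>E. \<zeta> ^ e x)" "ev \<omega> (\<Sum>x\<in>E. monom 1 (e x)) = (\<Sum>x\<in>E. \<omega> ^ e x)"
      using that(1) by (induction E rule: finite_induct) (simp_all add: mon, simp_all add: ek_def ev_def)
    then show ?thesis using fz that(2) by metis
  qed
  ultimately show ?thesis by blast
qed

text \<open>The source of positivity: over an equivalence relation the double sum splits into
  classes, and each class gives a complex number times its conjugate.\<close>

lemma sum_equiv_rel:
  fixes f :: "'y \<Rightarrow> complex"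
  assumes "finite Y" "equiv Y E"
  shows "(\<Sum>(y, z)\<in>E. f z * cnj (f y)) = (\<Sum>A\<in>Y // E. of_real ((cmod (\<Sum>y\<in>A. f y))\<^sup>2))"
proof -
  have E: "E = (\<Union>A\<in>Y // E. A \<times> A)"
  proof (intro equalityI subsetI)
    fix x assume "x \<in> E"
    then obtain y z where x: "x = (y, z)" "(y, z) \<in> E" by (cases x) auto
    then have "y \<in> Y" using equiv_type[OF assms(2)] by auto
    then show "x \<in> (\<Union>A\<in>Y // E. A \<times> A)"
      using x equiv_class_self[OF assms(2)] by (auto intro!: bexI[of _ "E `` {y}"] quotientI)
  next
    fix x assume "x \<in> (\<Union>A\<in>Y // E. A \<times> A)"
    then show "x \<in> E" using quotient_eq_iff[OF assms(2)] by auto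
  qed
  have fin: "finite (Y // E)" "\<And>A. A \<in> Y // E \<Longrightarrow> finite A"
    using assms equiv_type[OF assms(2)] by (auto intro: finite_quotient finite_equiv_class)
  have "(\<Sum>x\<in>E. (case x of (y, z) \<Rightarrow> f z * cnj (f y))) = (\<Sum>A\<in>Y // E. \<Sum>x\<in>A \<times> A. (case x of (y, z) \<Rightarrow> f z * cnj (f y)))"
    by (subst E, rule sum.UNION_disjoint)
      (use fin quotient_disj[OF assms(2)] in \<open>auto\<close>)
  also have "\<dots> = (\<Sum>A\<in>Y // E. of_real ((cmod (\<Sum>y\<in>A. f y))\<^sup>2))"
  proof (rule sum.cong[OF refl])
    fix A assume "A \<in> Y // E"
    have "(\<Sum>x\<in>A \<times> A. (case x of (y, z) \<Rightarrow> f z * cnj (f y))) = (\<Sum>z\<in>A. f z) * cnj (\<Sum>y\<in>A. f y)"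
      by (simp add: sum.cartesian_product[symmetric] sum_product) (rule sum.swap)
    also have "\<dots> = of_real ((cmod (\<Sum>y\<in>A. f y))\<^sup>2)"
      by (rule complex_norm_square[symmetric])
    finally show "(\<Sum>x\<in>A \<times> A. (case x of (y, z) \<Rightarrow> f z * cnj (f y))) = of_real ((cmod (\<Sum>y\<in>A. f y))\<^sup>2)" .
  qed
  finally show ?thesis .
qed

section \<open>The trace of the squared antipode\<close>

locale haar_ac = haar_integral H lam L
  for H :: "('k::{alg_closed_field, field_char_0}, 'h::ab_group_add) hopf" (structure) and lam L
begin

notation conv (infixl "\<star>" 70)

text \<open>\<open>B p q c\<close> is the corner \<open>p K q\<close> of the eigenspace of \<open>Q\<close> for the eigenvalue \<open>c\<close>.\<close>

definition B :: "('h \<Rightarrow> 'k) \<Rightarrow> ('h \<Rightarrow> 'k) \<Rightarrow> 'k \<Rightarrow> ('h \<Rightarrow> 'k) set"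
  where "B p q c = {x\<in>K. p \<star> x = x \<and> x \<star> q = x \<and> Q x = fsc c x}"

lemma BD: "x \<in> B p q c \<Longrightarrow> x \<in> K" "x \<in> B p q c \<Longrightarrow> p \<star> x = x" "x \<in> B p q c \<Longrightarrow> x \<star> q = x"
    "x \<in> B p q c \<Longrightarrow> Q x = fsc c x"
  by (auto simp: B_def)

lemma B_mult:
  assumes "p \<in> K" "q \<in> K" "r \<in> K" "x \<in> B p q c" "y \<in> B q r d"
  shows "x \<star> y \<in> B p r (c * d)"
  using assms unfolding B_def
  by (simp add: Q_conv conv_scale_left conv_scale_right conv_assoc mult.commute)
    (simp add: fsc_def mult.assoc flip: conv_assoc)

lemma B_closed:
  assumes "x \<in> B p q c" "y \<in> B p q c"
  shows "x + y \<in> B p q c" "x - y \<in> B p q c" "fsc a x \<in> B p q c"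
  using assms unfolding B_def
  by (auto simp: conv_add_left conv_add_right conv_diff_left conv_diff_right conv_scale_left
      conv_scale_right Q_linear fv.scale_right_distrib fv.scale_right_diff_distrib mult.commute)

lemma Q_pow_K: "\<phi> \<in> K \<Longrightarrow> (Q ^^ m) \<phi> \<in> K"
  by (induction m) auto

lemma Q_pow_conv: "\<phi> \<in> K \<Longrightarrow> \<psi> \<in> K \<Longrightarrow> (Q ^^ m) (\<phi> \<star> \<psi>) = (Q ^^ m) \<phi> \<star> (Q ^^ m) \<psi>"
  by (induction m) (auto simp: Q_conv Q_pow_K)

lemma Q_pow_fsc: "(Q ^^ m) (fsc c \<phi>) = fsc c ((Q ^^ m) \<phi>)"
  by (induction m) (simp_all only: Q_linear funpow.simps comp_apply id_apply)

lemma Q_pow_eigen: "Q x = fsc c x \<Longrightarrow> (Q ^^ m) x = fsc (c ^ m) x"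
  by (induction m) (simp_all add: Q_linear mult.commute)

lemma Q_sum: "Q (\<Sum>i\<in>I. f i) = (\<Sum>i\<in>I. Q (f i))"
  by (induction I rule: infinite_finite_induct) (simp_all only: Q_linear sum.infinite sum.empty sum.insert not_False_eq_True)

end

section \<open>Eigenspaces of the squared antipode and a maximal family of invariant
  idempotents\<close>

locale haar_order = haar_ac H lam L
  for H :: "('k::{alg_closed_field, field_char_0}, 'h::ab_group_add) hopf" (structure) and lam L +
  fixes M :: nat
  assumes M: "M > 0" and Q_M: "\<phi> \<in> K \<Longrightarrow> (Q ^^ M) \<phi> = \<phi>"
begin

notation conv (infixl "\<star>" 70)

text \<open>For \<open>c ^ M = 1\<close> this is the spectral projection onto the eigenspace of
  \<open>Q\<close> for \<open>c\<close>, by averaging over the cyclic group generated by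
  \<open>Q\<close>.\<close>

definition proj :: "'k \<Rightarrow> ('h \<Rightarrow> 'k) \<Rightarrow> 'h \<Rightarrow> 'k"
  where "proj c \<phi> = fsc (1 / of_nat M) (\<Sum>j<M. fsc ((1 / c) ^ j) ((Q ^^ j) \<phi>))"

lemma proj_K: "\<phi> \<in> K \<Longrightarrow> proj c \<phi> \<in> K"
  unfolding proj_def by (intro K_closed K_sum Q_pow_K)

lemma proj_eigen:
  assumes p: "\<phi> \<in> K" and c: "c ^ M = 1"
  shows "Q (proj c \<phi>) = fsc c (proj c \<phi>)"
proof -
  have c0: "c \<noteq> 0" using c M by (cases M) auto
  define g where "g j = fsc ((1 / c) ^ j) ((Q ^^ j) \<phi>)" for j
  have gM: "g M = g 0" using Q_M[OF p] c by (simp add: g_def power_one_over)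
  have sh: "(\<Sum>j<M. g (Suc j)) = (\<Sum>j<M. g j)"
    using sum.lessThan_Suc[of g M] sum.lessThan_Suc_shift[of g M] gM by (simp add: add.commute)
  have "Q (\<Sum>j<M. g j) = (\<Sum>j<M. fsc c (g (Suc j)))"
    unfolding Q_sum using c0 by (intro sum.cong refl) (simp add: g_def Q_linear)
  also have "\<dots> = fsc c (\<Sum>j<M. g j)"
    by (simp add: sh flip: fv.scale_sum_right)
  finally show ?thesis
    by (simp add: proj_def Q_linear g_def mult.commute)
qed

lemma proj_of_eigen: assumes "Q x = fsc c x" "c \<noteq> 0" shows "proj c x = x"
  unfolding proj_def Q_pow_eigen[OF assms(1)] fv.scale_scale
  using M assms(2) by (simp add: power_one_over fun_eq_iff)

lemma proj_conv:
  assumes "p \<in> K" "q \<in> K" "Q p = p" "Q q = q" "\<phi> \<in> K"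
  shows "proj c (p \<star> \<phi> \<star> q) = p \<star> proj c \<phi> \<star> q"
proof -
  have e: "(Q ^^ j) p = p" "(Q ^^ j) q = q" for j
    using assms by (induction j) auto
  show ?thesis
    unfolding proj_def using assms
    by (simp add: conv_scale_left conv_scale_right conv_sum_left conv_sum_right Q_pow_conv e)
qed

lemma proj_linear: "proj c (\<phi> + \<psi>) = proj c \<phi> + proj c \<psi>" "proj c (fsc a \<phi>) = fsc a (proj c \<phi>)"
proof -
  have "(Q ^^ j) (\<phi> + \<psi>) = (Q ^^ j) \<phi> + (Q ^^ j) \<psi>" for j
    by (induction j) (simp_all only: Q_linear funpow.simps comp_apply id_apply)
  then show "proj c (\<phi> + \<psi>) = proj c \<phi> + proj c \<psi>"
    by (simp add: proj_def fv.scale_right_distrib sum.distrib)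
  show "proj c (fsc a \<phi>) = fsc a (proj c \<phi>)"
    by (simp add: proj_def Q_pow_fsc fun_eq_iff sum_distrib_left mult_ac)
qed

text \<open>Applying \<open>Q ^^ j\<close> to \<open>x \<star> y \<star> x = x\<close> shows that
  \<open>(Q ^^ j) y\<close> between two factors \<open>x\<close> gives \<open>(1 / c) ^ j\<close>
  times \<open>x\<close>. The weights \<open>c ^ j\<close> of \<open>proj (1 / c)\<close> cancel
  these factors, so the projected quasi-inverse still works.\<close>

lemma homogeneous_regular:
  assumes pq: "p \<in> K" "q \<in> K" "Q p = p" "Q q = q" "p \<star> p = p" "q \<star> q = q"
    and x: "x \<in> B p q c" and c: "c ^ M = 1"
  shows "\<exists>y\<in>B q p (1 / c). x \<star> y \<star> x = x"
proof -
  note xD = BD[OF x]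
  have c0: "c \<noteq> 0" using c M by (cases M) auto
  obtain y where y: "y \<in> K" "x \<star> y \<star> x = x" using regular[OF xD(1)] by blast
  have xyx: "x \<star> (Q ^^ j) y \<star> x = fsc ((1 / c) ^ j) x" for j
  proof -
    have "fsc (c ^ j) x = (Q ^^ j) (x \<star> y \<star> x)" using y xD by (simp add: Q_pow_eigen[OF xD(4)])
    also have "\<dots> = fsc (c ^ j * c ^ j) (x \<star> (Q ^^ j) y \<star> x)"
      using y(1) xD(1) by (simp add: Q_pow_conv Q_pow_eigen[OF xD(4)] conv_scale_left conv_scale_right)
    finally have "fsc (1 / (c ^ j * c ^ j)) (fsc (c ^ j) x)
      = fsc (1 / (c ^ j * c ^ j)) (fsc (c ^ j * c ^ j) (x \<star> (Q ^^ j) y \<star> x))" by simp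
    then show ?thesis using c0 by (simp add: power_one_over)
  qed
  define z where "z = proj (1 / c) (q \<star> y \<star> p)"
  have zc: "(1 / c) ^ M = 1" using c by (simp add: power_one_over)
  have zq: "z = q \<star> proj (1 / c) y \<star> p" unfolding z_def using pq y by (simp add: proj_conv)
  have pj: "proj (1 / c) y \<in> K" using y by (simp add: proj_K)
  have "z \<in> B q p (1 / c)"
    using proj_eigen[OF _ zc, of "q \<star> y \<star> p"] pq y pj unfolding B_def z_def[symmetric]
    by (simp add: zq conv_assoc) (simp add: pj pq flip: conv_assoc)
  moreover have "x \<star> z \<star> x = x"
  proof -
    have "x \<star> z \<star> x = (x \<star> q) \<star> proj (1 / c) y \<star> (p \<star> x)"
      using pq pj xD(1) by (simp add: zq conv_assoc)
    also have "\<dots> = x \<star> proj (1 / c) y \<star> x" by (simp add: xD)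
    also have "\<dots> = fsc (1 / of_nat M) (\<Sum>j<M. fsc (c ^ j) (x \<star> (Q ^^ j) y \<star> x))"
      unfolding proj_def by (simp add: conv_scale_left conv_scale_right conv_sum_left conv_sum_right)
    also have "\<dots> = x" using M c0 by (simp add: xyx power_one_over fun_eq_iff)
    finally show ?thesis .
  qed
  ultimately show ?thesis by blast
qed

text \<open>Complete families of orthogonal idempotents fixed by \<open>Q\<close>. Membership of
  \<open>lam\<close> is imposed to keep one corner whose contribution to the trace is known.\<close>

definition family :: "('h \<Rightarrow> 'k) set \<Rightarrow> bool"
  where "family P \<longleftrightarrow> finite P \<and> P \<subseteq> K \<and> lam \<in> P \<and> (\<forall>p\<in>P. p \<noteq> 0 \<and> p \<star> p = p \<and> Q p = p) \<and>
    (\<forall>p\<in>P. \<forall>q\<in>P. p \<noteq> q \<longrightarrow> p \<star> q = 0) \<and> (\<Sum>p\<in>P. p) = eps"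

lemma family_card: "\<exists>N. \<forall>P. family P \<longrightarrow> card P \<le> N"
proof -
  obtain Bs where Bs: "finite Bs" "K = fv.span Bs" using K_fin by blast
  have "card P \<le> card Bs" if P: "family P" for P
  proof -
    have f: "finite P" and PK: "P \<subseteq> K" using P by (auto simp: family_def)
    have "fv.independent P"
    proof
      assume "fv.dependent P"
      then obtain u where u: "\<exists>p\<in>P. u p \<noteq> 0" "(\<Sum>p\<in>P. fsc (u p) p) = 0"
        using fv.dependent_finite[OF f] by blast
      then obtain p where p: "p \<in> P" "u p \<noteq> 0" by blast
      have "0 = p \<star> (\<Sum>q\<in>P. fsc (u q) q)" using u by simp
      also have "\<dots> = (\<Sum>q\<in>P. if q = p then fsc (u p) p else 0)"
        unfolding conv_sum_right conv_scale_right
        using P p by (intro sum.cong refl) (auto simp: family_def)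
      also have "\<dots> = fsc (u p) p" using f p by simp
      finally have "fsc (u p) p = 0" by simp
      then show False using p P fv.scale_eq_0_iff by (auto simp: family_def)
    qed
    then show ?thesis using fv.independent_span_bound[OF Bs(1)] PK Bs(2) by blast
  qed
  then show ?thesis by blast
qed

lemma lam_idem: "lam \<star> lam = lam"
  by (simp add: lam_conv)

lemma lam_nz: "lam \<noteq> 0"
  using lam_one by (metis zero_fun_apply zero_neq_one)

lemma ex_family: "\<exists>P. family P"
proof (cases "eps = lam")
  case True
  then have "family {lam}" by (simp add: family_def lam_idem lam_nz Q_lam)
  then show ?thesis by blast
next
  case False
  then have "eps - lam \<noteq> lam"
    using lam_idem lam_nz by (metis add_diff_cancel conv_diff_left conv_eps(1) diff_add_cancel diff_self lam_K)
  then have "family {lam, eps - lam}"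
    using False by (auto simp: family_def lam_idem lam_nz Q_lam conv_diff_left conv_diff_right Q_linear Q_eps)
  then show ?thesis by blast
qed

definition P :: "('h \<Rightarrow> 'k) set"
  where "P = (ARG_MAX card P. family P)"

lemma P: "family P" and P_max: "family P' \<Longrightarrow> card P' \<le> card P"
proof -
  obtain N where N: "\<And>P. family P \<Longrightarrow> card P \<le> N" using family_card by blast
  obtain P0 where P0: "family P0" using ex_family by blast
  have *: "\<forall>y. family y \<longrightarrow> card y < Suc N" using N le_imp_less_Suc by blast
  show "family P" unfolding P_def by (rule arg_max_natI[OF P0 *])
  show "card P' \<le> card P" if "family P'" unfolding P_def by (rule arg_max_nat_le[OF that *])
qed

lemma PD: "finite P" "p \<in> P \<Longrightarrow> p \<in> K" "lam \<in> P" "p \<in> P \<Longrightarrow> p \<noteq> 0" "p \<in> P \<Longrightarrow> p \<star> p = p"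
    "p \<in> P \<Longrightarrow> Q p = p" "p \<in> P \<Longrightarrow> q \<in> P \<Longrightarrow> p \<noteq> q \<Longrightarrow> p \<star> q = 0" "(\<Sum>p\<in>P. p) = eps"
  using P by (auto simp: family_def)

text \<open>Splitting \<open>p\<close> into \<open>e\<close> and \<open>p - e\<close> would give a
  larger family. The case \<open>p = lam\<close> is separate, since \<open>lam\<close> must stay in
  the family: there \<open>e\<close> is a multiple of \<open>lam\<close>.\<close>

lemma primitive:
  assumes p: "p \<in> P" and e: "e \<in> B p p 1" "e \<star> e = e"
  shows "e = 0 \<or> e = p"
proof (rule ccontr)
  assume "\<not> ?thesis"
  then have ne: "e \<noteq> 0" "e \<noteq> p" by auto
  note eD = BD[OF e(1)]
  have pK: "p \<in> K" using PD(2) p .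
  have Qe: "Q e = e" using eD(4) by simp
  have pl: "p \<noteq> lam"
  proof
    assume "p = lam"
    then have 1: "e = fsc (e \<one>) lam" using eD(2) lam_conv[OF eD(1)] by simp
    have "e \<one> * e \<one> = e \<one>" using conv_one[OF eD(1) eD(1)] e(2) by simp
    then have "e \<one> = 0 \<or> e \<one> = 1" by auto
    then show False using ne 1 \<open>p = lam\<close> by auto
  qed
  define f where "f = p - e"
  have fK: "f \<in> K" and fe: "f \<star> e = 0" "e \<star> f = 0" "f \<star> f = f" "p \<star> f = f" "f \<star> p = f" "Q f = f" "f \<noteq> 0"
    using ne pK eD e(2) Qe PD(5,6)[OF p]
    by (auto simp: f_def conv_diff_left conv_diff_right Q_linear)
  have ef: "e \<noteq> f" using fe ne e(2) by auto
  have orth: "e \<star> q = 0" "q \<star> e = 0" "f \<star> q = 0" "q \<star> f = 0" if "q \<in> P" "q \<noteq> p" for q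
  proof -
    have qK: "q \<in> K" using PD(2) that by blast
    have pq: "p \<star> q = 0" "q \<star> p = 0" using PD(7) that p by blast+
    have "e \<star> q = e \<star> (p \<star> q)" using eD pK qK by (simp flip: conv_assoc)
    then show "e \<star> q = 0" by (simp add: pq)
    have "q \<star> e = q \<star> p \<star> e" using eD pK qK by (simp add: conv_assoc)
    then show "q \<star> e = 0" by (simp add: pq)
    have "f \<star> q = f \<star> (p \<star> q)" using fe fK pK qK by (simp flip: conv_assoc)
    then show "f \<star> q = 0" by (simp add: pq)
    have "q \<star> f = q \<star> p \<star> f" using fe fK pK qK by (simp add: conv_assoc)
    then show "q \<star> f = 0" by (simp add: pq)
  qed
  have nP: "e \<notin> P - {p}" "f \<notin> P - {p}"
    using orth(1)[of e] orth(3)[of f] e(2) fe ne by auto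
  let ?P = "insert e (insert f (P - {p}))"
  have "(\<Sum>q\<in>?P. q) = e + (f + (\<Sum>q\<in>P - {p}. q))"
    using nP ef PD(1) by simp
  also have "\<dots> = p + (\<Sum>q\<in>P - {p}. q)" by (simp add: f_def)
  also have "\<dots> = eps" using PD(8) sum.remove[OF PD(1) p, of "\<lambda>q. q"] by simp
  finally have sum: "(\<Sum>q\<in>?P. q) = eps" .
  have idem: "q \<noteq> 0 \<and> q \<star> q = q \<and> Q q = q" if "q \<in> ?P" for q
    using that PD(4,5,6) fe ne e(2) Qe by blast
  have disj: "q \<star> r = 0" if "q \<in> ?P" "r \<in> ?P" "q \<noteq> r" for q r
    using that PD(7) fe(1,2) orth by blast
  have "family ?P"
    unfolding family_def
  proof (intro conjI ballI impI)
    show "?P \<subseteq> K" using PD(2) fK eD(1) by blast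
    show "finite ?P" "lam \<in> ?P" using PD(1,3) pl by auto
    show "(\<Sum>q\<in>?P. q) = eps" by (rule sum)
  next
    fix q assume q: "q \<in> ?P"
    show "q \<noteq> 0" "q \<star> q = q" "Q q = q" using idem[OF q] by blast+
  next
    fix q r assume "q \<in> ?P" "r \<in> ?P" "q \<noteq> r"
    then show "q \<star> r = 0" by (rule disj)
  qed
  moreover have "card ?P = Suc (card P)"
  proof -
    have "card ?P = Suc (Suc (card (P - {p})))" using nP ef PD(1) by simp
    then show ?thesis using card_Suc_Diff1[OF PD(1) p] by simp
  qed
  ultimately show False using P_max by fastforce
qed

lemma P_B: "p \<in> P \<Longrightarrow> p \<in> B p p 1"
  using PD by (auto simp: B_def)

text \<open>For a homogeneous quasi-inverse \<open>y\<close>, the products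
  \<open>x \<star> y\<close> and \<open>y \<star> x\<close> are nonzero \<open>Q\<close>-fixed
  idempotents in the corners at \<open>p\<close> and \<open>q\<close>, so primitivity makes them the
  units.\<close>

lemma corner_inverse:
  assumes p: "p \<in> P" and q: "q \<in> P" and x: "x \<in> B p q c" "x \<noteq> 0" and c: "c ^ M = 1"
  shows "\<exists>y\<in>B q p (1 / c). x \<star> y = p \<and> y \<star> x = q"
proof -
  have c0: "c \<noteq> 0" using c M by (cases M) auto
  obtain y where y: "y \<in> B q p (1 / c)" "x \<star> y \<star> x = x"
    using homogeneous_regular[OF PD(2)[OF p] PD(2)[OF q] PD(6)[OF p] PD(6)[OF q] PD(5)[OF p] PD(5)[OF q] x(1) c]
    by blast
  note K' = BD(1)[OF x(1)] BD(1)[OF y(1)]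
  have "x \<star> y \<in> B p p (c * (1 / c))" using B_mult[OF _ _ _ x(1) y(1)] PD(2) p q by blast
  then have 1: "x \<star> y \<in> B p p 1" using c0 by simp
  have "y \<star> x \<in> B q q (1 / c * c)" using B_mult[OF _ _ _ y(1) x(1)] PD(2) p q by blast
  then have 2: "y \<star> x \<in> B q q 1" using c0 by simp
  have "x \<star> y \<star> (x \<star> y) = x \<star> y" "y \<star> x \<star> (y \<star> x) = y \<star> x"
    using y(2) K' by (simp_all flip: conv_assoc) (simp_all add: conv_assoc)
  moreover have "x \<star> y \<noteq> 0" using x(2) y(2) by auto
  moreover have "y \<star> x \<noteq> 0" using x(2) y(2) K' by (auto simp: conv_assoc)
  ultimately show ?thesis using primitive[OF p 1] primitive[OF q 2] y by blast
qed

end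

section \<open>Homogeneous corners are at most one-dimensional\<close>

context haar_order
begin

text \<open>The value of \<open>f\<close> at \<open>x\<close> by Horner's scheme in the corner
  \<open>p K p\<close>, whose unit is \<open>p\<close>.\<close>

definition peval :: "('h \<Rightarrow> 'k) \<Rightarrow> ('h \<Rightarrow> 'k) \<Rightarrow> 'k poly \<Rightarrow> 'h \<Rightarrow> 'k"
  where "peval p x f = fold_coeffs (\<lambda>a r. fsc a p + x \<star> r) f 0"

lemma peval_0 [simp]: "peval p x 0 = 0"
  by (simp add: peval_def)

lemma peval_pCons [simp]: "peval p x (pCons a f) = fsc a p + x \<star> peval p x f"
  by (cases "a = 0 \<and> f = 0") (auto simp: peval_def)

lemma peval_add: "peval p x (f + g) = peval p x f + peval p x g"
proof (induction f g rule: poly_induct2)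
  case (pCons a f b g)
  then show ?case
    by (simp only: add_pCons peval_pCons pCons conv_add_right fv.scale_left_distrib) (simp only: ac_simps)
qed simp

lemma peval_smult: "peval p x (smult c f) = fsc c (peval p x f)"
proof (induction f)
  case (pCons a f)
  then show ?case
    by (simp only: smult_pCons peval_pCons pCons conv_scale_right fv.scale_right_distrib fv.scale_scale)
qed (simp add: fv.scale_zero_right)

lemma peval_K:
  assumes "p \<in> K" "x \<in> K" "p \<star> p = p" "p \<star> x = x"
  shows "peval p x f \<in> K" "p \<star> peval p x f = peval p x f"
proof -
  have "peval p x f \<in> K \<and> p \<star> peval p x f = peval p x f"
  proof (induction f)
    case (pCons a f)
    have "p \<star> (x \<star> peval p x f) = x \<star> peval p x f"
      using pCons assms by (simp flip: conv_assoc)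
    moreover have "x \<star> peval p x f \<in> K" using pCons assms by simp
    ultimately show ?case using assms
      by (simp only: peval_pCons conv_add_right conv_scale_right K_closed simp_thms)
  qed (simp only: peval_0 conv_zero K_closed simp_thms)
  then show "peval p x f \<in> K" "p \<star> peval p x f = peval p x f" by auto
qed

lemma peval_dependent:
  assumes "p \<in> K" "x \<in> K" "p \<star> p = p" "p \<star> x = x"
  shows "\<exists>f. f \<noteq> 0 \<and> peval p x f = 0"
proof (cases "inj (\<lambda>i. peval p x (monom 1 i))")
  case False
  then obtain i j where ij: "peval p x (monom 1 i) = peval p x (monom 1 j)" "i \<noteq> j"
    by (auto simp: inj_def)
  have "coeff (monom 1 i + smult (-1) (monom 1 j) :: 'k poly) i = 1" using ij(2)[symmetric] by simp
  then have "monom 1 i + smult (-1) (monom 1 j) \<noteq> (0 :: 'k poly)" by (metis coeff_0 zero_neq_one)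
  moreover have "peval p x (monom 1 i + smult (-1) (monom 1 j)) = 0"
    by (simp only: peval_add peval_smult ij) simp
  ultimately show ?thesis by blast
next
  case True
  obtain Bs where Bs: "finite Bs" "K = fv.span Bs" using K_fin by blast
  define A where "A = (\<lambda>i. peval p x (monom 1 i)) ` {..card Bs}"
  have io: "inj_on (\<lambda>i. peval p x (monom 1 i)) {..card Bs}"
    using True by (rule inj_on_subset) simp
  have ca: "card A = Suc (card Bs)" "finite A"
    unfolding A_def by (simp_all add: card_image[OF io])
  have "fv.dependent A"
  proof (rule ccontr)
    assume "\<not> fv.dependent A"
    moreover have "A \<subseteq> fv.span Bs" using peval_K[OF assms] Bs(2) by (auto simp: A_def)
    ultimately have "card A \<le> card Bs" using fv.independent_span_bound[OF Bs(1)] by blast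
    then show False using ca by simp
  qed
  then obtain u where u: "\<exists>v\<in>A. u v \<noteq> 0" "(\<Sum>v\<in>A. fsc (u v) v) = 0"
    using fv.dependent_finite[OF ca(2)] by blast
  define c where "c i = u (peval p x (monom 1 i))" for i
  define f where "f = (\<Sum>i\<le>card Bs. smult (c i) (monom 1 i))"
  have "peval p x f = (\<Sum>i\<le>card Bs. fsc (c i) (peval p x (monom 1 i)))"
  proof -
    have "peval p x (\<Sum>i\<in>I. smult (c i) (monom 1 i)) = (\<Sum>i\<in>I. fsc (c i) (peval p x (monom 1 i)))"
      if "finite I" for I
      using that by (induction I rule: finite_induct) (simp_all only: sum.insert sum.empty peval_0 peval_add peval_smult not_False_eq_True)
    then show ?thesis by (simp add: f_def)
  qed
  also have "\<dots> = (\<Sum>v\<in>A. fsc (u v) v)"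
    unfolding A_def c_def sum.reindex[OF io] by (simp only: o_def)
  finally have "peval p x f = 0" using u by simp
  moreover have "f \<noteq> 0"
  proof -
    obtain i where i: "i \<le> card Bs" "c i \<noteq> 0" using u(1) by (auto simp: A_def c_def)
    have "coeff f i = (\<Sum>j\<le>card Bs. if j = i then c i else 0)"
      unfolding f_def coeff_sum by (intro sum.cong refl) simp
    then show ?thesis using i by auto
  qed
  ultimately show ?thesis by blast
qed

text \<open>The \<open>Q\<close>-fixed part of the corner is a finite-dimensional division algebra
  over an algebraically closed field. A linear factor of an annihilating polynomial either vanishes
  at \<open>x\<close> or is invertible there and can be cancelled.\<close>

lemma corner_scalar:
  assumes p: "p \<in> P" and x: "x \<in> B p p 1"
  shows "\<exists>c. x = fsc c p"
proof -
  note xD = BD[OF x]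
  note A = PD(2)[OF p] xD(1) PD(5)[OF p] xD(2)
  have "\<exists>c. x = fsc c p" if "f \<noteq> 0" "peval p x f = 0" for f
    using that
  proof (induction "degree f" arbitrary: f rule: less_induct)
    case less
    show ?case
    proof (cases "degree f = 0")
      case True
      then obtain a where a: "f = [:a:]" using degree_eq_zeroE by blast
      then have "fsc a p = 0" using less.prems(2) by simp
      then have "a = 0" using fv.scale_eq_0_iff[of a p] PD(4)[OF p] by blast
      then show ?thesis using a less.prems(1) by simp
    next
      case False
      then obtain c where "poly f c = 0" using alg_closed_imp_poly_has_root by blast
      then obtain g where g: "f = [:-c, 1:] * g" using poly_eq_0_iff_dvd by (blast elim: dvdE)
      have gn: "g \<noteq> 0" using g less.prems(1) by auto
      have "degree f = degree [:-c, 1:] + degree g"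
        unfolding g by (rule degree_mult_eq) (use gn in auto)
      then have dg: "degree g < degree f" by simp
      have f: "f = smult (-c) g + pCons 0 g" using g by simp
      have "peval p x f = x \<star> peval p x g - fsc c (peval p x g)"
        unfolding f peval_add peval_smult peval_pCons by (simp add: fv.scale_minus_left)
      also have "\<dots> = (x - fsc c p) \<star> peval p x g"
        using peval_K(2)[OF A] by (simp add: conv_diff_left conv_scale_left)
      finally have z: "(x - fsc c p) \<star> peval p x g = 0" using less.prems(2) by simp
      show ?thesis
      proof (cases "x - fsc c p = 0")
        case True
        then show ?thesis by (metis right_minus_eq)
      next
        case False
        have b: "x - fsc c p \<in> B p p 1" by (rule B_closed(2)[OF x B_closed(3)[OF P_B[OF p] P_B[OF p]]])
        obtain y where y: "y \<in> B p p (1 / 1 :: 'k)" "y \<star> (x - fsc c p) = p"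
          using corner_inverse[OF p p b False power_one] by blast
        have "peval p x g = y \<star> (x - fsc c p) \<star> peval p x g"
          unfolding y(2) peval_K(2)[OF A] ..
        also have "\<dots> = 0"
          using BD(1)[OF y(1)] BD(1)[OF b] peval_K(1)[OF A] z by (simp add: conv_assoc)
        finally show ?thesis using less.hyps[OF dg gn] by blast
      qed
    qed
  qed
  then show ?thesis using peval_dependent[OF A] by blast
qed

text \<open>The inverse of \<open>x\<close> carries \<open>y\<close> into the scalar corner at
  \<open>p\<close>.\<close>

lemma corner_one_dim:
  assumes p: "p \<in> P" and q: "q \<in> P" and x: "x \<in> B p q c" "x \<noteq> 0" and c: "c ^ M = 1"
    and y: "y \<in> B p q c"
  shows "\<exists>a. y = fsc a x"
proof -
  have c0: "c \<noteq> 0" using c M by (cases M) auto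
  obtain z where z: "z \<in> B q p (1 / c)" "z \<star> x = q"
    using corner_inverse[OF p q x c] by blast
  have "y \<star> z \<in> B p p (c * (1 / c))" using B_mult[OF _ _ _ y z(1)] PD(2) p q by blast
  then obtain a where a: "y \<star> z = fsc a p" using corner_scalar[OF p] c0 by auto
  have "y = y \<star> z \<star> x"
    using BD[OF y] BD[OF z(1)] BD[OF x(1)] z(2) by (simp add: conv_assoc)
  also have "\<dots> = fsc a x" unfolding a using BD[OF x(1)] by (simp add: conv_scale_left)
  finally show ?thesis by blast
qed

text \<open>The trace of \<open>Q\<close> after projection onto \<open>B p q c\<close>: the image is
  at most one-dimensional and \<open>Q\<close> acts on it by \<open>c\<close>.\<close>

lemma corner_trace:
  assumes T: "T \<subseteq> C" and I: "interp K T w" and p: "p \<in> P" and q: "q \<in> P" and c: "c ^ M = 1"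
  shows "(\<Sum>t\<in>T. Q (proj c (p \<star> w t \<star> q)) t) = (if \<exists>x\<in>B p q c. x \<noteq> 0 then c else 0)"
proof -
  have c0: "c \<noteq> 0" using c M by (cases M) auto
  have pjB: "proj c (p \<star> \<phi> \<star> q) \<in> B p q c" if \<phi>: "\<phi> \<in> K" for \<phi>
  proof -
    have e: "proj c (p \<star> \<phi> \<star> q) = p \<star> proj c \<phi> \<star> q"
      using proj_conv PD p q \<phi> by simp
    have "Q (proj c (p \<star> \<phi> \<star> q)) = fsc c (proj c (p \<star> \<phi> \<star> q))"
      by (rule proj_eigen) (use c \<phi> PD p q in auto)
    then show ?thesis
      using PD(2,5) p q proj_K[OF \<phi>, of c] unfolding B_def e
      by (simp add: conv_assoc) (simp add: conv_assoc[symmetric])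
  qed
  have wK: "t \<in> T \<Longrightarrow> w t \<in> K" for t using interpD(2)[OF I] .
  show ?thesis
  proof (cases "\<exists>x\<in>B p q c. x \<noteq> 0")
    case True
    then obtain x where x: "x \<in> B p q c" "x \<noteq> 0" by blast
    note xD = BD[OF x(1)]
    obtain h where h: "x h \<noteq> 0" using x(2) by (metis ext zero_fun_apply)
    \<comment> \<open>The coordinate along \<open>x\<close>, read off at a point \<open>h\<close>
      where \<open>x\<close> does not vanish.\<close>
    define \<xi> where "\<xi> \<phi> = proj c (p \<star> \<phi> \<star> q) h / x h" for \<phi>
    have \<xi>: "proj c (p \<star> \<phi> \<star> q) = fsc (\<xi> \<phi>) x" if \<phi>: "\<phi> \<in> K" for \<phi>
    proof -
      obtain a where a: "proj c (p \<star> \<phi> \<star> q) = fsc a x"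
        using corner_one_dim[OF p q x c pjB[OF \<phi>]] by blast
      have "\<xi> \<phi> = a" unfolding \<xi>_def a using h by simp
      then show ?thesis using a by simp
    qed
    have xx: "p \<star> x \<star> q = x" using xD by simp
    have \<xi>x: "\<xi> x = 1" unfolding \<xi>_def xx proj_of_eigen[OF xD(4) c0] using h by simp
    have \<xi>lin: "\<xi> (\<phi> + \<psi>) = \<xi> \<phi> + \<xi> \<psi>" "\<xi> (fsc a \<phi>) = a * \<xi> \<phi>" for \<phi> \<psi> a
      by (simp_all add: \<xi>_def conv_add_left conv_add_right conv_scale_left conv_scale_right
          proj_linear add_divide_distrib)
    have \<xi>0: "\<xi> 0 = 0" using \<xi>lin(2)[of 0 0] by (simp only: fv.scale_zero_right mult_zero_left)
    have \<xi>sum: "\<xi> (\<Sum>i\<in>J. f i) = (\<Sum>i\<in>J. \<xi> (f i))" for J :: "'h set" and f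
      by (induction J rule: infinite_finite_induct) (simp_all only: \<xi>lin \<xi>0 sum.infinite sum.empty sum.insert not_False_eq_True)
    have "(\<Sum>t\<in>T. Q (proj c (p \<star> w t \<star> q)) t) = (\<Sum>t\<in>T. c * \<xi> (fsc (x t) (w t)))"
      using wK by (intro sum.cong refl) (simp add: \<xi> Q_linear xD(4) \<xi>lin)
    also have "\<dots> = c * \<xi> (\<Sum>t\<in>T. fsc (x t) (w t))"
      by (simp add: \<xi>sum sum_distrib_left)
    also have "\<dots> = c" by (simp add: interp_expand[OF I xD(1), symmetric] \<xi>x)
    finally show ?thesis using True by simp
  next
    case False
    then have "proj c (p \<star> w t \<star> q) = 0" if "t \<in> T" for t using pjB[OF wK[OF that]] by blast
    then show ?thesis using False by (simp add: Q_linear)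
  qed
qed

end

section \<open>The trace as a sum over an equivalence relation\<close>

locale haar_root = haar_order H lam L M
  for H :: "('k::{alg_closed_field, field_char_0}, 'h::ab_group_add) hopf" (structure) and lam L M +
  fixes \<zeta> :: 'k
  assumes \<zeta>M: "\<zeta> ^ M = 1" and \<zeta>_inj: "inj_on (\<lambda>i. \<zeta> ^ i) {..<M}"
begin

notation conv (infixl "\<star>" 70)

lemma \<zeta>0: "\<zeta> \<noteq> 0"
  using \<zeta>M M by (cases M) auto

lemma pow_M1: "(\<zeta> ^ l) ^ M = 1"
  by (metis \<zeta>M mult.commute power_mult power_one)

lemma pow_M: "(\<zeta> ^ l / \<zeta> ^ m) ^ M = 1"
  by (simp add: power_divide pow_M1)

text \<open>Dividing by \<open>\<zeta> ^ m\<close> only permutes the \<open>M\<close>-th roots of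
  unity, so for every shift \<open>m\<close> the eigenprojections add up to the identity.\<close>

lemma sum_proj:
  assumes p: "\<phi> \<in> K" and m: "m < M"
  shows "(\<Sum>l<M. proj (\<zeta> ^ l / \<zeta> ^ m) \<phi>) = \<phi>"
proof -
  have g: "(\<Sum>l<M. (\<zeta> ^ m / \<zeta> ^ l) ^ j) = (if j = 0 then of_nat M else 0)" if j: "j < M" for j
  proof (cases "j = 0")
    case False
    define r where "r = 1 / \<zeta> ^ j"
    have "\<zeta> ^ j \<noteq> \<zeta> ^ 0" using inj_onD[OF \<zeta>_inj, of j 0] j M False by auto
    then have r1: "r \<noteq> 1" using \<zeta>0 by (simp add: r_def)
    have "r ^ M = 1" by (simp add: r_def power_divide pow_M1)
    then have "(\<Sum>l<M. r ^ l) = 0" using geometric_sum[OF r1, of M] by simp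
    moreover have "(\<zeta> ^ m / \<zeta> ^ l) ^ j = \<zeta> ^ (m * j) * r ^ l" for l
      by (simp add: r_def power_divide power_one_over power_mult[symmetric] mult.commute)
    ultimately show ?thesis using False by (simp flip: sum_distrib_left)
  qed simp
  have "(\<Sum>l<M. proj (\<zeta> ^ l / \<zeta> ^ m) \<phi>) x = \<phi> x" for x
  proof -
    have "(\<Sum>l<M. proj (\<zeta> ^ l / \<zeta> ^ m) \<phi>) x = (\<Sum>l<M. \<Sum>j<M. (\<zeta> ^ m / \<zeta> ^ l) ^ j * (Q ^^ j) \<phi> x) / of_nat M"
      by (simp add: proj_def sum_divide_distrib)
    also have "\<dots> = (\<Sum>j<M. (\<Sum>l<M. (\<zeta> ^ m / \<zeta> ^ l) ^ j) * (Q ^^ j) \<phi> x) / of_nat M"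
      by (subst sum.swap) (simp add: sum_distrib_right)
    also have "(\<Sum>j<M. (\<Sum>l<M. (\<zeta> ^ m / \<zeta> ^ l) ^ j) * (Q ^^ j) \<phi> x) = (\<Sum>j<M. if j = 0 then of_nat M * \<phi> x else 0)"
      by (intro sum.cong refl) (simp add: g)
    also have "\<dots> = of_nat M * \<phi> x" using M by simp
    finally show ?thesis using M by simp
  qed
  then show ?thesis by (rule ext)
qed

text \<open>Isomorphism of the graded projective modules \<open>p K\<close>, shifted by \<open>m\<close>.\<close>

definition E :: "((('h \<Rightarrow> 'k) \<times> nat) \<times> (('h \<Rightarrow> 'k) \<times> nat)) set"
  where "E = {((p, m), (q, l)) |p m q l. p \<in> P \<and> q \<in> P \<and> m < M \<and> l < M \<and>
    (\<exists>x\<in>B p q (\<zeta> ^ l / \<zeta> ^ m). x \<noteq> 0)}"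

text \<open>Reflexivity comes from the units of the corners; symmetry and transitivity hold because
  nonzero homogeneous corner elements are invertible.\<close>

lemma equiv_E: "equiv (P \<times> {..<M}) E"
proof (rule equivI)
  show "refl_on (P \<times> {..<M}) E"
    unfolding refl_on_def using P_B PD(4) \<zeta>0 by (fastforce simp: E_def)
  show "E \<subseteq> (P \<times> {..<M}) \<times> (P \<times> {..<M})" by (auto simp: E_def)
  show "sym E"
  proof (rule symI)
    fix a b assume "(a, b) \<in> E"
    then obtain p m q l x where ab: "a = (p, m)" "b = (q, l)" "p \<in> P" "q \<in> P" "m < M" "l < M"
      "x \<in> B p q (\<zeta> ^ l / \<zeta> ^ m)" "x \<noteq> 0" by (auto simp: E_def)
    obtain y where y: "y \<in> B q p (1 / (\<zeta> ^ l / \<zeta> ^ m))" "x \<star> y = p"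
      using corner_inverse[OF ab(3,4,7,8) pow_M] by blast
    then have "y \<noteq> 0" using PD(4)[OF ab(3)] by auto
    then show "(b, a) \<in> E" using ab y by (auto simp: E_def)
  qed
  show "trans E"
  proof (rule transI)
    fix a b c assume "(a, b) \<in> E" "(b, c) \<in> E"
    then obtain p m q l x r n y where abc: "a = (p, m)" "b = (q, l)" "c = (r, n)" "p \<in> P" "q \<in> P" "r \<in> P"
      "m < M" "l < M" "n < M" and x: "x \<in> B p q (\<zeta> ^ l / \<zeta> ^ m)" "x \<noteq> 0"
      and y: "y \<in> B q r (\<zeta> ^ n / \<zeta> ^ l)" "y \<noteq> 0" by (auto simp: E_def)
    obtain z where z: "z \<in> B q p (1 / (\<zeta> ^ l / \<zeta> ^ m))" "z \<star> x = q"
      using corner_inverse[OF abc(4,5) x pow_M] by blast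
    have "z \<star> (x \<star> y) = y"
      using BD[OF x(1)] BD[OF y(1)] BD[OF z(1)] z(2) by (simp flip: conv_assoc)
    then have "x \<star> y \<noteq> 0" using y(2) by auto
    moreover have "x \<star> y \<in> B p r (\<zeta> ^ l / \<zeta> ^ m * (\<zeta> ^ n / \<zeta> ^ l))"
      by (rule B_mult[OF _ _ _ x(1) y(1)]) (use PD(2) abc in auto)
    ultimately show "(a, c) \<in> E" using abc \<zeta>0 by (auto simp: E_def)
  qed
qed

lemma finite_E: "finite E"
  by (rule finite_subset[OF _ finite_SigmaI[OF finite_SigmaI[OF PD(1)] finite_SigmaI[OF PD(1)]]])
    (use equiv_type[OF equiv_E] in auto)

text \<open>The trace is written once for each shift \<open>m\<close>, which gives the factor
  \<open>M\<close> and a sum over pairs in \<open>E\<close>. The exponent \<open>l + (M - m)\<close>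
  replaces \<open>l - m\<close> to stay a natural number, as the transfer to complex numbers
  requires.\<close>

lemma trace_E: "of_nat M * counit H L = (\<Sum>((p, m), (q, l))\<in>E. \<zeta> ^ (l + (M - m)))"
proof -
  obtain T w where T: "T \<subseteq> C" and I: "interp K T w" using K_interp by blast
  have wK: "t \<in> T \<Longrightarrow> w t \<in> K" for t using interpD(2)[OF I] .
  have PK: "p \<in> P \<Longrightarrow> p \<in> K" for p using PD(2) .
  let ?c = "\<lambda>m l. \<zeta> ^ l / \<zeta> ^ m"
  let ?i = "\<lambda>p m q l. if \<exists>x\<in>B p q (?c m l). x \<noteq> 0 then ?c m l else 0"
  have 1: "counit H L = (\<Sum>p\<in>P. \<Sum>q\<in>P. \<Sum>l<M. ?i p m q l)" if m: "m < M" for m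
  proof -
    have "counit H L = (\<Sum>t\<in>T. Q (w t) t)" by (rule trace_Q[OF T I, symmetric])
    also have "\<dots> = (\<Sum>t\<in>T. \<Sum>p\<in>P. \<Sum>q\<in>P. \<Sum>l<M. Q (proj (?c m l) (p \<star> w t \<star> q)) t)"
    proof (rule sum.cong[OF refl])
      fix t assume t: "t \<in> T"
      have "w t = (\<Sum>p\<in>P. p) \<star> w t \<star> (\<Sum>q\<in>P. q)" using wK[OF t] PD(8) by simp
      also have "\<dots> = (\<Sum>p\<in>P. \<Sum>q\<in>P. p \<star> w t \<star> q)"
        by (simp only: conv_sum_left conv_sum_right) (rule sum.swap)
      also have "\<dots> = (\<Sum>p\<in>P. \<Sum>q\<in>P. \<Sum>l<M. proj (?c m l) (p \<star> w t \<star> q))"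
        using wK[OF t] PK m by (intro sum.cong refl) (simp only: sum_proj conv_K)
      finally have "Q (w t) = Q (\<Sum>p\<in>P. \<Sum>q\<in>P. \<Sum>l<M. proj (?c m l) (p \<star> w t \<star> q))" by (rule arg_cong)
      then show "Q (w t) t = (\<Sum>p\<in>P. \<Sum>q\<in>P. \<Sum>l<M. Q (proj (?c m l) (p \<star> w t \<star> q)) t)"
        by (simp only: Q_sum sum_fun_apply)
    qed
    also have "\<dots> = (\<Sum>p\<in>P. \<Sum>q\<in>P. \<Sum>l<M. \<Sum>t\<in>T. Q (proj (?c m l) (p \<star> w t \<star> q)) t)"
      by (simp only: sum.swap[of _ _ T])
    also have "\<dots> = (\<Sum>p\<in>P. \<Sum>q\<in>P. \<Sum>l<M. ?i p m q l)"
      by (intro sum.cong refl corner_trace[OF T I _ _ pow_M])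
    finally show ?thesis .
  qed
  have pw: "?c m l = \<zeta> ^ (l + (M - m))" if "m < M" for m l
    using \<zeta>M \<zeta>0 that by (simp add: power_add power_diff)
  have "of_nat M * counit H L = (\<Sum>m<M. counit H L)" by simp
  also have "\<dots> = (\<Sum>m<M. \<Sum>p\<in>P. \<Sum>q\<in>P. \<Sum>l<M. ?i p m q l)"
    by (rule sum.cong[OF refl]) (rule 1, simp)
  also have "\<dots> = (\<Sum>p\<in>P. \<Sum>m<M. \<Sum>q\<in>P. \<Sum>l<M. ?i p m q l)" by (rule sum.swap)
  also have "\<dots> = (\<Sum>((p, m), (q, l))\<in>(P \<times> {..<M}) \<times> (P \<times> {..<M}). ?i p m q l)"
    by (simp add: sum.cartesian_product[symmetric] split_def sum.cartesian_product' cong: if_cong)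
  also have "\<dots> = (\<Sum>((p, m), (q, l))\<in>E. ?i p m q l)"
    using PD(1) equiv_type[OF equiv_E]
    by (intro sum.mono_neutral_right) (auto simp: E_def split: if_splits)
  also have "\<dots> = (\<Sum>((p, m), (q, l))\<in>E. \<zeta> ^ (l + (M - m)))"
  proof (rule sum.cong[OF refl])
    fix x assume "x \<in> E"
    then obtain p m q l where x: "x = ((p, m), (q, l))" "m < M" "\<exists>x\<in>B p q (?c m l). x \<noteq> 0"
      unfolding E_def by blast
    show "(\<lambda>((p, m), (q, l)). ?i p m q l) x = (\<lambda>((p, m), (q, l)). \<zeta> ^ (l + (M - m))) x"
      unfolding x(1) prod.case pw[OF x(2), symmetric] using x(3) by simp
  qed
  finally show ?thesis .
qed

text \<open>\<open>lam K\<close> is the line spanned by \<open>lam\<close>, on which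
  \<open>Q\<close> is the identity. So nothing else is equivalent to a shift of
  \<open>lam\<close>.\<close>

lemma lam_class: "m < M \<Longrightarrow> E `` {(lam, m)} = {(lam, m)}"
proof -
  assume m: "m < M"
  have "p = lam \<and> l = m" if "((lam, m), (p, l)) \<in> E" for p l
  proof -
    from that obtain x where x: "x \<in> B lam p (\<zeta> ^ l / \<zeta> ^ m)" "x \<noteq> 0" "p \<in> P" "l < M"
      by (auto simp: E_def)
    note xD = BD[OF x(1)]
    have e: "x = fsc (x \<one>) lam" using xD(2) lam_conv[OF xD(1)] by simp
    have "p = lam"
    proof (rule ccontr)
      assume "p \<noteq> lam"
      then have "lam \<star> p = 0" using PD(7)[OF PD(3) x(3)] by blast
      then have "fsc (x \<one>) lam \<star> p = 0" by (simp only: conv_scale_left fv.scale_zero_right)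
      then show False using xD(3) x(2) e by simp
    qed
    moreover have "\<zeta> ^ l / \<zeta> ^ m = 1"
    proof -
      have x1: "x \<one> \<noteq> 0"
      proof
        assume "x \<one> = 0"
        then have "x = fsc 0 lam" using e by simp
        then show False using x(2) by (simp only: fv.scale_zero_left)
      qed
      have "Q x \<one> = \<zeta> ^ l / \<zeta> ^ m * x \<one>" using xD(4) by simp
      then have "\<zeta> ^ l / \<zeta> ^ m * x \<one> = 1 * x \<one>" by (simp only: Q_apply C_one antipode_one mult_1_left)
      then show ?thesis using mult_right_cancel[OF x1] by blast
    qed
    then have "\<zeta> ^ l = \<zeta> ^ m" using \<zeta>0 by simp
    then have "l = m" using inj_onD[OF \<zeta>_inj] x(4) m by blast
    ultimately show ?thesis by blast
  qed
  moreover have "((lam, m), (lam, m)) \<in> E"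
    using equiv_E PD(3) m by (auto simp: equiv_def refl_on_def)
  ultimately show "E `` {(lam, m)} = {(lam, m)}" by (auto simp: Image_iff)
qed

end

context haar_ac
begin

text \<open>If the counit of \<open>L\<close> were 0, so would be the sum in \<open>trace_E\<close>.
  The relation transfers to complex roots of unity, where the sum is one of squared moduli over the
  classes of \<open>E\<close>; the singleton class of \<open>(lam, 0)\<close> contributes 1.\<close>

lemma counit_L_nz: "counit H L \<noteq> 0"
proof
  assume 0: "counit H L = 0"
  obtain M where M: "M > 0" "\<And>\<phi>. \<phi> \<in> K \<Longrightarrow> (Q ^^ M) \<phi> = \<phi>" using Q_finite_order by blast
  define \<omega> where "\<omega> = cis (2 * pi / real M)"
  obtain \<zeta> :: 'k where z: "\<zeta> ^ M = 1" "inj_on (\<lambda>i. \<zeta> ^ i) {..<M}"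
    "\<And>E (e :: (('h \<Rightarrow> 'k) \<times> nat) \<times> (('h \<Rightarrow> 'k) \<times> nat) \<Rightarrow> nat). finite E \<Longrightarrow>
      (\<Sum>x\<in>E. \<zeta> ^ e x) = 0 \<Longrightarrow> (\<Sum>x\<in>E. \<omega> ^ e x) = 0"
    using ex_root_of_unity[OF M(1)] unfolding \<omega>_def by blast
  interpret haar_root H lam L M \<zeta>
    by unfold_locales (use M z in auto)
  let ?Y = "P \<times> {..<M}"
  have "(\<Sum>x\<in>E. \<zeta> ^ (case x of ((p, m), (q, l)) \<Rightarrow> l + (M - m))) = 0"
    using trace_E 0 by (simp add: split_def)
  from z(3)[OF finite_E this] have 1: "(\<Sum>x\<in>E. \<omega> ^ (case x of ((p, m), (q, l)) \<Rightarrow> l + (M - m))) = 0" .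
  have w1: "\<omega> * cnj \<omega> = 1" "\<omega> ^ M = 1"
    using M by (simp_all add: \<omega>_def cis_cnj cis_mult DeMoivre)
  have cw: "\<omega> ^ (M - m) = cnj (\<omega> ^ m)" if "m < M" for m
  proof -
    have "cnj (\<omega> ^ m) = \<omega> ^ (M - m) * \<omega> ^ m * cnj (\<omega> ^ m)"
      using that w1(2) by (simp flip: power_add)
    also have "\<omega> ^ m * cnj (\<omega> ^ m) = 1" using w1(1) by (simp flip: power_mult_distrib)
    then have "\<omega> ^ (M - m) * \<omega> ^ m * cnj (\<omega> ^ m) = \<omega> ^ (M - m)" by (simp add: mult.assoc)
    finally show ?thesis by simp
  qed
  define f where "f y = \<omega> ^ snd y" for y :: "('h \<Rightarrow> 'k) \<times> nat"
  have "0 = (\<Sum>(y, z)\<in>E. f z * cnj (f y))"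
    unfolding 1[symmetric]
  proof (rule sum.cong[OF refl])
    fix x assume "x \<in> E"
    then obtain p m q l where x: "x = ((p, m), (q, l))" "m < M" by (auto simp: E_def)
    show "\<omega> ^ (case x of ((p, m), (q, l)) \<Rightarrow> l + (M - m)) = (case x of (y, z) \<Rightarrow> f z * cnj (f y))"
      unfolding x(1) f_def prod.case snd_conv power_add cw[OF x(2)] ..
  qed
  also have "\<dots> = (\<Sum>A\<in>?Y // E. of_real ((cmod (\<Sum>y\<in>A. f y))\<^sup>2))"
    by (rule sum_equiv_rel[OF _ equiv_E]) (simp add: PD(1))
  also have "\<dots> = of_real (\<Sum>A\<in>?Y // E. (cmod (\<Sum>y\<in>A. f y))\<^sup>2)" by simp
  finally have s0: "(\<Sum>A\<in>?Y // E. (cmod (\<Sum>y\<in>A. f y))\<^sup>2) = 0" by (metis of_real_eq_0_iff)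
  have "finite (?Y // E)" using PD(1) equiv_type[OF equiv_E] by (intro finite_quotient) auto
  then have "\<forall>A\<in>?Y // E. (cmod (\<Sum>y\<in>A. f y))\<^sup>2 = 0"
    using s0 by (subst (asm) sum_nonneg_eq_0_iff) auto
  moreover have "{(lam, 0)} \<in> ?Y // E"
    using lam_class[OF M(1)] PD(3) M(1) by (auto simp: quotient_def intro!: bexI[of _ "(lam, 0)"])
  ultimately have "(cmod (\<Sum>y\<in>{(lam, 0)}. f y))\<^sup>2 = 0" by blast
  then show False by (simp add: f_def)
qed

end

section \<open>Integrals of cosemisimple Hopf algebras\<close>

context fd_hopf
begin

abbreviation "R2 \<equiv> tensor2_relations s C"
abbreviation sg :: "'h \<Rightarrow> 'h \<Rightarrow> ('h \<times> 'h) \<Rightarrow>\<^sub>0 'k" where "sg a b \<equiv> Poly_Mapping.single (a, b) 1"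

lemma R2_subspace: "fr.subspace R2"
  by (simp add: tensor2_relations_def)

lemmas R2_closed = fr.subspace_0[OF R2_subspace] fr.subspace_add[OF R2_subspace]
  fr.subspace_diff[OF R2_subspace] fr.subspace_scale[OF R2_subspace]

lemma single_scale: "Poly_Mapping.single x c = free_scale c (Poly_Mapping.single x (1 :: 'k))"
  by (rule poly_mapping_eqI) (simp add: lookup_single when_def)

lemma R2_gen:
  assumes "a \<in> C" "a' \<in> C" "b \<in> C"
  shows "sg (a + a') b - sg a b - sg a' b \<in> R2" "sg (s c a) b - free_scale c (sg a b) \<in> R2"
    "sg b (a + a') - sg b a - sg b a' \<in> R2" "sg b (s c a) - free_scale c (sg b a) \<in> R2"
proof -
  have *: "r \<in> R2" if "b \<in> C" "r \<in> slot_relations s C (\<lambda>x. (x, b)) \<union> slot_relations s C (\<lambda>x. (b, x))" for r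
    unfolding tensor2_relations_def by (rule fr.span_base) (use that in blast)
  show "sg (a + a') b - sg a b - sg a' b \<in> R2" "sg (s c a) b - free_scale c (sg a b) \<in> R2"
    "sg b (a + a') - sg b a - sg b a' \<in> R2" "sg b (s c a) - free_scale c (sg b a) \<in> R2"
    unfolding single_scale[of _ c, symmetric]
    by (rule *[OF assms(3)]; use assms in \<open>unfold slot_relations_def; blast\<close>)+
qed

lemma R2_sum:
  assumes "finite I" "b \<in> C" "\<And>i. i \<in> I \<Longrightarrow> f i \<in> C"
  shows "sg (\<Sum>i\<in>I. s (c i) (f i)) b - (\<Sum>i\<in>I. free_scale (c i) (sg (f i) b)) \<in> R2"
    "sg b (\<Sum>i\<in>I. s (c i) (f i)) - (\<Sum>i\<in>I. free_scale (c i) (sg b (f i))) \<in> R2"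
proof -
  have z: "sg 0 b \<in> R2" "sg b 0 \<in> R2"
    using R2_gen(2)[of 0 0 b 0] R2_gen(4)[of 0 0 b 0] assms(2) by simp_all
  have "sg (\<Sum>i\<in>I. s (c i) (f i)) b - (\<Sum>i\<in>I. free_scale (c i) (sg (f i) b)) \<in> R2 \<and>
    sg b (\<Sum>i\<in>I. s (c i) (f i)) - (\<Sum>i\<in>I. free_scale (c i) (sg b (f i))) \<in> R2"
    using assms(1,3)
  proof (induction I rule: finite_induct)
    case empty
    then show ?case using z by simp
  next
    case (insert i I)
    let ?u = "s (c i) (f i)" and ?v = "\<Sum>i\<in>I. s (c i) (f i)"
    have C': "?u \<in> C" "?v \<in> C" "f i \<in> C" using insert.prems by auto
    note g = R2_gen(1,3)[OF C'(1,2) assms(2)] R2_gen(2,4)[OF C'(3,3) assms(2), of "c i"]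
    have IH: "sg ?v b - (\<Sum>i\<in>I. free_scale (c i) (sg (f i) b)) \<in> R2"
      "sg b ?v - (\<Sum>i\<in>I. free_scale (c i) (sg b (f i))) \<in> R2" using insert by auto
    have "sg (?u + ?v) b - (free_scale (c i) (sg (f i) b) + (\<Sum>i\<in>I. free_scale (c i) (sg (f i) b))) \<in> R2"
      using R2_closed(2)[OF R2_closed(2)[OF g(1) g(3)] IH(1)] by (simp add: algebra_simps)
    moreover have "sg b (?u + ?v) - (free_scale (c i) (sg b (f i)) + (\<Sum>i\<in>I. free_scale (c i) (sg b (f i)))) \<in> R2"
      using R2_closed(2)[OF R2_closed(2)[OF g(2) g(4)] IH(2)] by (simp add: algebra_simps)
    ultimately show ?case using insert.hyps by simp
  qed
  then show "sg (\<Sum>i\<in>I. s (c i) (f i)) b - (\<Sum>i\<in>I. free_scale (c i) (sg (f i) b)) \<in> R2"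
    "sg b (\<Sum>i\<in>I. s (c i) (f i)) - (\<Sum>i\<in>I. free_scale (c i) (sg b (f i))) \<in> R2" by auto
qed

lemma expand:
  assumes "interp K T w" "T \<subseteq> C" "x \<in> C"
  shows "x = (\<Sum>t\<in>T. s (w t x) t)"
proof (rule separates_eq[OF assms(3)])
  show "(\<Sum>t\<in>T. s (w t x) t) \<in> C" using assms(2) by (intro C_sum C_scale) auto
  fix \<phi> assume p: "\<phi> \<in> K"
  have "\<phi> (\<Sum>t\<in>T. s (w t x) t) = (\<Sum>t\<in>T. w t x * \<phi> t)"
    using assms(2) by (subst lin_sum[OF K_lin[OF p]]) (auto intro!: sum.cong simp: lin_scale[OF K_lin[OF p]] subset_eq)
  then show "\<phi> x = \<phi> (\<Sum>t\<in>T. s (w t x) t)" using lin_expand[OF assms(1,2) K_lin[OF p] assms(3)] by simp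
qed

text \<open>Modulo the relations \<open>p\<close> is a combination of tensors of points of
  \<open>T\<close>, whose coefficients are values of products of functionals on \<open>p\<close>. So
  such products detect every tensor.\<close>

lemma R2_I:
  assumes p: "Poly_Mapping.keys p \<subseteq> C \<times> C"
    and z: "\<And>\<phi> \<psi>. \<phi> \<in> K \<Longrightarrow> \<psi> \<in> K \<Longrightarrow> ev (\<lambda>(a, b). \<phi> a * \<psi> b) p = 0"
  shows "p \<in> R2"
proof -
  obtain T w where T: "T \<subseteq> C" and I: "interp K T w" using K_interp by blast
  have fT: "finite T" and wK: "t \<in> T \<Longrightarrow> w t \<in> K" for t using interpD(1,2)[OF I] by auto
  define N where "N a b = (\<Sum>t\<in>T. \<Sum>t'\<in>T. free_scale (w t a * w t' b) (sg t t'))" for a b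
  have 1: "sg a b - N a b \<in> R2" if ab: "a \<in> C" "b \<in> C" for a b
  proof -
    have "sg a b - (\<Sum>t\<in>T. free_scale (w t a) (sg t b)) \<in> R2"
      using R2_sum(1)[OF fT ab(2), of "\<lambda>t. t" "\<lambda>t. w t a"] T expand[OF I T ab(1)] by auto
    moreover have "(\<Sum>t\<in>T. free_scale (w t a) (sg t b - (\<Sum>t'\<in>T. free_scale (w t' b) (sg t t')))) \<in> R2"
    proof (rule fr.subspace_sum[OF R2_subspace], rule R2_closed(4))
      fix t assume "t \<in> T"
      then show "sg t b - (\<Sum>t'\<in>T. free_scale (w t' b) (sg t t')) \<in> R2"
        using R2_sum(2)[OF fT, of t "\<lambda>t. t" "\<lambda>t. w t b"] T expand[OF I T ab(2)] by auto
    qed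
    ultimately have "sg a b - (\<Sum>t\<in>T. free_scale (w t a) (sg t b)) +
      (\<Sum>t\<in>T. free_scale (w t a) (sg t b - (\<Sum>t'\<in>T. free_scale (w t' b) (sg t t')))) \<in> R2"
      by (rule R2_closed(2))
    then show ?thesis
      by (simp add: N_def fr.scale_right_diff_distrib sum_subtractf fr.scale_sum_right)
  qed
  have pe: "p = (\<Sum>x\<in>Poly_Mapping.keys p. free_scale (Poly_Mapping.lookup p x) (Poly_Mapping.single x 1))"
  proof (rule poly_mapping_eqI)
    fix y
    have "(\<Sum>x\<in>Poly_Mapping.keys p. Poly_Mapping.lookup p x * (1 when x = y))
      = (\<Sum>x\<in>Poly_Mapping.keys p. if x = y then Poly_Mapping.lookup p y else 0)"
      by (intro sum.cong) (auto simp: when_def)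
    also have "\<dots> = Poly_Mapping.lookup p y" by (simp add: in_keys_iff)
    finally show "Poly_Mapping.lookup p y = Poly_Mapping.lookup
      (\<Sum>x\<in>Poly_Mapping.keys p. free_scale (Poly_Mapping.lookup p x) (Poly_Mapping.single x 1)) y"
      by (simp add: lookup_sum lookup_single)
  qed
  have "(\<Sum>x\<in>Poly_Mapping.keys p. free_scale (Poly_Mapping.lookup p x) (Poly_Mapping.single x 1 - N (fst x) (snd x))) \<in> R2"
  proof (rule fr.subspace_sum[OF R2_subspace], rule R2_closed(4))
    fix x assume "x \<in> Poly_Mapping.keys p"
    then show "Poly_Mapping.single x 1 - N (fst x) (snd x) \<in> R2" using 1 p by (cases x) auto
  qed
  moreover have "(\<Sum>x\<in>Poly_Mapping.keys p. free_scale (Poly_Mapping.lookup p x) (N (fst x) (snd x))) = 0"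
  proof -
    have "(\<Sum>x\<in>Poly_Mapping.keys p. free_scale (Poly_Mapping.lookup p x) (N (fst x) (snd x)))
      = (\<Sum>t\<in>T. \<Sum>t'\<in>T. free_scale (ev (\<lambda>(a, b). w t a * w t' b) p) (sg t t'))"
      unfolding N_def ev_def fr.scale_sum_right fr.scale_sum_left fr.scale_scale case_prod_unfold
      by (subst sum.swap, intro sum.cong refl, subst sum.swap) (rule refl)
    then show ?thesis using z wK by simp
  qed
  ultimately show ?thesis
    by (subst pe) (simp add: fr.scale_right_diff_distrib sum_subtractf)
qed

lemma mem_comult:
  assumes "x \<in> C" "Poly_Mapping.keys q \<subseteq> C \<times> C"
    and "\<And>\<phi> \<psi>. \<phi> \<in> K \<Longrightarrow> \<psi> \<in> K \<Longrightarrow> ev (\<lambda>(a, b). \<phi> a * \<psi> b) q = sw (\<lambda>a b. \<phi> a * \<psi> b) x"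
  shows "q \<in> comult H x"
proof -
  have "q - sweedler H x \<in> R2"
  proof (rule R2_I)
    have "Poly_Mapping.keys (q - sweedler H x) \<subseteq> Poly_Mapping.keys q \<union> Poly_Mapping.keys (sweedler H x)"
      by (rule keys_diff)
    then show "Poly_Mapping.keys (q - sweedler H x) \<subseteq> C \<times> C"
      using assms(2) sweedler_keys[OF assms(1)] by blast
  qed (use assms(3) in \<open>simp add: ev_diff sw_def\<close>)
  then show ?thesis
    using comult_class[OF assms(1) sweedler_in[OF assms(1)]] by (simp add: tensor2_class_def)
qed

lemma lslice_eqI:
  assumes "x \<in> C" "y \<in> C" "\<And>\<psi>. \<psi> \<in> K \<Longrightarrow> sw (\<lambda>a b. \<phi> a * \<psi> b) x = \<psi> y"
  shows "lslice \<phi> x = y"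
  by (rule separates_eq) (use assms lin_slice(1)[OF assms(1) K_lin] in auto)

lemma rslice_eqI:
  assumes "x \<in> C" "y \<in> C" "\<And>\<psi>. \<psi> \<in> K \<Longrightarrow> sw (\<lambda>a b. \<psi> a * \<phi> b) x = \<psi> y"
  shows "rslice \<phi> x = y"
  by (rule separates_eq) (use assms lin_slice(2)[OF assms(1) K_lin] in auto)

lemma slice_linear:
  assumes "\<phi> \<in> K" "x \<in> C" "y \<in> C"
  shows "lslice \<phi> (x + y) = lslice \<phi> x + lslice \<phi> y" "rslice \<phi> (x + y) = rslice \<phi> x + rslice \<phi> y"
    "lslice \<phi> (s c x) = s c (lslice \<phi> x)" "rslice \<phi> (s c x) = s c (rslice \<phi> x)"
    "lslice \<phi> \<one> = s (\<phi> \<one>) \<one>" "rslice \<phi> \<one> = s (\<phi> \<one>) \<one>"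
proof -
  have b: "blin (\<lambda>a b. \<phi> a * \<psi> b)" "blin (\<lambda>a b. \<psi> a * \<phi> b)" if "\<psi> \<in> K" for \<psi>
    using that assms(1) by (auto intro: blin_mult K_lin)
  note l = lin_add[OF sw_lin[OF b(1)]] lin_add[OF sw_lin[OF b(2)]] lin_scale[OF sw_lin[OF b(1)]]
    lin_scale[OF sw_lin[OF b(2)]] lin_add[OF K_lin] lin_scale[OF K_lin] lin_slice[OF _ K_lin] sw_one[OF b(1)] sw_one[OF b(2)]
  show "lslice \<phi> (x + y) = lslice \<phi> x + lslice \<phi> y" by (rule lslice_eqI) (use assms in \<open>simp_all add: l\<close>)
  show "rslice \<phi> (x + y) = rslice \<phi> x + rslice \<phi> y" by (rule rslice_eqI) (use assms in \<open>simp_all add: l\<close>)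
  show "lslice \<phi> (s c x) = s c (lslice \<phi> x)" by (rule lslice_eqI) (use assms in \<open>simp_all add: l\<close>)
  show "rslice \<phi> (s c x) = s c (rslice \<phi> x)" by (rule rslice_eqI) (use assms in \<open>simp_all add: l\<close>)
  show "lslice \<phi> \<one> = s (\<phi> \<one>) \<one>" by (rule lslice_eqI) (use assms in \<open>simp_all add: l\<close>)
  show "rslice \<phi> \<one> = s (\<phi> \<one>) \<one>" by (rule rslice_eqI) (use assms in \<open>simp_all add: l\<close>)
qed

lemma subcoalgebra_slices:
  assumes D: "subcoalgebra H D" and x: "x \<in> D" and p: "\<phi> \<in> K"
  shows "lslice \<phi> x \<in> D" "rslice \<phi> x \<in> D"
proof -
  have DC: "D \<subseteq> C" and Ds: "V.subspace D" using D by (auto simp: subcoalgebra_def)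
  obtain q where q: "q \<in> comult H x" "Poly_Mapping.keys q \<subseteq> D \<times> D" using D x by (auto simp: subcoalgebra_def)
  have xC: "x \<in> C" using x DC by blast
  have qD: "fst y \<in> D" "snd y \<in> D" if "y \<in> Poly_Mapping.keys q" for y using that q(2) by auto
  let ?l = "\<Sum>y\<in>Poly_Mapping.keys q. s (Poly_Mapping.lookup q y * \<phi> (fst y)) (snd y)"
  let ?r = "\<Sum>y\<in>Poly_Mapping.keys q. s (Poly_Mapping.lookup q y * \<phi> (snd y)) (fst y)"
  have lr: "?l \<in> D" "?r \<in> D"
    using qD by (auto intro!: V.subspace_sum[OF Ds] V.subspace_scale[OF Ds])
  have "lslice \<phi> x = ?l"
  proof (rule lslice_eqI[OF xC])
    fix \<psi> assume s: "\<psi> \<in> K"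
    have "sw (\<lambda>a b. \<phi> a * \<psi> b) x = ev (\<lambda>(a, b). \<phi> a * \<psi> b) q"
      by (rule sw_rep[OF xC q(1) blin_mult[OF K_lin[OF p] K_lin[OF s]]])
    also have "\<dots> = \<psi> ?l"
      using qD DC by (subst lin_sum[OF K_lin[OF s]])
        (auto simp: ev_def case_prod_unfold lin_scale[OF K_lin[OF s]] subset_eq intro!: sum.cong)
    finally show "sw (\<lambda>a b. \<phi> a * \<psi> b) x = \<psi> ?l" .
  qed (use lr DC in blast)
  then show "lslice \<phi> x \<in> D" using lr by simp
  have "rslice \<phi> x = ?r"
  proof (rule rslice_eqI[OF xC])
    fix \<psi> assume s: "\<psi> \<in> K"
    have "sw (\<lambda>a b. \<psi> a * \<phi> b) x = ev (\<lambda>(a, b). \<psi> a * \<phi> b) q"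
      by (rule sw_rep[OF xC q(1) blin_mult[OF K_lin[OF s] K_lin[OF p]]])
    also have "\<dots> = \<psi> ?r"
      using qD DC by (subst lin_sum[OF K_lin[OF s]])
        (auto simp: ev_def case_prod_unfold lin_scale[OF K_lin[OF s]] subset_eq mult_ac intro!: sum.cong)
    finally show "sw (\<lambda>a b. \<psi> a * \<phi> b) x = \<psi> ?r" .
  qed (use lr DC in blast)
  then show "rslice \<phi> x \<in> D" using lr by simp
qed

text \<open>Stability under both actions of the dual places the comultiplication of \<open>x\<close>
  in \<open>D \<otimes> D\<close>: its components in a basis of \<open>D\<close> form the explicit
  representative \<open>q\<close>.\<close>

lemma subcoalgebraI:
  assumes DC: "D \<subseteq> C" and Ds: "V.subspace D"
    and sl: "\<And>x \<phi>. x \<in> D \<Longrightarrow> \<phi> \<in> K \<Longrightarrow> lslice \<phi> x \<in> D \<and> rslice \<phi> x \<in> D"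
  shows "subcoalgebra H D"
proof -
  obtain T0 w0 where T0: "T0 \<subseteq> C" and I0: "interp K T0 w0" using K_interp by blast
  \<comment> \<open>Functionals cut off outside \<open>D\<close>, so that \<open>ex_interp\<close>
    chooses its points in \<open>D\<close>.\<close>
  define r where "r \<phi> = (\<lambda>x. if x \<in> D then \<phi> x else 0)" for \<phi> :: "'h \<Rightarrow> 'k"
  have fin: "finite ((\<lambda>t. r (w0 t)) ` T0)" by (rule finite_imageI[OF interpD(1)[OF I0]])
  have out: "\<phi> x = 0" if "\<phi> \<in> (\<lambda>t. r (w0 t)) ` T0" "x \<notin> D" for \<phi> x
    using that by (auto simp: r_def)
  have "\<exists>T w. T \<subseteq> D \<and> interp (fv.span ((\<lambda>t. r (w0 t)) ` T0)) T w"
    by (rule ex_interp[OF fin]) (erule out, assumption)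
  then obtain T w where T: "T \<subseteq> D" and I: "interp (fv.span ((\<lambda>t. r (w0 t)) ` T0)) T w"
    by blast
  have rin: "r \<phi> \<in> fv.span ((\<lambda>t. r (w0 t)) ` T0)" if "\<phi> \<in> K" for \<phi>
  proof -
    have "r \<phi> = (\<Sum>t\<in>T0. fsc (\<phi> t) (r (w0 t)))"
    proof (rule ext)
      fix x
      show "r \<phi> x = (\<Sum>t\<in>T0. fsc (\<phi> t) (r (w0 t))) x"
        unfolding sum_fun_apply fsc_apply r_def
        by (cases "x \<in> D") (simp_all only: if_True if_False mult_zero_right sum.neutral_const interpD(4)[OF I0 that, symmetric])
    qed
    moreover have "(\<Sum>t\<in>T0. fsc (\<phi> t) (r (w0 t))) \<in> fv.span ((\<lambda>t. r (w0 t)) ` T0)"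
      by (intro fv.span_sum fv.span_scale fv.span_base imageI)
    ultimately show ?thesis by (simp only:)
  qed
  have wr: "\<exists>\<kappa>\<in>K. w t = r \<kappa>" if "t \<in> T" for t
  proof -
    have "fv.span ((\<lambda>t. r (w0 t)) ` T0) \<subseteq> r ` K"
    proof (rule fv.span_minimal)
      show "fv.subspace (r ` K)"
        unfolding fv.subspace_def
      proof (intro conjI ballI allI)
        show "0 \<in> r ` K" by (rule image_eqI[of _ _ 0]) (auto simp: r_def fun_eq_iff)
      next
        fix f g assume "f \<in> r ` K" "g \<in> r ` K"
        then obtain f' g' where "f = r f'" "g = r g'" "f' \<in> K" "g' \<in> K" by blast
        then show "f + g \<in> r ` K" by (intro image_eqI[of _ _ "f' + g'"]) (auto simp: r_def fun_eq_iff)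
      next
        fix c f assume "f \<in> r ` K"
        then obtain f' where "f = r f'" "f' \<in> K" by blast
        then show "fsc c f \<in> r ` K" by (intro image_eqI[of _ _ "fsc c f'"]) (auto simp: r_def fun_eq_iff)
      qed
    qed (use interpD(2)[OF I0] in auto)
    then show ?thesis using interpD(2)[OF I that] by auto
  qed
  then obtain \<kappa> where \<kappa>: "\<And>t. t \<in> T \<Longrightarrow> \<kappa> t \<in> K" "\<And>t. t \<in> T \<Longrightarrow> w t = r (\<kappa> t)" by metis
  have ex: "\<phi> x = (\<Sum>t\<in>T. \<phi> t * \<kappa> t x)" if "\<phi> \<in> K" "x \<in> D" for \<phi> x
  proof -
    have "r \<phi> x = (\<Sum>t\<in>T. r \<phi> t * w t x)" by (rule interpD(4)[OF I rin[OF that(1)]])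
    also have "\<dots> = (\<Sum>t\<in>T. \<phi> t * \<kappa> t x)" using T that \<kappa>(2) by (intro sum.cong refl) (auto simp: r_def)
    finally show ?thesis using that by (simp add: r_def)
  qed
  have fT: "finite T" using interpD(1)[OF I] .
  have "\<exists>p\<in>comult H x. Poly_Mapping.keys p \<subseteq> D \<times> D" if x: "x \<in> D" for x
  proof -
    have xC: "x \<in> C" using x DC by blast
    define q where "q = (\<Sum>t\<in>T. \<Sum>t'\<in>T. free_scale ((\<kappa> t \<star> \<kappa> t') x) (sg t t'))"
    have "Poly_Mapping.keys q \<subseteq> (\<Union>t\<in>T. \<Union>t'\<in>T. {(t, t')})"
      unfolding q_def
      by (rule order_trans[OF keys_sum], rule UN_mono[OF order_refl], rule order_trans[OF keys_sum], rule UN_mono[OF order_refl])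
        (auto simp: in_keys_iff lookup_single when_def split: if_splits)
    then have k: "Poly_Mapping.keys q \<subseteq> D \<times> D" using T by blast
    have "q \<in> comult H x"
    proof (rule mem_comult[OF xC])
      show "Poly_Mapping.keys q \<subseteq> C \<times> C" using k DC by blast
      fix \<phi> \<psi> assume p: "\<phi> \<in> K" "\<psi> \<in> K"
      \<comment> \<open>\<open>\<phi>'\<close> and \<open>\<psi>'\<close> are only known to agree
        with \<phi> and \<psi> on \<open>D\<close>. They are exchanged one factor at a time below,
        each time on a slice, which lies in \<open>D\<close>.\<close>
      define \<phi>' where "\<phi>' = (\<Sum>t\<in>T. fsc (\<phi> t) (\<kappa> t))"
      define \<psi>' where "\<psi>' = (\<Sum>t\<in>T. fsc (\<psi> t) (\<kappa> t))"
      have K': "\<phi>' \<in> K" "\<psi>' \<in> K" unfolding \<phi>'_def \<psi>'_def using \<kappa>(1) by (auto intro!: K_sum K_closed(4))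
      have e: "\<phi>' y = \<phi> y" "\<psi>' y = \<psi> y" if "y \<in> D" for y
        using ex[OF p(1) that] ex[OF p(2) that] by (simp_all add: \<phi>'_def \<psi>'_def)
      have "ev (\<lambda>(a, b). \<phi> a * \<psi> b) q = (\<Sum>t\<in>T. \<Sum>t'\<in>T. (\<kappa> t \<star> \<kappa> t') x * (\<phi> t * \<psi> t'))"
        by (simp add: q_def ev_sum ev_scale)
      also have "\<dots> = (\<phi>' \<star> \<psi>') x"
        by (simp add: \<phi>'_def \<psi>'_def conv_sum_left conv_sum_right conv_scale_left conv_scale_right sum_distrib_left mult_ac)
          (rule sum.swap)
      also have "\<dots> = \<phi>' (rslice \<psi>' x)" using lin_slice(2)[OF xC K_lin[OF K'(1)]] xC by (simp add: conv_apply)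
      also have "\<dots> = \<phi> (rslice \<psi>' x)" using e(1) sl[OF x K'(2)] by blast
      also have "\<dots> = (\<phi> \<star> \<psi>') x" using lin_slice(2)[OF xC K_lin[OF p(1)]] xC by (simp add: conv_apply)
      also have "\<dots> = \<psi>' (lslice \<phi> x)" using lin_slice(1)[OF xC K_lin[OF K'(2)]] xC by (simp add: conv_apply)
      also have "\<dots> = \<psi> (lslice \<phi> x)" using e(2) sl[OF x p(1)] by blast
      also have "\<dots> = sw (\<lambda>a b. \<phi> a * \<psi> b) x" by (rule lin_slice(1)[OF xC K_lin[OF p(2)]])
      finally show "ev (\<lambda>(a, b). \<phi> a * \<psi> b) q = sw (\<lambda>a b. \<phi> a * \<psi> b) x" .
    qed
    then show ?thesis using k by blast
  qed
  then show ?thesis using DC Ds by (auto simp: subcoalgebra_def)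
qed

text \<open>Take \<open>U\<close> maximal among the subcoalgebras avoiding \<one>. A simple
  \<open>D\<close> outside \<open>W = U + k \<one>\<close> meets \<open>W\<close> in 0, and then
  \<open>U + D\<close> still avoids \<one>, contrary to maximality; so \<open>W\<close> contains the
  coradical.\<close>

lemma ex_complement:
  assumes cs: "cosemisimple H"
  shows "\<exists>U. subcoalgebra H U \<and> \<one> \<notin> U \<and> (\<forall>x\<in>C. \<exists>c. x - s c \<one> \<in> U)"
proof -
  define A where "A = {U. subcoalgebra H U \<and> \<one> \<notin> U}"
  have one0: "\<one> \<noteq> 0" using counit_one counit_scale[of 0 0] by auto
  have AD: "V.subspace U" "U \<subseteq> C" if "U \<in> A" for U using that by (auto simp: A_def subcoalgebra_def)
  have sl0: "lslice \<phi> 0 = 0" "rslice \<phi> 0 = 0" if "\<phi> \<in> K" for \<phi>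
    using slice_linear(3,4)[OF that, of 0 0 0] by simp_all
  have "{0} \<in> A" unfolding A_def using one0 sl0 by (auto intro!: subcoalgebraI)
  then have "A \<noteq> {}" by blast
  moreover have "\<Union>\<C> \<in> A" if ch: "\<C> \<noteq> {}" "subset.chain A \<C>" for \<C>
  proof -
    have CA: "U \<in> A" if "U \<in> \<C>" for U using ch(2) that by (auto simp: subset.chain_def)
    have "subcoalgebra H (\<Union>\<C>)"
    proof (rule subcoalgebraI)
      show "\<Union>\<C> \<subseteq> C" using CA AD(2) by blast
      show "V.subspace (\<Union>\<C>)"
        unfolding V.subspace_def
      proof (intro conjI ballI allI)
        show "0 \<in> \<Union>\<C>" using ch(1) CA AD(1) V.subspace_0 by blast
      next
        fix x y assume "x \<in> \<Union>\<C>" "y \<in> \<Union>\<C>"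
        then obtain U W where UW: "U \<in> \<C>" "W \<in> \<C>" "x \<in> U" "y \<in> W" by blast
        then have "U \<subseteq> W \<or> W \<subseteq> U" using ch(2) by (auto simp: subset.chain_def)
        then show "x + y \<in> \<Union>\<C>"
          using UW V.subspace_add[OF AD(1)[OF CA[OF UW(1)]]] V.subspace_add[OF AD(1)[OF CA[OF UW(2)]]] by blast
      next
        fix c x assume "x \<in> \<Union>\<C>"
        then show "s c x \<in> \<Union>\<C>" using CA AD(1) V.subspace_scale by blast
      qed
      fix x \<phi> assume "x \<in> \<Union>\<C>" "\<phi> \<in> K"
      then obtain X where X: "X \<in> \<C>" "x \<in> X" by blast
      then have "subcoalgebra H X" using CA by (auto simp: A_def)
      from subcoalgebra_slices[OF this X(2) \<open>\<phi> \<in> K\<close>]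
      show "lslice \<phi> x \<in> \<Union>\<C> \<and> rslice \<phi> x \<in> \<Union>\<C>" using X(1) by blast
    qed
    then show ?thesis using CA by (auto simp: A_def)
  qed
  ultimately obtain U where U: "U \<in> A" and max: "\<And>X. X \<in> A \<Longrightarrow> U \<subseteq> X \<Longrightarrow> X = U"
    using subset_Zorn_nonempty[of A] by blast
  have Us: "V.subspace U" "U \<subseteq> C" "subcoalgebra H U" "\<one> \<notin> U" using AD U by (auto simp: A_def)
  define W where "W = {x\<in>C. \<exists>c. x - s c \<one> \<in> U}"
  have WI: "u + s c \<one> \<in> W" if "u \<in> U" for u c using that Us(2) by (auto simp: W_def intro!: exI[of _ c])
  have WE: "\<exists>u c. u \<in> U \<and> x = u + s c \<one>" if "x \<in> W" for x
    using that unfolding W_def mem_Collect_eq by (metis diff_add_cancel)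
  have Ws: "V.subspace W"
    unfolding V.subspace_def
  proof (intro conjI ballI allI)
    show "0 \<in> W" using WI[OF V.subspace_0[OF Us(1)], of 0] by simp
  next
    fix x y assume "x \<in> W" "y \<in> W"
    then obtain u c v d where "u \<in> U" "x = u + s c \<one>" "v \<in> U" "y = v + s d \<one>" using WE by metis
    then show "x + y \<in> W" using WI[OF V.subspace_add[OF Us(1), of u v], of "c + d"]
      by (simp add: V.scale_left_distrib algebra_simps)
  next
    fix a x assume "x \<in> W"
    then obtain u c where "u \<in> U" "x = u + s c \<one>" using WE by metis
    then show "s a x \<in> W" using WI[OF V.subspace_scale[OF Us(1), of u a], of "a * c"]
      by (simp add: V.scale_right_distrib)
  qed
  have Wsl: "lslice \<phi> x \<in> W \<and> rslice \<phi> x \<in> W" if xW: "x \<in> W" and p: "\<phi> \<in> K" for x \<phi>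
  proof -
    obtain u c where u: "u \<in> U" "x = u + s c \<one>" using WE[OF xW] by metis
    then have uC: "u \<in> C" using Us(2) by blast
    show ?thesis
      using WI subcoalgebra_slices[OF Us(3) u(1) p] slice_linear[OF p uC, of "s c \<one>"] slice_linear[OF p C_one C_one]
      by (simp add: u(2))
  qed
  have "C \<subseteq> W"
  proof (rule ccontr)
    assume "\<not> C \<subseteq> W"
    have "\<not> \<Union>{D. simple_subcoalgebra H D} \<subseteq> W"
      using V.span_minimal[OF _ Ws] cs \<open>\<not> C \<subseteq> W\<close> by (auto simp: cosemisimple_def)
    then obtain D where D: "simple_subcoalgebra H D" "\<not> D \<subseteq> W" by blast
    then have Dc: "subcoalgebra H D" and Ds: "V.subspace D" "D \<subseteq> C" by (auto simp: simple_subcoalgebra_def subcoalgebra_def)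
    have "subcoalgebra H (D \<inter> W)"
      by (rule subcoalgebraI) (use Ds V.subspace_inter[OF Ds(1) Ws] subcoalgebra_slices[OF Dc] Wsl in auto)
    then have DW: "D \<inter> W = {0}" using D by (auto simp: simple_subcoalgebra_def)
    let ?X = "{x + y |x y. x \<in> U \<and> y \<in> D}"
    have "subcoalgebra H ?X"
    proof (rule subcoalgebraI)
      show "V.subspace ?X" by (rule V.subspace_sums[OF Us(1) Ds(1)])
      show "?X \<subseteq> C" using Us(2) Ds(2) by (auto simp: subset_eq)
      fix z \<phi> assume "z \<in> ?X" and p: "\<phi> \<in> K"
      then obtain x y where xy: "z = x + y" "x \<in> U" "y \<in> D" by blast
      have xyC: "x \<in> C" "y \<in> C" using xy Us(2) Ds(2) by auto
      show "lslice \<phi> z \<in> ?X \<and> rslice \<phi> z \<in> ?X"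
        unfolding xy(1) slice_linear(1,2)[OF p xyC]
        using subcoalgebra_slices[OF Us(3) xy(2) p] subcoalgebra_slices[OF Dc xy(3) p] by blast
    qed
    moreover have "\<one> \<notin> ?X"
    proof
      assume "\<one> \<in> ?X"
      then obtain x y where xy: "\<one> = x + y" "x \<in> U" "y \<in> D" by blast
      have "y = - x + s 1 \<one>" using xy(1) by simp
      then have "y \<in> W" using WI[OF V.subspace_neg[OF Us(1) xy(2)], of 1] by metis
      then have "y = 0" using DW xy(3) by blast
      then show False using xy Us(4) by simp
    qed
    moreover have "U \<subseteq> ?X" using V.subspace_0[OF Ds(1)] by force
    ultimately have "?X = U" using max[of ?X] by (simp add: A_def)
    moreover have "D \<subseteq> ?X" using V.subspace_0[OF Us(1)] by force
    ultimately have "D \<subseteq> W" using WI[of _ 0] by auto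
    then show False using D(2) by blast
  qed
  then show ?thesis using Us by (auto simp: W_def)
qed

text \<open>\<open>lam\<close> is the projection onto the line of \<one> along the subcoalgebra
  \<open>U\<close>. Slices of \<open>U\<close> stay in \<open>U\<close>, so the products of
  \<open>lam\<close> with a functional vanish on \<open>U\<close> too and are multiples of
  \<open>lam\<close>.\<close>

lemma ex_haar:
  assumes cs: "cosemisimple H"
  shows "\<exists>lam. haar H lam"
proof -
  obtain U where U: "subcoalgebra H U" "\<one> \<notin> U" "\<And>x. x \<in> C \<Longrightarrow> \<exists>c. x - s c \<one> \<in> U"
    using ex_complement[OF cs] by blast
  have Us: "V.subspace U" "U \<subseteq> C" using U(1) by (auto simp: subcoalgebra_def)
  have uniq: "c = d" if "x - s c \<one> \<in> U" "x - s d \<one> \<in> U" for x c d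
  proof (rule ccontr)
    assume "c \<noteq> d"
    have "x - s d \<one> - (x - s c \<one>) \<in> U" by (rule V.subspace_diff[OF Us(1) that(2,1)])
    then have "s (c - d) \<one> \<in> U" by (simp add: V.scale_left_diff_distrib)
    then have "s (1 / (c - d)) (s (c - d) \<one>) \<in> U" by (rule V.subspace_scale[OF Us(1)])
    then show False using \<open>c \<noteq> d\<close> U(2) by simp
  qed
  define lam where "lam = restr (\<lambda>x. THE c. x - s c \<one> \<in> U)"
  have lamI: "lam x = c" if "x \<in> C" "x - s c \<one> \<in> U" for x c
    using that uniq by (auto simp: lam_def)
  have lamD: "x - s (lam x) \<one> \<in> U" if "x \<in> C" for x
    using U(3)[OF that] lamI[OF that] by auto
  have lamK: "lam \<in> K"
    unfolding K_def mem_Collect_eq lin_def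
  proof (intro conjI ballI allI impI)
    fix x y assume xy: "x \<in> C" "y \<in> C"
    have "x + y - s (lam x + lam y) \<one> \<in> U"
      using V.subspace_add[OF Us(1) lamD[OF xy(1)] lamD[OF xy(2)]] by (simp add: V.scale_left_distrib algebra_simps)
    then show "lam (x + y) = lam x + lam y" using lamI xy by simp
  next
    fix c x assume x: "x \<in> C"
    have "s c x - s (c * lam x) \<one> \<in> U"
      using V.subspace_scale[OF Us(1) lamD[OF x], of c] by (simp add: V.scale_right_diff_distrib)
    then show "lam (s c x) = c * lam x" using lamI x by simp
  qed (simp add: lam_def restr_def)
  have lamU: "lam u = 0" if "u \<in> U" for u using lamI[of u 0] that Us(2) by auto
  have lam1: "lam \<one> = 1" using lamI[of \<one> 1] V.subspace_0[OF Us(1)] by simp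
  have dec: "\<chi> x = \<chi> (x - s (lam x) \<one>) + lam x * \<chi> \<one>" if "\<chi> \<in> K" "x \<in> C" for \<chi> x
    using that(2) by (simp add: lin_diff[OF K_lin[OF that(1)]] lin_scale[OF K_lin[OF that(1)]])
  have cU: "(lam \<star> \<phi>) u = 0" "(\<phi> \<star> lam) u = 0" if "\<phi> \<in> K" "u \<in> U" for \<phi> u
  proof -
    have uC: "u \<in> C" using that Us by blast
    show "(lam \<star> \<phi>) u = 0" "(\<phi> \<star> lam) u = 0"
      using lin_slice[OF uC K_lin[OF lamK], of \<phi>] lamU[OF subcoalgebra_slices(1)[OF U(1) that(2,1)]]
        lamU[OF subcoalgebra_slices(2)[OF U(1) that(2,1)]] uC by (simp_all add: conv_apply)
  qed
  have "haar H lam"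
  proof unfold_locales
    show "lam \<in> K" "lam \<one> = 1" by (fact lamK lam1)+
    fix \<phi> assume p: "\<phi> \<in> K"
    show "lam \<star> \<phi> = fsc (\<phi> \<one>) lam"
      by (rule K_eqI) (use p lamK dec[of "lam \<star> \<phi>"] cU[OF p lamD] conv_one[OF lamK p] lam1 in \<open>auto simp: mult.commute\<close>)
    show "\<phi> \<star> lam = fsc (\<phi> \<one>) lam"
      by (rule K_eqI) (use p lamK dec[of "\<phi> \<star> lam"] cU[OF p lamD] conv_one[OF p lamK] lam1 in \<open>auto simp: mult.commute\<close>)
  qed
  then show ?thesis by blast
qed

end

theorem cosemisimple_integral:
  fixes H :: "('k::{alg_closed_field, field_char_0}, 'h::ab_group_add) hopf"
  assumes H: "hopf_algebra H" and fd: "fin_dim H" and cs: "cosemisimple H"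
  shows "\<exists>\<Lambda>\<in>carrier H. counit H \<Lambda> = 1 \<and> (\<forall>h\<in>carrier H. \<Lambda> \<otimes>\<^bsub>H\<^esub> h = vscale H (counit H h) \<Lambda> \<and>
    h \<otimes>\<^bsub>H\<^esub> \<Lambda> = vscale H (counit H h) \<Lambda>)"
proof -
  interpret hopf_algebra H by (rule H)
  interpret fd_hopf H by unfold_locales (auto simp: fd)
  obtain lam where lam: "haar H lam" using ex_haar[OF cs] by blast
  interpret haar H lam by (rule lam)
  obtain L where LL: "L \<in> C" "\<And>y. y \<in> C \<Longrightarrow> lam (L \<otimes>\<^bsub>H\<^esub> y) = counit H y" "\<And>h. h \<in> C \<Longrightarrow> L \<otimes>\<^bsub>H\<^esub> h = s (counit H h) L"
    using ex_integral by blast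
  interpret haar_ac H lam L by unfold_locales (use LL in auto)
  let ?L = "s (1 / counit H L) L"
  have "?L \<in> C" "counit H ?L = 1" using counit_L_nz LL(1) by (simp_all add: counit_scale)
  moreover have "?L \<otimes>\<^bsub>H\<^esub> h = s (counit H h) ?L \<and> h \<otimes>\<^bsub>H\<^esub> ?L = s (counit H h) ?L" if h: "h \<in> C" for h
    using h LL(1) counit_L_imp_unimodular[OF counit_L_nz h] LL(3)[OF h]
    by (simp add: mult_scale_left mult_scale_right mult.commute)
  ultimately show ?thesis by blast
qed

section \<open>Derivations of fields\<close>

context field_hom
begin

text \<open>A derivation on a subring, given as a subring of the dual numbers \<open>(x, y) = x + y \<epsilon>\<close>
  that projects injectively to the first component.\<close>

definition dsub :: "('f \<times> 'f) set \<Rightarrow> bool"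
  where "dsub G \<longleftrightarrow> (\<forall>x y x' y'. (x, y) \<in> G \<longrightarrow> (x', y') \<in> G \<longrightarrow>
      (x + x', y + y') \<in> G \<and> (x * x', x * y' + y * x') \<in> G) \<and>
    (\<forall>a. (\<iota> a, 0) \<in> G) \<and> (\<forall>y. (0, y) \<in> G \<longrightarrow> y = 0)"

text \<open>Pairs of a polynomial \<open>p\<close> and the polynomial \<open>q\<close> got by
  applying the derivation to its coefficients.\<close>

definition dpoly :: "('f \<times> 'f) set \<Rightarrow> ('f poly \<times> 'f poly) set"
  where "dpoly G = {(p, q). \<forall>i. (coeff p i, coeff q i) \<in> G}"

text \<open>The derivative that the product rule forces on \<open>poly p t\<close> when
  \<open>t\<close> has derivative \<open>y\<close>.\<close>

definition dval :: "'f \<Rightarrow> 'f \<Rightarrow> 'f poly \<times> 'f poly \<Rightarrow> 'f"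
  where "dval t y = (\<lambda>(p, q). poly q t + y * poly (pderiv p) t)"

definition adjoin :: "('f \<times> 'f) set \<Rightarrow> 'f \<Rightarrow> 'f \<Rightarrow> ('f \<times> 'f) set"
  where "adjoin G t y = {(poly p t, dval t y (p, q)) |p q. (p, q) \<in> dpoly G}"

lemma hom_of_nat: "\<iota> (of_nat n) = of_nat n"
  by (induction n) (auto simp: hom_zero hom_add hom_one)

lemma dsubD:
  assumes "dsub G"
  shows "(x, y) \<in> G \<Longrightarrow> (x', y') \<in> G \<Longrightarrow> (x + x', y + y') \<in> G"
    "(x, y) \<in> G \<Longrightarrow> (x', y') \<in> G \<Longrightarrow> (x * x', x * y' + y * x') \<in> G"
    "(\<iota> a, 0) \<in> G" "(0, y) \<in> G \<Longrightarrow> y = 0" "(0, 0) \<in> G" "(1, 0) \<in> G" "(of_nat n, 0) \<in> G"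
proof -
  show "(\<iota> a, 0) \<in> G" for a using assms by (simp add: dsub_def)
  from this[of 0] this[of 1] this[of "of_nat n"] show "(0, 0) \<in> G" "(1, 0) \<in> G" "(of_nat n, 0) \<in> G"
    by (simp_all add: hom_zero hom_one hom_of_nat)
qed (use assms in \<open>auto simp: dsub_def\<close>)

lemma dsub_sum:
  assumes "dsub G" "\<And>i. i \<in> I \<Longrightarrow> (f i, g i) \<in> G"
  shows "((\<Sum>i\<in>I. f i), (\<Sum>i\<in>I. g i)) \<in> G"
  using assms(2) by (induction I rule: infinite_finite_induct) (auto simp: dsubD[OF assms(1)])

lemma dpoly_closed:
  assumes G: "dsub G"
  shows "(p, q) \<in> dpoly G \<Longrightarrow> (p', q') \<in> dpoly G \<Longrightarrow> (p + p', q + q') \<in> dpoly G"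
    "(p, q) \<in> dpoly G \<Longrightarrow> (p', q') \<in> dpoly G \<Longrightarrow> (p * p', p * q' + q * p') \<in> dpoly G"
    "(x, y) \<in> G \<Longrightarrow> (monom x n, monom y n) \<in> dpoly G"
    "(p, q) \<in> dpoly G \<Longrightarrow> (pderiv p, pderiv q) \<in> dpoly G"
proof -
  show "(p + p', q + q') \<in> dpoly G" if "(p, q) \<in> dpoly G" "(p', q') \<in> dpoly G"
    using that by (simp add: dpoly_def dsubD[OF G])
  show "(monom x n, monom y n) \<in> dpoly G" if "(x, y) \<in> G"
    using that by (simp add: dpoly_def dsubD[OF G])
  show "(pderiv p, pderiv q) \<in> dpoly G" if "(p, q) \<in> dpoly G"
  proof -
    have "(of_nat (Suc i) * coeff p (Suc i), of_nat (Suc i) * coeff q (Suc i)) \<in> G" for i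
      using dsubD(2)[OF G dsubD(7)[OF G, of "Suc i"], of "coeff p (Suc i)" "coeff q (Suc i)"] that
      by (simp add: dpoly_def)
    then show ?thesis by (simp add: dpoly_def coeff_pderiv)
  qed
  show "(p * p', p * q' + q * p') \<in> dpoly G" if "(p, q) \<in> dpoly G" "(p', q') \<in> dpoly G"
    using that unfolding dpoly_def coeff_mult coeff_add mem_Collect_eq prod.case sum.distrib[symmetric]
    by (intro allI dsub_sum[OF G] dsubD(2)[OF G]) auto
qed

lemma dpoly_0: "dsub G \<Longrightarrow> (0, q) \<in> dpoly G \<Longrightarrow> q = 0"
  by (rule poly_eqI) (simp add: dpoly_def dsubD(4))

lemma dval_mult:
  "dval t y (p * p', p * q' + q * p') = poly p t * dval t y (p', q') + dval t y (p, q) * poly p' t"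
  by (simp add: dval_def pderiv_mult algebra_simps)

lemma dval_add: "dval t y (p + p', q + q') = dval t y (p, q) + dval t y (p', q')"
  by (simp add: dval_def pderiv_add algebra_simps)

lemma dsub_adjoin:
  assumes G: "dsub G" and z: "\<And>p q. (p, q) \<in> dpoly G \<Longrightarrow> poly p t = 0 \<Longrightarrow> dval t y (p, q) = 0"
  shows "dsub (adjoin G t y)" "G \<subseteq> adjoin G t y" "(t, y) \<in> adjoin G t y"
proof -
  have I: "(a, b) \<in> adjoin G t y" if "(p, q) \<in> dpoly G" "a = poly p t" "b = dval t y (p, q)" for a b p q
    using that by (auto simp: adjoin_def)
  show sub: "G \<subseteq> adjoin G t y"
  proof
    fix x assume "x \<in> G"
    then obtain a b where x: "x = (a, b)" "(a, b) \<in> G" by (cases x) auto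
    show "x \<in> adjoin G t y"
      unfolding x(1) by (rule I[OF dpoly_closed(3)[OF G x(2), of 0]]) (simp_all add: dval_def monom_0)
  qed
  show "(t, y) \<in> adjoin G t y"
    by (rule I[OF dpoly_closed(3)[OF G dsubD(6)[OF G], of 1]])
      (simp_all add: dval_def monom_Suc monom_0 pderiv_pCons)
  show "dsub (adjoin G t y)"
    unfolding dsub_def
  proof (intro conjI allI impI)
    fix a b a' b' assume "(a, b) \<in> adjoin G t y" "(a', b') \<in> adjoin G t y"
    then obtain p q p' q' where pq: "(p, q) \<in> dpoly G" "a = poly p t" "b = dval t y (p, q)"
      "(p', q') \<in> dpoly G" "a' = poly p' t" "b' = dval t y (p', q')" by (auto simp: adjoin_def)
    show "(a + a', b + b') \<in> adjoin G t y"
      by (rule I[OF dpoly_closed(1)[OF G pq(1,4)]]) (simp_all add: pq dval_add)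
    show "(a * a', a * b' + b * a') \<in> adjoin G t y"
      by (rule I[OF dpoly_closed(2)[OF G pq(1,4)]]) (simp_all add: pq dval_mult)
  next
    fix a show "(\<iota> a, 0) \<in> adjoin G t y" using sub dsubD(3)[OF G] by blast
  next
    fix b assume "(0, b) \<in> adjoin G t y"
    then show "b = 0" using z by (auto simp: adjoin_def)
  qed
qed

text \<open>If no nonzero polynomial over the subring kills \<open>t\<close>, the derivative of
  \<open>t\<close> is free and 0 is taken. Otherwise a relation \<open>p0\<close> of least degree
  dictates \<open>y\<close>; characteristic 0 and minimality make its formal derivative nonzero at
  \<open>t\<close>.\<close>

lemma ex_adjoin:
  assumes G: "dsub G" and char0: "\<And>n. of_nat (Suc n) \<noteq> (0 :: 'f)"
  shows "\<exists>y. dsub (adjoin G t y) \<and> G \<subseteq> adjoin G t y \<and> (t, y) \<in> adjoin G t y"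
proof (cases "\<exists>p q. (p, q) \<in> dpoly G \<and> poly p t = 0 \<and> p \<noteq> 0")
  case False
  have "dval t 0 (p, q) = 0" if "(p, q) \<in> dpoly G" "poly p t = 0" for p q
  proof -
    have "p = 0" using that False by blast
    then have "q = 0" using that(1) dpoly_0[OF G] by simp
    then show ?thesis by (simp add: dval_def)
  qed
  from dsub_adjoin[OF G this] show ?thesis by blast
next
  case True
  let ?A = "\<lambda>x. x \<in> dpoly G \<and> poly (fst x) t = 0 \<and> fst x \<noteq> 0"
  have "\<exists>x. ?A x" using True by force
  then obtain x where x: "?A x" "\<And>z. ?A z \<Longrightarrow> degree (fst x) \<le> degree (fst z)"
    using ex_has_least_nat[of ?A _ "\<lambda>x. degree (fst x)"] by metis
  obtain p0 q0 where "x = (p0, q0)" by fastforce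
  with x(1) have pq: "(p0, q0) \<in> dpoly G" "poly p0 t = 0" "p0 \<noteq> 0" by auto
  have min: "degree p0 \<le> degree p" if "(p, q) \<in> dpoly G" "poly p t = 0" "p \<noteq> 0" for p q
    using x(2)[of "(p, q)"] that \<open>x = (p0, q0)\<close> by simp
  have d0: "degree p0 \<noteq> 0"
  proof
    assume "degree p0 = 0"
    then obtain a where "p0 = [:a:]" using degree_eq_zeroE by blast
    then show False using pq by auto
  qed
  have cd: "coeff (pderiv p0) (degree p0 - 1) \<noteq> 0"
    using d0 char0[of "degree p0 - 1"] pq(3) by (simp add: coeff_pderiv del: of_nat_Suc)
  have pd0: "poly (pderiv p0) t \<noteq> 0"
  proof
    assume z: "poly (pderiv p0) t = 0"
    have "pderiv p0 \<noteq> 0" using cd by auto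
    then have "degree p0 \<le> degree (pderiv p0)" using min[OF dpoly_closed(4)[OF G pq(1)] z] by blast
    moreover have "degree (pderiv p0) \<le> degree p0 - 1"
      by (rule degree_le) (auto simp: coeff_pderiv coeff_eq_0)
    ultimately show False using d0 by simp
  qed
  define y where "y = - poly q0 t / poly (pderiv p0) t"
  have y0: "dval t y (p0, q0) = 0" using pd0 by (simp add: dval_def y_def)
  have "dval t y (p, q) = 0" if "(p, q) \<in> dpoly G" "poly p t = 0" for p q
    using that
  proof (induction "degree p" arbitrary: p q rule: less_induct)
    case less
    show ?case
    proof (cases "p = 0")
      case True
      then have "q = 0" using less.prems(1) dpoly_0[OF G] by simp
      then show ?thesis using True by (simp add: dval_def)
    next
      case False
      define n where "n = degree p - degree p0"
      have dn: "degree p0 + n = degree p" using min[OF less.prems False] by (simp add: n_def)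
      define a where "a = lead_coeff p0"
      define a' where "a' = coeff q0 (degree p0)"
      define b where "b = - lead_coeff p"
      define b' where "b' = - coeff q (degree p)"
      have aG: "(a, a') \<in> G" using pq(1) by (simp add: dpoly_def a_def a'_def)
      have "(lead_coeff p, coeff q (degree p)) \<in> G" using less.prems(1) by (simp add: dpoly_def)
      from dsubD(2)[OF G dsubD(3)[OF G, of "- 1"] this] have bG: "(b, b') \<in> G"
        by (simp add: b_def b'_def hom_minus hom_one)
      \<comment> \<open>Pseudo-division, since the coefficients form only a ring: the leading terms
        of \<open>p\<close> and \<open>p0\<close> are cross-multiplied and cancel.\<close>
      define P where "P = monom a 0 * p + monom b n * p0"
      define R where "R = (monom a 0 * q + monom a' 0 * p) + (monom b n * q0 + monom b' n * p0)"
      have PR: "(P, R) \<in> dpoly G"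
        unfolding P_def R_def
        by (intro dpoly_closed(1)[OF G] dpoly_closed(2)[OF G] dpoly_closed(3)[OF G] aG bG less.prems pq)
      have P0: "poly P t = 0" using less.prems(2) pq(2) by (simp add: P_def)
      have v: "dval t y (P, R) = a * dval t y (p, q)"
        unfolding P_def R_def dval_add dval_mult using less.prems(2) pq(2) y0 by (simp add: poly_monom)
      have a0: "a \<noteq> 0" using pq(3) by (simp add: a_def)
      have "dval t y (P, R) = 0"
      proof (cases "degree p = 0 \<or> P = 0")
        case True
        have "P = 0"
        proof (rule ccontr)
          assume "P \<noteq> 0"
          then have "degree p = 0" using True by blast
          then show False using dn d0 by simp
        qed
        then have "R = 0" using PR dpoly_0[OF G] by simp
        then show ?thesis using \<open>P = 0\<close> by (simp add: dval_def)
      next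
        case False
        have "coeff P i = 0" if "i \<ge> degree p" for i
        proof (cases "i = degree p")
          case True
          then show ?thesis
            unfolding P_def by (simp add: monom_0 coeff_monom_mult a_def b_def n_def) (use dn in \<open>simp add: n_def\<close>)
        next
          case False
          then have "coeff p i = 0" "coeff p0 (i - n) = 0" using that dn by (auto intro!: coeff_eq_0)
          then show ?thesis unfolding P_def by (simp add: monom_0 coeff_monom_mult)
        qed
        then have "degree P < degree p"
          using False by (metis leading_coeff_0_iff not_le)
        then show ?thesis using less.hyps PR P0 by blast
      qed
      then show ?thesis using v a0 by simp
    qed
  qed
  from dsub_adjoin[OF G this] show ?thesis by blast
qed

end

text \<open>An element outside an algebraically closed \<open>k\<close> is transcendental over it,
  so \<open>c\<close> may be given derivative 1. A maximal extension obtained from Zorn's lemma is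
  defined everywhere, as \<open>ex_adjoin\<close> applies to any element, inverses included.\<close>

lemma (in field_hom) ex_derivation:
  assumes ac: "\<And>p :: 'k poly. degree p > 0 \<Longrightarrow> \<exists>x. poly p x = 0"
    and char0: "\<And>n. of_nat (Suc n) \<noteq> (0 :: 'f)" and c: "c \<notin> range \<iota>"
  shows "\<exists>\<delta> :: 'f \<Rightarrow> 'f. (\<forall>x y. \<delta> (x + y) = \<delta> x + \<delta> y) \<and> (\<forall>x y. \<delta> (x * y) = x * \<delta> y + \<delta> x * y) \<and>
    (\<forall>a. \<delta> (\<iota> a) = 0) \<and> \<delta> c \<noteq> 0"
proof -
  define ek where "ek f = poly (map_poly \<iota> f) c" for f
  have cf: "coeff (map_poly \<iota> f) i = \<iota> (coeff f i)" for f i by (simp add: coeff_map_poly hom_zero)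
  have ekm: "ek (f * g) = ek f * ek g" for f g
  proof -
    have "map_poly \<iota> (f * g) = map_poly \<iota> f * map_poly \<iota> g"
      by (rule poly_eqI) (simp add: cf coeff_mult hom_sum hom_mult)
    then show ?thesis by (simp add: ek_def)
  qed
  have trans: "f = 0" if "ek f = 0" for f
    using that
  proof (induction "degree f" arbitrary: f rule: less_induct)
    case less
    show ?case
    proof (cases "degree f = 0")
      case True
      then obtain a where "f = [:a:]" using degree_eq_zeroE by blast
      then show ?thesis using less.prems by (simp add: ek_def map_poly_pCons hom_zero hom_eq_0)
    next
      case False
      then obtain \<mu> where "poly f \<mu> = 0" using ac by blast
      then obtain g where g: "f = [:-\<mu>, 1:] * g" using poly_eq_0_iff_dvd by (blast elim: dvdE)
      have "ek [:-\<mu>, 1:] = c - \<iota> \<mu>" by (simp add: ek_def map_poly_pCons hom_zero hom_one hom_minus)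
      then have "ek [:-\<mu>, 1:] \<noteq> 0" using c by auto
      then have eg: "ek g = 0" using less.prems ekm g by (metis mult_eq_0_iff)
      show ?thesis
      proof (cases "g = 0")
        case False
        then have "degree f = degree [:-\<mu>, 1:] + degree g" unfolding g by (intro degree_mult_eq) auto
        then have "g = 0" using less.hyps eg by simp
        then show ?thesis using g by simp
      qed (use g in simp)
    qed
  qed
  define G0 where "G0 = (\<lambda>a. (\<iota> a, 0 :: 'f)) ` UNIV"
  have G0: "dsub G0"
    unfolding dsub_def G0_def by (auto simp: hom_eq_0 simp flip: hom_add hom_mult)
  have "dval c 1 (p, q) = 0" if pq: "(p, q) \<in> dpoly G0" "poly p c = 0" for p q
  proof -
    have pqi: "\<exists>a. coeff p i = \<iota> a" "coeff q i = 0" for i using pq(1) by (auto simp: dpoly_def G0_def)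
    then have "q = 0" by (simp add: poly_eq_iff)
    from pqi(1) have "\<forall>i. \<exists>a. coeff p i = \<iota> a" by blast
    then obtain a where a: "\<And>i. coeff p i = \<iota> (a i)" by metis
    define f where "f = (\<Sum>i\<le>degree p. monom (a i) i)"
    have "coeff f i = a i" for i
    proof (cases "i \<le> degree p")
      case False
      then have "\<iota> (a i) = 0" using a[of i] coeff_eq_0[of p i] by simp
      then have "a i = 0" by (simp add: hom_eq_0)
      then show ?thesis using False by (simp add: f_def coeff_sum)
    qed (simp add: f_def coeff_sum)
    then have "map_poly \<iota> f = p" by (intro poly_eqI) (simp add: cf a)
    then have "p = 0" using trans[of f] pq(2) by (auto simp: ek_def)
    then show ?thesis using \<open>q = 0\<close> by (simp add: dval_def)
  qed
  from dsub_adjoin[OF G0 this] have c1: "dsub (adjoin G0 c 1)" "(c, 1) \<in> adjoin G0 c 1" by blast+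
  define \<A> where "\<A> = {G. dsub G \<and> (c, 1) \<in> G}"
  have "\<A> \<noteq> {}" using c1 by (auto simp: \<A>_def)
  moreover have "\<Union>\<C> \<in> \<A>" if ch: "\<C> \<noteq> {}" "subset.chain \<A> \<C>" for \<C>
  proof -
    have CA: "dsub G" "(c, 1) \<in> G" if "G \<in> \<C>" for G using ch(2) that by (auto simp: subset.chain_def \<A>_def)
    have "dsub (\<Union>\<C>)"
      unfolding dsub_def
    proof (intro conjI allI impI)
      fix x y x' y' assume "(x, y) \<in> \<Union>\<C>" "(x', y') \<in> \<Union>\<C>"
      then obtain G G' where GG: "G \<in> \<C>" "G' \<in> \<C>" "(x, y) \<in> G" "(x', y') \<in> G'" by blast
      then have "G \<subseteq> G' \<or> G' \<subseteq> G" using ch(2) by (auto simp: subset.chain_def)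
      then obtain X where X: "X \<in> \<C>" "(x, y) \<in> X" "(x', y') \<in> X" using GG by blast
      from dsubD(1,2)[OF CA(1)[OF X(1)] X(2,3)] X(1)
      show "(x + x', y + y') \<in> \<Union>\<C>" "(x * x', x * y' + y * x') \<in> \<Union>\<C>" by blast+
    next
      fix a show "(\<iota> a, 0) \<in> \<Union>\<C>" using ch(1) CA(1) dsubD(3) by blast
    next
      fix y assume "(0, y) \<in> \<Union>\<C>"
      then show "y = 0" using CA(1) dsubD(4) by blast
    qed
    then show ?thesis using ch(1) CA(2) by (auto simp: \<A>_def)
  qed
  ultimately obtain G where G: "G \<in> \<A>" and max: "\<And>X. X \<in> \<A> \<Longrightarrow> G \<subseteq> X \<Longrightarrow> X = G"
    using subset_Zorn_nonempty[of \<A>] by blast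
  have Gd: "dsub G" "(c, 1) \<in> G" using G by (auto simp: \<A>_def)
  have ex: "\<exists>y. (t, y) \<in> G" for t
  proof -
    obtain y where y: "dsub (adjoin G t y)" "G \<subseteq> adjoin G t y" "(t, y) \<in> adjoin G t y"
      using ex_adjoin[OF Gd(1) char0] by blast
    then have "adjoin G t y = G" using max Gd(2) by (auto simp: \<A>_def)
    then show ?thesis using y(3) by auto
  qed
  have uniq: "y = z" if "(t, y) \<in> G" "(t, z) \<in> G" for t y z
  proof -
    have "(- 1 * t, - 1 * z + 0 * t) \<in> G"
      using dsubD(2)[OF Gd(1) dsubD(3)[OF Gd(1), of "- 1"] that(2)] by (simp add: hom_minus hom_one)
    from dsubD(1)[OF Gd(1) that(1) this] have "(0, y - z) \<in> G" by simp
    then show ?thesis using dsubD(4)[OF Gd(1)] by fastforce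
  qed
  obtain \<delta> where d: "\<And>t. (t, \<delta> t) \<in> G" using ex by metis
  have "\<delta> (x + y) = \<delta> x + \<delta> y" for x y by (rule uniq[OF d dsubD(1)[OF Gd(1) d d]])
  moreover have "\<delta> (x * y) = x * \<delta> y + \<delta> x * y" for x y by (rule uniq[OF d dsubD(2)[OF Gd(1) d d]])
  moreover have "\<delta> (\<iota> a) = 0" for a by (rule uniq[OF d dsubD(3)[OF Gd(1)]])
  moreover have "\<delta> c \<noteq> 0" using uniq[OF d Gd(2)] by simp
  ultimately show ?thesis by blast
qed

section \<open>Rigidity of commutative module algebras in the dual\<close>

context hopf_ext
begin

lemma hit_conv:
  assumes "h \<in> C" "x \<in> C" "\<phi> \<in> K" "\<psi> \<in> K"
  shows "hit h (\<phi> \<star> \<psi>) x = sw (\<lambda>c d. (hit c \<phi> \<star> hit d \<psi>) x) h"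
proof -
  have "hit h (\<phi> \<star> \<psi>) x = sw (\<lambda>a b. sw (\<lambda>c d. \<phi> (a \<otimes> c) * \<psi> (b \<otimes> d)) h) x"
    using assms by (simp add: conv_apply sw_mult blin_mult K_lin)
  also have "\<dots> = sw (\<lambda>c d. sw (\<lambda>a b. \<phi> (a \<otimes> c) * \<psi> (b \<otimes> d)) x) h" by (rule sw_swap)
  also have "\<dots> = sw (\<lambda>c d. (hit c \<phi> \<star> hit d \<psi>) x) h"
    using assms by (simp add: conv_apply)
  finally show ?thesis .
qed

lemma hit_hit:
  assumes "h \<in> C" "g \<in> C" "\<phi> \<in> K"
  shows "hit h (hit g \<phi>) = hit (h \<otimes> g) \<phi>"
  by (rule K_eqI) (use assms in \<open>simp_all add: m_assoc\<close>)

lemma hit_one: "\<phi> \<in> K \<Longrightarrow> hit \<one> \<phi> = \<phi>"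
  by (rule K_eqI) simp_all

lemma hit_add: "hit h (\<phi> + \<psi>) = hit h \<phi> + hit h \<psi>"
  and hit_scale: "hit h (fsc c \<phi>) = fsc c (hit h \<phi>)"
  by (simp_all add: hit_def restr_def fun_eq_iff)

lemma lin_hit: "\<phi> \<in> K \<Longrightarrow> x \<in> C \<Longrightarrow> lin (\<lambda>z. hit z \<phi> x)"
  using lin_comp[OF K_lin, of \<phi> "\<lambda>z. x \<otimes> z"] by (simp add: linI)

lemma hit_add_arg:
  assumes "\<phi> \<in> K" "y \<in> C" "z \<in> C"
  shows "hit (y + z) \<phi> = hit y \<phi> + hit z \<phi>"
  by (rule K_eqI) (use assms in \<open>simp_all add: lin_add[OF lin_hit] del: hit_apply\<close>)

lemma hit_scale_arg:
  assumes "\<phi> \<in> K" "z \<in> C"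
  shows "hit (s c z) \<phi> = fsc (\<iota> c) (hit z \<phi>)"
  by (rule K_eqI) (use assms in \<open>simp_all add: lin_scale[OF lin_hit] del: hit_apply\<close>)

end

locale dual_module_algebra = fd_hopf_ext H \<iota>
  for H :: "('k::field, 'h::ab_group_add) hopf" (structure) and \<iota> :: "'k \<Rightarrow> 'f::field" +
  fixes L :: 'h and R :: "('h \<Rightarrow> 'f) set"
  assumes L: "L \<in> C" "counit H L = 1"
    and L_left: "h \<in> C \<Longrightarrow> h \<otimes> L = s (counit H h) L"
    and L_right: "h \<in> C \<Longrightarrow> L \<otimes> h = s (counit H h) L"
    and char0: "of_nat (Suc n) \<noteq> (0 :: 'f)"
    and R_sub: "fv.subspace R" and R_K: "R \<subseteq> K" and R_eps: "eps \<in> R"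
    and R_conv: "r \<in> R \<Longrightarrow> r' \<in> R \<Longrightarrow> r \<star> r' \<in> R"
    and R_comm: "r \<in> R \<Longrightarrow> r' \<in> R \<Longrightarrow> r \<star> r' = r' \<star> r"
    and R_hit: "h \<in> C \<Longrightarrow> r \<in> R \<Longrightarrow> hit h r \<in> R"
begin

notation conv (infixl "\<star>" 70)

lemma RK [simp]: "r \<in> R \<Longrightarrow> r \<in> K"
  using R_K by blast

lemmas R_closed = fv.subspace_0[OF R_sub] fv.subspace_add[OF R_sub] fv.subspace_diff[OF R_sub]
  fv.subspace_scale[OF R_sub] fv.subspace_sum[OF R_sub] R_eps R_conv R_hit

definition B :: "('h \<Rightarrow> 'f) \<Rightarrow> ('h \<Rightarrow> 'f) \<Rightarrow> 'f"
  where "B r r' = (r \<star> r') L"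

lemma B_sym: "r \<in> R \<Longrightarrow> r' \<in> R \<Longrightarrow> B r r' = B r' r"
  by (simp add: B_def R_comm)

lemma B_lin:
  "B (r + r') r'' = B r r'' + B r' r''" "B r'' (r + r') = B r'' r + B r'' r'"
  "B (r - r') r'' = B r r'' - B r' r''" "B r'' (r - r') = B r'' r - B r'' r'"
  "B (fsc c r) r' = c * B r r'" "B r (fsc c r') = c * B r r'"
  "B (\<Sum>i\<in>I. f i) r = (\<Sum>i\<in>I. B (f i) r)" "B r (\<Sum>i\<in>I. f i) = (\<Sum>i\<in>I. B r (f i))"
  unfolding B_def conv_add_left conv_add_right conv_diff_left conv_diff_right conv_scale_left
    conv_scale_right conv_sum_left conv_sum_right
  by (simp_all only: plus_fun_apply minus_apply fsc_apply sum_fun_apply)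

lemma B_zero [simp]: "B 0 r = 0" "B r 0 = 0"
  unfolding B_def conv_zero by (simp_all only: zero_fun_apply)

text \<open>Since \<open>L\<close> is an integral,
  \<open>B (h1 r) (h2 r') = \<epsilon> h B r r'\<close>. Inserting this into
  \<open>B r (S h r')\<close> makes \<open>h2 S h3\<close> cancel.\<close>

lemma B_adjoint:
  assumes h: "h \<in> C" and r: "r \<in> R" "r' \<in> R"
  shows "B (hit h r) r' = B r (hit (S h) r')"
proof -
  have inv: "sw (\<lambda>c d. B (hit c r) (hit d r'')) g = \<epsilon> g * B r r''" if "g \<in> C" "r'' \<in> R" for g r''
  proof -
    have "sw (\<lambda>c d. B (hit c r) (hit d r'')) g = hit g (r \<star> r'') L"
      unfolding B_def using hit_conv[OF that(1) L(1)] r that by simp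
    also have "\<dots> = (r \<star> r'') (s (counit H g) L)"
      using that L by (simp add: L_right)
    also have "\<dots> = \<epsilon> g * B r r''"
      unfolding B_def by (rule lin_scale[OF K_lin L(1)]) (use r that in simp)
    finally show ?thesis .
  qed
  have B_sw: "B (hit a r) (hit z r') = sw (\<lambda>p q. r (p \<otimes> a) * r' (q \<otimes> z)) L" for a z
    using L(1) by (simp add: B_def conv_apply)
  have B_sw': "B (hit a r) r' = sw (\<lambda>p q. r (p \<otimes> a) * r' q) L" for a
    using L(1) by (simp add: B_def conv_apply)
  have B_sw'': "B r (hit z r') = sw (\<lambda>p q. r p * r' (q \<otimes> z)) L" for z
    using L(1) by (simp add: B_def conv_apply)
  note l = linI K_comp[OF RK[OF r(1)]] K_comp[OF RK[OF r(2)]] L(1)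
  have "tlin (\<lambda>a b c. B (hit a r) (hit (b \<otimes> S c) r'))"
    unfolding B_sw by (intro l | simp)+
  note co = sw_coassoc[OF h this]
  have 1: "B (hit c r) (hit (d \<otimes> S b) r') = B (hit c r) (hit d (hit (S b) r'))"
    if "b \<in> C" "d \<in> C" for b c d
    using that r by (simp add: hit_hit)
  have "B r (hit (S h) r') = sw (\<lambda>a b. \<epsilon> a * B r (hit (S b) r')) h"
    by (rule sw_counit(1)[OF h, symmetric]) (unfold B_sw'', (intro l | simp)+)
  also have "\<dots> = sw (\<lambda>a b. sw (\<lambda>c d. B (hit c r) (hit (d \<otimes> S b) r')) a) h"
    using h r by (simp add: 1 inv R_hit)
  also have "\<dots> = sw (\<lambda>a b. sw (\<lambda>c d. B (hit a r) (hit (c \<otimes> S d) r')) b) h"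
    by (rule co)
  also have "\<dots> = sw (\<lambda>a b. B (hit a r) r' * \<epsilon> b) h"
  proof (rule sw_cong[OF refl h])
    fix a b assume ab: "a \<in> C" "b \<in> C"
    have "lin (\<lambda>z. B (hit a r) (hit z r'))"
      unfolding B_sw using ab by (intro l | simp)+
    from sw_antipode(2)[OF ab(2) this]
    show "sw (\<lambda>c d. B (hit a r) (hit (c \<otimes> S d) r')) b = B (hit a r) r' * \<epsilon> b"
      using r by (simp add: hit_one)
  qed
  also have "\<dots> = B (hit h r) r'"
    by (rule sw_counit(2)[OF h]) (unfold B_sw', (intro l | simp)+)
  finally show ?thesis by simp
qed

definition rad :: "('h \<Rightarrow> 'f) set"
  where "rad = {r \<in> R. \<forall>r'\<in>R. B r r' = 0}"

lemma rad_R: "r \<in> rad \<Longrightarrow> r \<in> R"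
  by (simp add: rad_def)

lemma rad_sub: "fv.subspace rad"
proof (rule fv.subspaceI)
  show "0 \<in> rad" unfolding rad_def using R_closed(1) by simp
  show "r + r' \<in> rad" if "r \<in> rad" "r' \<in> rad" for r r'
    using that R_closed(2) unfolding rad_def by (simp add: B_lin(1))
  show "fsc c r \<in> rad" if "r \<in> rad" for c r
    using that R_closed(4) unfolding rad_def by (simp add: B_lin(5))
qed

lemma rad_ideal: "r \<in> R \<Longrightarrow> r' \<in> rad \<Longrightarrow> r \<star> r' \<in> rad"
proof -
  assume r: "r \<in> R" "r' \<in> rad"
  have "B (r \<star> r') r'' = B r' (r \<star> r'')" if "r'' \<in> R" for r''
    unfolding B_def R_comm[OF r(1) rad_R[OF r(2)]]
    by (rule arg_cong[of _ _ "\<lambda>f. f L"]) (rule conv_assoc; rule RK; use r that rad_R in blast)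
  then show ?thesis using r by (simp add: rad_def R_conv)
qed

lemma rad_hit: "h \<in> C \<Longrightarrow> r \<in> rad \<Longrightarrow> hit h r \<in> rad"
  by (auto simp: rad_def R_hit B_adjoint)

declare rad_R [simp]

text \<open>The product of the ideal \<open>rad\<close> with a set of vectors, from which Nakayama's
  argument removes the generators one by one.\<close>

definition M :: "('h \<Rightarrow> 'f) set \<Rightarrow> ('h \<Rightarrow> 'f) set"
  where "M Z = fv.span {r \<star> z |r z. r \<in> rad \<and> z \<in> Z}"

lemma M_mult:
  assumes "Z \<subseteq> K" "a \<in> R" "m \<in> M Z"
  shows "a \<star> m \<in> M Z"
proof -
  have "M Z \<subseteq> {m. a \<star> m \<in> M Z}"
    unfolding M_def[of Z]
  proof (rule fv.span_minimal)
    show "{r \<star> z |r z. r \<in> rad \<and> z \<in> Z} \<subseteq> {m. a \<star> m \<in> fv.span {r \<star> z |r z. r \<in> rad \<and> z \<in> Z}}"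
    proof
      fix m assume "m \<in> {r \<star> z |r z. r \<in> rad \<and> z \<in> Z}"
      then obtain r z where m: "m = r \<star> z" "r \<in> rad" "z \<in> Z" by blast
      then have "a \<star> m = (a \<star> r) \<star> z" using assms by (simp add: conv_assoc subset_eq)
      then have "a \<star> m \<in> {r \<star> z |r z. r \<in> rad \<and> z \<in> Z}"
        using rad_ideal[OF assms(2) m(2)] m(3) by blast
      then show "m \<in> {m. a \<star> m \<in> fv.span {r \<star> z |r z. r \<in> rad \<and> z \<in> Z}}"
        by (simp only: mem_Collect_eq fv.span_base)
    qed
    show "fv.subspace {m. a \<star> m \<in> fv.span {r \<star> z |r z. r \<in> rad \<and> z \<in> Z}}"
      by (rule fv.subspaceI)
        (simp_all only: mem_Collect_eq conv_zero conv_add_right conv_scale_right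
          fv.span_zero fv.span_add fv.span_scale)
  qed
  then show ?thesis using assms(3) by blast
qed

lemma M_insert:
  assumes "m \<in> M (insert y Z)"
  obtains r m' where "r \<in> rad" "m' \<in> M Z" "m = r \<star> y + m'"
proof -
  have "{r \<star> z |r z. r \<in> rad \<and> z \<in> insert y Z} = (\<lambda>r. r \<star> y) ` rad \<union> {r \<star> z |r z. r \<in> rad \<and> z \<in> Z}"
    by blast
  then have "m \<in> fv.span ((\<lambda>r. r \<star> y) ` rad \<union> {r \<star> z |r z. r \<in> rad \<and> z \<in> Z})"
    using assms by (simp only: M_def)
  then obtain p m' where pm: "p \<in> fv.span ((\<lambda>r. r \<star> y) ` rad)" "m' \<in> M Z" "m = p + m'"
    unfolding fv.span_Un M_def by blast
  have "fv.span ((\<lambda>r. r \<star> y) ` rad) \<subseteq> (\<lambda>r. r \<star> y) ` rad"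
  proof (rule fv.span_minimal[OF order_refl], rule fv.subspaceI)
    show "0 \<in> (\<lambda>r. r \<star> y) ` rad"
      by (rule image_eqI, rule conv_zero(1)[symmetric], rule fv.subspace_0[OF rad_sub])
  next
    fix a b assume "a \<in> (\<lambda>r. r \<star> y) ` rad" "b \<in> (\<lambda>r. r \<star> y) ` rad"
    then obtain r r' where "a = r \<star> y" "b = r' \<star> y" and r: "r \<in> rad" "r' \<in> rad" by blast
    then show "a + b \<in> (\<lambda>r. r \<star> y) ` rad"
      by (simp only:) (rule image_eqI, rule conv_add_left[symmetric], rule fv.subspace_add[OF rad_sub r])
  next
    fix c a assume "a \<in> (\<lambda>r. r \<star> y) ` rad"
    then obtain r where "a = r \<star> y" and r: "r \<in> rad" by blast
    then show "fsc c a \<in> (\<lambda>r. r \<star> y) ` rad"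
      by (simp only:) (rule image_eqI, rule conv_scale_left[symmetric], rule fv.subspace_scale[OF rad_sub r])
  qed
  then show ?thesis using that pm by blast
qed

text \<open>The radical generates the unit ideal of \<open>K\<close> unless it vanishes; Nakayama's lemma for the
  finitely generated module \<open>K\<close> then puts the unit into the radical.\<close>

lemma B_nondeg:
  assumes r: "r \<in> R" and z: "\<And>r'. r' \<in> R \<Longrightarrow> B r r' = 0"
  shows "r = 0"
proof (rule ccontr)
  assume "r \<noteq> 0"
  have rr: "r \<in> rad" unfolding rad_def using assms by blast
  obtain x where x: "x \<in> C" "r x \<noteq> 0"
    using \<open>r \<noteq> 0\<close> K_eqI[OF RK[OF r] K_closed(1)] by fastforce
  \<comment> \<open>A translate of \<open>r\<close> normalised to 1 at \<one>, so that
    \<open>\<epsilon> h = r0 (h1 S h2)\<close>; expanding \<open>S h2\<close> puts the unit into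
    \<open>rad K\<close>.\<close>
  define r0 where "r0 = fsc (1 / r x) (hit x r)"
  have r0: "r0 \<in> rad" unfolding r0_def by (intro fv.subspace_scale[OF rad_sub] rad_hit x rr)
  have r01: "r0 \<one> = 1" using x by (simp add: r0_def)
  obtain T w where T: "T \<subseteq> C" and I: "interp K T w" using K_interp by blast
  define \<phi> where "\<phi> t = restr (\<lambda>x. w t (S x))" for t
  have \<phi>K: "\<phi> t \<in> K" if "t \<in> T" for t
    unfolding \<phi>_def by (intro restr_K K_comp[OF interpD(2)[OF I that]] linI)
  have eps: "eps = (\<Sum>t\<in>T. hit t r0 \<star> \<phi> t)"
  proof (rule K_eqI)
    fix h assume h: "h \<in> C"
    have e: "r0 (a \<otimes> S b) = (\<Sum>t\<in>T. r0 (a \<otimes> t) * w t (S b))" if "a \<in> C" "b \<in> C" for a b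
    proof -
      have "lin (\<lambda>z. r0 (a \<otimes> z))"
        using that by (intro K_comp[OF RK[OF rad_R[OF r0]]] linI)
      from lin_expand[OF I T this, of "S b"] show ?thesis using that by (simp add: mult.commute)
    qed
    have "\<epsilon> h = sw (\<lambda>a b. r0 (a \<otimes> S b)) h"
      using sw_antipode(2)[OF h K_lin[OF RK[OF rad_R[OF r0]]]] r01 by simp
    also have "\<dots> = (\<Sum>t\<in>T. sw (\<lambda>a b. r0 (a \<otimes> t) * w t (S b)) h)"
      using h by (simp add: e sw_sumf)
    also have "\<dots> = (\<Sum>t\<in>T. hit t r0 \<star> \<phi> t) h"
      using h by (simp add: conv_apply \<phi>_def)
    finally show "eps h = (\<Sum>t\<in>T. hit t r0 \<star> \<phi> t) h" using h by (simp add: eps_apply)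
  qed (use T r0 \<phi>K in \<open>auto intro!: K_sum conv_K hit_K simp: subset_eq\<close>)
  obtain Y where Y: "finite Y" "K = fv.span Y" using K_fin by blast
  have YK: "Y \<subseteq> K" using Y(2) fv.span_superset by blast
  have M0: "\<psi> \<in> M Y" if "\<psi> \<in> K" for \<psi>
  proof -
    have gen: "a \<star> \<chi> \<in> M Y" if "a \<in> rad" "\<chi> \<in> K" for a \<chi>
    proof -
      have "K \<subseteq> {\<chi>. a \<star> \<chi> \<in> M Y}"
        unfolding Y(2)
      proof (rule fv.span_minimal)
        show "Y \<subseteq> {\<chi>. a \<star> \<chi> \<in> M Y}" unfolding M_def using that(1) by (blast intro: fv.span_base)
        show "fv.subspace {\<chi>. a \<star> \<chi> \<in> M Y}"
          unfolding M_def by (rule fv.subspaceI)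
            (simp_all only: mem_Collect_eq conv_zero conv_add_right conv_scale_right
              fv.span_zero fv.span_add fv.span_scale)
      qed
      then show ?thesis using that(2) by blast
    qed
    have "\<psi> = (\<Sum>t\<in>T. hit t r0 \<star> \<phi> t) \<star> \<psi>" using that eps by (metis conv_eps(1))
    also have "\<dots> = (\<Sum>t\<in>T. hit t r0 \<star> (\<phi> t \<star> \<psi>))"
      unfolding conv_sum_left using T r0 \<phi>K that
      by (intro sum.cong refl conv_assoc) (auto simp: subset_eq)
    finally have "\<psi> = (\<Sum>t\<in>T. hit t r0 \<star> (\<phi> t \<star> \<psi>))" .
    moreover have "\<dots> \<in> M Y"
      unfolding M_def[of Y] by (rule fv.span_sum, fold M_def[of Y])
        (use T r0 \<phi>K that in \<open>auto intro!: gen rad_hit conv_K\<close>)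
    ultimately show ?thesis by simp
  qed
  \<comment> \<open>Induction on the generators discarded; once all are gone, the unit equals an
    element of \<open>rad\<close>.\<close>
  have "\<exists>r\<in>rad. \<forall>\<psi>\<in>K. (eps - r) \<star> \<psi> \<in> M (Y - X)" if "finite X" "X \<subseteq> Y" for X
    using that
  proof (induction X rule: finite_induct)
    case empty
    show ?case
      by (rule bexI[of _ 0]) (use M0 fv.subspace_0[OF rad_sub] in \<open>simp_all only: diff_zero conv_eps(1) Diff_empty ball_simps\<close>, simp)
  next
    case (insert y X)
    define Z where "Z = Y - insert y X"
    have Z: "Y - X = insert y Z" "Z \<subseteq> K" using insert YK by (auto simp: Z_def)
    obtain r where r: "r \<in> rad" "\<And>\<psi>. \<psi> \<in> K \<Longrightarrow> (eps - r) \<star> \<psi> \<in> M (insert y Z)"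
      using insert.IH insert.prems unfolding Z(1) by blast
    have yK: "y \<in> K" using insert YK by blast
    obtain ry m where ry: "ry \<in> rad" "m \<in> M Z" "(eps - r) \<star> y = ry \<star> y + m"
      using M_insert[OF r(2)[OF yK]] .
    \<comment> \<open>This multiplier sends \<open>y\<close> into \<open>M Z\<close>; commutativity
      of \<open>R\<close> moves it past the coefficient \<open>a\<close> of \<open>y\<close> below,
      so \<open>y\<close> drops out of the generators.\<close>
    define e' where "e' = eps - r - ry"
    define r'' where "r'' = (r + r + ry) - (r + ry) \<star> r"
    have in_rad: "r + ry \<in> rad" "r'' \<in> rad"
      unfolding r''_def by (intro fv.subspace_add[OF rad_sub] fv.subspace_diff[OF rad_sub] r ry
          rad_ideal rad_R)+
    have e'R: "e' \<in> R" unfolding e'_def using r ry by (simp add: R_closed)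
    have e'y: "e' \<star> y = m" unfolding e'_def conv_diff_left[of "eps - r"] ry(3) by (rule add_diff_cancel_left')
    have ee: "e' \<star> (eps - r) = eps - r''"
    proof -
      have "e' \<star> (eps - r) = eps - r - (eps \<star> r - r \<star> r) - (ry - ry \<star> r)"
        unfolding e'_def conv_diff_right conv_diff_left using r ry by (simp only: conv_eps RK rad_R eps_K) (simp only: algebra_simps)
      also have "\<dots> = eps - r''"
        unfolding r''_def conv_add_left using r by (simp only: conv_eps RK rad_R) (simp only: algebra_simps)
      finally show ?thesis .
    qed
    have "(eps - r'') \<star> \<psi> \<in> M Z" if \<psi>: "\<psi> \<in> K" for \<psi>
    proof -
      obtain a m' where a: "a \<in> rad" "m' \<in> M Z" "(eps - r) \<star> \<psi> = a \<star> y + m'"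
        using M_insert[OF r(2)[OF \<psi>]] .
      have "(eps - r'') \<star> \<psi> = e' \<star> ((eps - r) \<star> \<psi>)"
        unfolding ee[symmetric] by (rule conv_assoc) (use e'R r \<psi> in \<open>simp_all add: K_closed\<close>)
      also have "\<dots> = e' \<star> (a \<star> y) + e' \<star> m'" unfolding a(3) by (rule conv_add_right)
      also have "e' \<star> (a \<star> y) = a \<star> m"
        unfolding e'y[symmetric] using e'R a(1) yK
        by (simp add: R_comm[of e' a] flip: conv_assoc)
      finally have "(eps - r'') \<star> \<psi> = a \<star> m + e' \<star> m'" .
      moreover have "a \<star> m \<in> M Z" "e' \<star> m' \<in> M Z"
        using M_mult[OF Z(2)] a ry e'R by auto
      ultimately show ?thesis unfolding M_def[of Z] by (simp only: fv.span_add)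
    qed
    then show ?case using in_rad(2) unfolding Z_def by blast
  qed
  from this[OF Y(1) order_refl] obtain r1 where r1: "r1 \<in> rad" "(eps - r1) \<star> eps \<in> M (Y - Y)"
    using eps_K by blast
  have "M {} = {0}" by (simp add: M_def fv.span_empty)
  then have "(eps - r1) \<star> eps = 0" using r1(2) by simp
  then have "eps - r1 = 0" using r1(1) by (simp only: conv_eps K_closed eps_K RK rad_R)
  then have "eps \<in> rad" using r1(1) by (simp only: right_minus_eq)
  then have "B eps eps = 0" using R_eps unfolding rad_def by blast
  then show False using L by (simp add: B_def eps_apply hom_one)
qed

text \<open>Nondegeneracy represents evaluation at each point of \<open>T\<close> by an element
  \<open>u t\<close>. If the rows \<open>\<beta> r\<close> had fewer pivots than \<open>T\<close>, a
  nontrivial combination of the \<open>w t\<close> would be orthogonal to \<open>R\<close>.\<close>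

lemma ex_dual_bases:
  "\<exists>T w u. T \<subseteq> C \<and> interp R T w \<and> (\<forall>t\<in>T. u t \<in> R \<and> (\<forall>r\<in>R. B (u t) r = r t))"
proof -
  obtain T w where T: "T \<subseteq> C" and I: "interp R T w" using subspace_interp[OF R_sub R_K] by blast
  note D = interpD[OF I]
  define \<beta> where "\<beta> r = (\<lambda>t. if t \<in> T then B r (w t) else 0)" for r
  define W where "W = \<beta> ` R"
  have sub: "fv.subspace W"
  proof (rule fv.subspaceI)
    have "0 = \<beta> 0" by (simp add: \<beta>_def fun_eq_iff)
    then show "0 \<in> W" unfolding W_def using R_closed(1) by blast
  next
    fix a b assume "a \<in> W" "b \<in> W"
    then obtain r r' where "r \<in> R" "r' \<in> R" "a = \<beta> r" "b = \<beta> r'" unfolding W_def by blast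
    moreover have "\<beta> r + \<beta> r' = \<beta> (r + r')" by (simp add: \<beta>_def fun_eq_iff B_lin)
    ultimately show "a + b \<in> W" unfolding W_def using R_closed(2) by (metis imageI)
  next
    fix c a assume "a \<in> W"
    then obtain r where "r \<in> R" "a = \<beta> r" unfolding W_def by blast
    moreover have "fsc c (\<beta> r) = \<beta> (fsc c r)" by (simp add: \<beta>_def fun_eq_iff B_lin)
    ultimately show "fsc c a \<in> W" unfolding W_def using R_closed(4) by (metis imageI)
  qed
  have "\<beta> r \<in> fv.span ((\<lambda>t. \<beta> (w t)) ` T)" if "r \<in> R" for r
  proof -
    have "B r (w q) = (\<Sum>t\<in>T. r t * B (w t) (w q))" for q
      using arg_cong[OF interp_expand[OF I that], of "\<lambda>r. B r (w q)"] by (simp only: B_lin)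
    then have "\<beta> r = (\<Sum>t\<in>T. fsc (r t) (\<beta> (w t)))" by (simp add: \<beta>_def fun_eq_iff)
    moreover have "\<dots> \<in> fv.span ((\<lambda>t. \<beta> (w t)) ` T)"
      by (rule fv.span_sum, rule fv.span_scale, rule fv.span_base, erule imageI)
    ultimately show ?thesis by (simp only:)
  qed
  then have "W \<subseteq> fv.span ((\<lambda>t. \<beta> (w t)) ` T)" unfolding W_def by blast
  moreover have "fv.span ((\<lambda>t. \<beta> (w t)) ` T) \<subseteq> W"
    by (rule fv.span_minimal[OF _ sub]) (use D(2) in \<open>auto simp: W_def\<close>)
  ultimately have W: "W = fv.span ((\<lambda>t. \<beta> (w t)) ` T)" by blast
  have "\<phi> x = 0" if "\<phi> \<in> (\<lambda>t. \<beta> (w t)) ` T" "x \<notin> T" for \<phi> x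
    using that by (auto simp: \<beta>_def)
  with ex_interp[of "(\<lambda>t. \<beta> (w t)) ` T" T] D(1)
  obtain T' v where T': "T' \<subseteq> T" and I': "interp W T' v" unfolding W by blast
  note D' = interpD[OF I']
  have "q \<in> T'" if q: "q \<in> T" for q
  proof (rule ccontr)
    assume nq: "q \<notin> T'"
    define r where "r = w q - (\<Sum>t\<in>T'. fsc (v t q) (w t))"
    have wR: "w t \<in> R" if "t \<in> T" for t using D(2)[OF that] .
    have r: "r \<in> R" unfolding r_def by (intro R_closed wR) (use q T' in auto)
    have "B r r' = 0" if r': "r' \<in> R" for r'
    proof -
      have "\<beta> r' q = (\<Sum>t\<in>T'. \<beta> r' t * v t q)" by (rule D'(4)) (use r' in \<open>simp add: W_def\<close>)
      also have "\<beta> r' q = B r' (w q)" using q by (simp add: \<beta>_def)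
      also have "(\<Sum>t\<in>T'. \<beta> r' t * v t q) = (\<Sum>t\<in>T'. v t q * B r' (w t))"
        using T' by (intro sum.cong refl) (auto simp: \<beta>_def mult.commute)
      finally have "B r' r = 0" unfolding r_def B_lin by simp
      then show ?thesis using B_sym[OF r r'] by simp
    qed
    then have "r = 0" by (rule B_nondeg[OF r])
    then have "r q = 0" by simp
    moreover have "(\<Sum>t\<in>T'. v t q * w t q) = 0"
    proof (rule sum.neutral, rule ballI)
      fix t assume "t \<in> T'"
      then have "t \<in> T" "t \<noteq> q" using T' nq by blast+
      then show "v t q * w t q = 0" using D(3)[of t q] q by simp
    qed
    ultimately show False using q D(3)[OF q q] by (simp add: r_def)
  qed
  then have TT: "T' = T" using T' by blast
  have "\<exists>u. u \<in> R \<and> v t = \<beta> u" if "t \<in> T" for t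
    using D'(2)[of t] that unfolding TT W_def by blast
  then obtain u where u: "\<And>t. t \<in> T \<Longrightarrow> u t \<in> R" "\<And>t. t \<in> T \<Longrightarrow> v t = \<beta> (u t)" by metis
  have uw: "B (u t) (w q) = (if t = q then 1 else 0)" if "t \<in> T" "q \<in> T" for t q
    using D'(3)[of t q] u(2)[OF that(1)] that unfolding TT by (simp add: \<beta>_def)
  have "B (u t) r = r t" if "t \<in> T" "r \<in> R" for t r
  proof -
    have "B (u t) r = (\<Sum>q\<in>T. r q * B (u t) (w q))"
      using arg_cong[OF interp_expand[OF I that(2)], of "B (u t)"] by (simp only: B_lin)
    also have "\<dots> = (\<Sum>q\<in>T. if q = t then r q else 0)"
      by (intro sum.cong refl) (use uw that in auto)
    finally show ?thesis using that D(1) by simp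
  qed
  then show ?thesis using T I u(1) by blast
qed

end

section \<open>The Casimir element of \<open>R\<close> and stability under derivations\<close>

locale dual_bases = dual_module_algebra H \<iota> L R
  for H :: "('k::field, 'h::ab_group_add) hopf" (structure) and \<iota> :: "'k \<Rightarrow> 'f::field"
    and L :: 'h and R :: "('h \<Rightarrow> 'f) set" +
  fixes T :: "'h set" and w u :: "'h \<Rightarrow> 'h \<Rightarrow> 'f"
  assumes TC: "T \<subseteq> C" and w_interp: "interp R T w"
    and u_R: "t \<in> T \<Longrightarrow> u t \<in> R" and B_u: "t \<in> T \<Longrightarrow> r \<in> R \<Longrightarrow> B (u t) r = r t"
begin

notation conv (infixl "\<star>" 70)

lemmas T_fin = interpD(1)[OF w_interp] and w_R = interpD(2)[OF w_interp]
  and w_dual = interpD(3)[OF w_interp] and w_expand = interp_expand[OF w_interp]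

lemma u_expand:
  assumes r: "r \<in> R"
  shows "r = (\<Sum>t\<in>T. fsc (B r (w t)) (u t))"
proof -
  have "r - (\<Sum>t\<in>T. fsc (B r (w t)) (u t)) = 0"
  proof (rule B_nondeg)
    fix r' assume r': "r' \<in> R"
    have "B r r' = (\<Sum>t\<in>T. r' t * B r (w t))"
      using arg_cong[OF w_expand[OF r'], of "B r"] by (simp only: B_lin)
    also have "\<dots> = (\<Sum>t\<in>T. B r (w t) * B (u t) r')"
      using r' by (intro sum.cong refl) (simp add: B_u mult.commute)
    finally show "B (r - (\<Sum>t\<in>T. fsc (B r (w t)) (u t))) r' = 0" by (simp only: B_lin diff_self)
  qed (intro R_closed r u_R)
  then show ?thesis by (simp only: right_minus_eq)
qed

text \<open>Bilinear functionals on \<open>R\<close> stand in for tensors: an identity in the tensor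
  square of \<open>R\<close> is stated for all \<open>J\<close>.\<close>

definition rbil :: "(('h \<Rightarrow> 'f) \<Rightarrow> ('h \<Rightarrow> 'f) \<Rightarrow> 'f) \<Rightarrow> bool"
  where "rbil J \<longleftrightarrow> (\<forall>p\<in>R. \<forall>q\<in>R. \<forall>r\<in>R. J (p + q) r = J p r + J q r \<and> J r (p + q) = J r p + J r q) \<and>
    (\<forall>c. \<forall>p\<in>R. \<forall>q\<in>R. J (fsc c p) q = c * J p q \<and> J p (fsc c q) = c * J p q)"

lemma rbilD:
  assumes "rbil J" "p \<in> R"
  shows "q \<in> R \<Longrightarrow> r \<in> R \<Longrightarrow> J (p + q) r = J p r + J q r"
    "q \<in> R \<Longrightarrow> J (fsc c p) q = c * J p q"
    "(\<And>i. i \<in> I \<Longrightarrow> f i \<in> R) \<Longrightarrow> J (\<Sum>i\<in>I. fsc (k i) (f i)) p = (\<Sum>i\<in>I. k i * J (f i) p)"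
    "(\<And>i. i \<in> I \<Longrightarrow> f i \<in> R) \<Longrightarrow> J p (\<Sum>i\<in>I. fsc (k i) (f i)) = (\<Sum>i\<in>I. k i * J p (f i))"
proof -
  have s: "J (fsc c p) q = c * J p q" "J p (fsc c q) = c * J p q" if "p \<in> R" "q \<in> R" for c p q
    using assms(1) that unfolding rbil_def by blast+
  have a: "J (p + q) r = J p r + J q r" "J r (p + q) = J r p + J r q"
    if "p \<in> R" "q \<in> R" "r \<in> R" for p q r
    using assms(1) that unfolding rbil_def by blast+
  have z: "J 0 p = 0" "J p 0 = 0"
    using s[OF assms(2) assms(2), of 0] s(1)[OF R_closed(1) assms(2), of 0]
      s(2)[OF assms(2) R_closed(1), of 0] by (simp_all only: fv.scale_zero_right mult_zero_left)
  show "q \<in> R \<Longrightarrow> r \<in> R \<Longrightarrow> J (p + q) r = J p r + J q r" "q \<in> R \<Longrightarrow> J (fsc c p) q = c * J p q"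
    using s a assms(2) by blast+
  show "J (\<Sum>i\<in>I. fsc (k i) (f i)) p = (\<Sum>i\<in>I. k i * J (f i) p)" if "\<And>i. i \<in> I \<Longrightarrow> f i \<in> R"
    using that
  proof (induction I rule: infinite_finite_induct)
    case (insert i I)
    then have fi: "f i \<in> R" and R: "fsc (k i) (f i) \<in> R" "(\<Sum>i\<in>I. fsc (k i) (f i)) \<in> R"
      by (auto intro!: R_closed)
    from insert have "J (\<Sum>i\<in>I. fsc (k i) (f i)) p = (\<Sum>i\<in>I. k i * J (f i) p)" by blast
    then show ?case unfolding sum.insert[OF insert.hyps] a(1)[OF R assms(2)] s(1)[OF fi assms(2)] by simp
  next
    case (infinite I)
    show ?case unfolding sum.infinite[OF infinite(1)] by (rule z(1))
  qed (simp only: sum.empty z)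
  show "J p (\<Sum>i\<in>I. fsc (k i) (f i)) = (\<Sum>i\<in>I. k i * J p (f i))" if "\<And>i. i \<in> I \<Longrightarrow> f i \<in> R"
    using that
  proof (induction I rule: infinite_finite_induct)
    case (insert i I)
    then have fi: "f i \<in> R" and R: "fsc (k i) (f i) \<in> R" "(\<Sum>i\<in>I. fsc (k i) (f i)) \<in> R"
      by (auto intro!: R_closed)
    from insert have "J p (\<Sum>i\<in>I. fsc (k i) (f i)) = (\<Sum>i\<in>I. k i * J p (f i))" by blast
    then show ?case unfolding sum.insert[OF insert.hyps] a(2)[OF R assms(2)] s(2)[OF assms(2) fi] by simp
  next
    case (infinite I)
    show ?case unfolding sum.infinite[OF infinite(1)] by (rule z(2))
  qed (simp only: sum.empty z)
qed

text \<open>The Casimir element, the sum of the \<open>w t \<otimes> u t\<close>, is dual to the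
  form, so an operator on one side may be exchanged for its adjoint on the other: both sides expand
  to the same double sum.\<close>

lemma casimir_adjoint:
  assumes J: "rbil J" and f: "\<And>r. r \<in> R \<Longrightarrow> f r \<in> R" and g: "\<And>r. r \<in> R \<Longrightarrow> g r \<in> R"
    and adj: "\<And>r r'. r \<in> R \<Longrightarrow> r' \<in> R \<Longrightarrow> B (f r) r' = B r (g r')"
  shows "(\<Sum>t\<in>T. J (f (w t)) (u t)) = (\<Sum>t\<in>T. J (w t) (g (u t)))"
proof -
  have "J (f (w t)) (u t) = (\<Sum>q\<in>T. B (u q) (f (w t)) * J (w q) (u t))" if t: "t \<in> T" for t
  proof -
    have "J (f (w t)) (u t) = (\<Sum>q\<in>T. f (w t) q * J (w q) (u t))"
      using arg_cong[OF w_expand[OF f[OF w_R[OF t]]], of "\<lambda>r. J r (u t)"]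
        rbilD(3)[OF J u_R[OF t], of T w "f (w t)"] w_R by metis
    then show ?thesis using t by (simp add: B_u f w_R)
  qed
  then have "(\<Sum>t\<in>T. J (f (w t)) (u t)) = (\<Sum>t\<in>T. \<Sum>q\<in>T. B (u q) (f (w t)) * J (w q) (u t))" by simp
  also have "\<dots> = (\<Sum>q\<in>T. \<Sum>t\<in>T. B (g (u q)) (w t) * J (w q) (u t))"
    by (subst sum.swap) (use adj f g w_R u_R in \<open>simp add: B_sym\<close>)
  also have "\<dots> = (\<Sum>q\<in>T. J (w q) (g (u q)))"
  proof (rule sum.cong[OF refl])
    fix q assume q: "q \<in> T"
    show "(\<Sum>t\<in>T. B (g (u q)) (w t) * J (w q) (u t)) = J (w q) (g (u q))"
      using arg_cong[OF u_expand[OF g[OF u_R[OF q]]], of "J (w q)"]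
        rbilD(4)[OF J w_R[OF q], of T u "\<lambda>t. B (g (u q)) (w t)"] u_R by metis
  qed
  finally show ?thesis .
qed

text \<open>By \<open>B_adjoint\<close> the action of \<open>h2\<close> on the second factor becomes
  that of \<open>S h2\<close> on the first, and \<open>h1 S h2\<close> cancels.\<close>

lemma casimir_invariant:
  assumes J: "rbil J" and h: "h \<in> C"
  shows "sw (\<lambda>a b. \<Sum>t\<in>T. J (hit a (w t)) (hit b (u t))) h = \<epsilon> h * (\<Sum>t\<in>T. J (w t) (u t))"
proof -
  have "(\<Sum>t\<in>T. J (hit a (w t)) (hit b (u t))) = (\<Sum>t\<in>T. J (hit (a \<otimes> S b) (w t)) (u t))"
    if ab: "a \<in> C" "b \<in> C" for a b
  proof -
    have "rbil (\<lambda>r. J (hit a r))"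
      using J ab unfolding rbil_def hit_add hit_scale by (simp add: R_hit)
    from casimir_adjoint[OF this, of "hit (S b)" "hit b"]
    have "(\<Sum>t\<in>T. J (hit a (hit (S b) (w t))) (u t)) = (\<Sum>t\<in>T. J (hit a (w t)) (hit b (u t)))"
      using ab B_adjoint by (simp add: R_hit B_sym)
    then show ?thesis using ab w_R by (simp add: hit_hit)
  qed
  then have "sw (\<lambda>a b. \<Sum>t\<in>T. J (hit a (w t)) (hit b (u t))) h
    = sw (\<lambda>a b. \<Sum>t\<in>T. J (hit (a \<otimes> S b) (w t)) (u t)) h" using h by simp
  also have "\<dots> = \<epsilon> h * (\<Sum>t\<in>T. J (hit \<one> (w t)) (u t))"
  proof (rule sw_antipode(2)[OF h])
    show "lin (\<lambda>z. \<Sum>t\<in>T. J (hit z (w t)) (u t))"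
    proof (rule lin_setsum)
      fix t assume t: "t \<in> T"
      show "lin (\<lambda>z. J (hit z (w t)) (u t))"
        unfolding lin_def using t w_R u_R
        by (simp add: hit_add_arg hit_scale_arg rbilD(1,2)[OF J] R_hit)
    qed
  qed
  finally show ?thesis using w_R by (simp add: hit_one)
qed

text \<open>The product of the two Casimir factors is invariant under \<open>H\<close>, hence a
  multiple of the unit; its value at \<open>L\<close> is the trace of the identity of
  \<open>R\<close>.\<close>

lemma casimir_conv: "(\<Sum>t\<in>T. w t \<star> u t) = fsc (of_nat (card T)) eps"
proof -
  let ?c = "\<Sum>t\<in>T. w t \<star> u t"
  have cK: "?c \<in> K" using w_R u_R by simp
  show ?thesis
  proof (rule K_eqI[OF cK])
    fix x assume x: "x \<in> C"
    have "rbil (\<lambda>p q. (p \<star> q) x)"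
      unfolding rbil_def conv_add_left conv_add_right conv_scale_left conv_scale_right by simp
    from casimir_invariant[OF this L(1)]
    have "?c x = sw (\<lambda>a b. \<Sum>t\<in>T. (hit a (w t) \<star> hit b (u t)) x) L"
      using L by (simp add: hom_one)
    also have "\<dots> = (\<Sum>t\<in>T. hit L (w t \<star> u t) x)"
      using x L(1) w_R u_R by (simp add: sw_sumf hit_conv del: hit_apply)
    also have "\<dots> = ?c (s (counit H x) L)"
      using x by (simp add: L_left)
    also have "\<dots> = \<epsilon> x * ?c L" by (rule lin_scale[OF K_lin[OF cK] L(1)])
    also have "?c L = (\<Sum>t\<in>T. B (u t) (w t))"
      using w_R u_R by (simp add: B_def R_comm)
    also have "\<dots> = of_nat (card T)" by (simp add: B_u w_R w_dual)
    finally show "?c x = fsc (of_nat (card T)) eps x" using x by (simp add: eps_apply)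
  qed simp
qed

text \<open>The functionals \<open>\<theta> x\<close> vanish jointly exactly on \<open>R\<close>: they serve as coordinates of \<open>K / R\<close>.\<close>

definition \<theta> :: "'h \<Rightarrow> ('h \<Rightarrow> 'f) \<Rightarrow> 'f"
  where "\<theta> x \<phi> = \<phi> x - (\<Sum>t\<in>T. \<phi> t * w t x)"

lemma \<theta>_lin: "\<theta> x (\<phi> + \<psi>) = \<theta> x \<phi> + \<theta> x \<psi>" "\<theta> x (fsc c \<phi>) = c * \<theta> x \<phi>"
  "\<theta> x (\<Sum>i\<in>I. f i) = (\<Sum>i\<in>I. \<theta> x (f i))"
proof -
  show "\<theta> x (\<phi> + \<psi>) = \<theta> x \<phi> + \<theta> x \<psi>" "\<theta> x (fsc c \<phi>) = c * \<theta> x \<phi>" for \<phi> \<psi> c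
    by (simp_all add: \<theta>_def algebra_simps sum.distrib sum_distrib_left)
  then show "\<theta> x (\<Sum>i\<in>I. f i) = (\<Sum>i\<in>I. \<theta> x (f i))"
    by (induction I rule: infinite_finite_induct) (simp_all add: \<theta>_def sum.distrib algebra_simps)
qed

lemma \<theta>_R: "r \<in> R \<Longrightarrow> \<theta> x r = 0"
  using interpD(4)[OF w_interp] by (simp add: \<theta>_def)

lemma \<theta>_imp_R:
  assumes "\<phi> \<in> K" "\<And>x. x \<in> C \<Longrightarrow> \<theta> x \<phi> = 0"
  shows "\<phi> \<in> R"
proof -
  have "(\<Sum>t\<in>T. fsc (\<phi> t) (w t)) \<in> R" by (intro R_closed w_R)
  moreover have "\<phi> = (\<Sum>t\<in>T. fsc (\<phi> t) (w t))"
    by (rule K_eqI[OF assms(1)]) (use assms(2) w_R in \<open>simp_all add: \<theta>_def\<close>)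
  ultimately show ?thesis by (simp only:)
qed

text \<open>The derivation \<open>R \<rightarrow> K / R\<close> induced by \<open>\<delta>\<close> is the commutator with the element \<open>z\<close> below, which is
  invariant because the Casimir element is. As \<open>L\<close> maps \<open>K\<close> to the multiples of the unit, \<open>z\<close> is 0
  modulo \<open>R\<close>.\<close>

lemma derivation_zero:
  assumes add: "\<And>a b. \<delta> (a + b) = \<delta> a + \<delta> b" and mult: "\<And>a b. \<delta> (a * b) = a * \<delta> b + \<delta> a * (b :: 'f)"
    and zero: "\<And>a. \<delta> (\<iota> a) = 0" and t: "t \<in> T"
  shows "\<delta> (w t x) = 0"
proof -
  have d0: "\<delta> 0 = 0" using zero[of 0] by (simp add: hom_zero)
  have d1: "\<delta> 1 = 0" using zero[of 1] by (simp add: hom_one)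
  have dsum: "\<delta> (\<Sum>i\<in>I. f i) = (\<Sum>i\<in>I. \<delta> (f i))" for I :: "'z set" and f
    by (induction I rule: infinite_finite_induct) (simp_all add: d0 add)
  define D where "D \<phi> = (\<lambda>x. \<delta> (\<phi> x))" for \<phi> :: "'h \<Rightarrow> 'f"
  have DK: "D \<phi> \<in> K" if "\<phi> \<in> K" for \<phi>
    using K_lin[OF that] K_out[OF that] by (simp add: K_def D_def lin_def add mult zero d0)
  have Dsw: "\<delta> (sw f x) = sw (\<lambda>a b. \<delta> (f a b)) x" for f x
    unfolding sw_def ev_def by (simp add: dsum mult zero case_prod_unfold)
  have Dconv: "D (\<phi> \<star> \<psi>) = \<phi> \<star> D \<psi> + D \<phi> \<star> \<psi>" if "\<phi> \<in> K" "\<psi> \<in> K" for \<phi> \<psi>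
  proof (rule K_eqI)
    fix x assume x: "x \<in> C"
    show "D (\<phi> \<star> \<psi>) x = (\<phi> \<star> D \<psi> + D \<phi> \<star> \<psi>) x"
      using x by (simp add: D_def conv_apply Dsw mult sw_addf)
  qed (use that DK in simp_all)
  have Dhit: "D (hit h \<phi>) = hit h (D \<phi>)" for h \<phi>
    by (simp add: D_def hit_def restr_def fun_eq_iff d0)
  have Dsc: "D (fsc c \<phi>) = fsc c (D \<phi>) + fsc (\<delta> c) \<phi>" for c \<phi>
    by (simp add: D_def fun_eq_iff mult)
  have Dadd: "D (\<phi> + \<psi>) = D \<phi> + D \<psi>" for \<phi> \<psi>
    by (simp add: D_def fun_eq_iff add)
  \<comment> \<open>The term \<open>\<delta> c\<close> times \<open>p \<star> q\<close>, by which
    linearity over the larger field fails, lies in \<open>R\<close>, where \<theta>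
    vanishes.\<close>
  have bil: "rbil (\<lambda>p q. \<theta> x (p \<star> D q))" for x
    unfolding rbil_def conv_add_left conv_add_right conv_scale_left conv_scale_right Dadd Dsc \<theta>_lin
    by (simp add: \<theta>_R R_closed)
  define z where "z = (\<Sum>t\<in>T. w t \<star> D (u t))"
  have zK: "z \<in> K" unfolding z_def by (intro K_sum conv_K DK RK w_R u_R)
  have zR: "z \<in> R"
  proof (rule \<theta>_imp_R[OF zK])
    fix x assume x: "x \<in> C"
    have \<theta>h: "\<theta> x (hit L \<phi>) = 0" if "\<phi> \<in> K" for \<phi>
    proof -
      have "hit L \<phi> = fsc (\<phi> L) eps"
        by (rule K_eqI) (use that L in \<open>simp_all add: L_left lin_scale[OF K_lin[OF that]] eps_apply\<close>)
      then show ?thesis using \<theta>_R[OF R_closed(4)[OF R_eps]] by simp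
    qed
    have h: "\<theta> x (hit L (w t \<star> D (u t))) = sw (\<lambda>a b. \<theta> x (hit a (w t) \<star> D (hit b (u t)))) L"
      if t: "t \<in> T" for t
    proof -
      have *: "hit L (w t \<star> D (u t)) y = sw (\<lambda>a b. (hit a (w t) \<star> D (hit b (u t))) y) L" if "y \<in> C" for y
        unfolding Dhit by (rule hit_conv[OF L(1) that RK[OF w_R[OF t]] DK[OF RK[OF u_R[OF t]]]])
      have "hit L (w t \<star> D (u t)) p * w p x = sw (\<lambda>a b. (hit a (w t) \<star> D (hit b (u t))) p * w p x) L"
        if "p \<in> T" for p using *[of p] that TC by (simp only: sw_scalef' subset_eq)
      then show ?thesis unfolding \<theta>_def *[OF x] by (simp only: sw_difff sw_sumf cong: sum.cong)
    qed
    have "\<theta> x z = sw (\<lambda>a b. \<Sum>t\<in>T. \<theta> x (hit a (w t) \<star> D (hit b (u t)))) L"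
      using casimir_invariant[OF bil L(1)] L by (simp only: z_def \<theta>_lin hom_one mult_1)
    also have "\<dots> = (\<Sum>t\<in>T. \<theta> x (hit L (w t \<star> D (u t))))"
      unfolding sw_sumf by (intro sum.cong refl h[symmetric])
    also have "\<dots> = 0"
      by (intro sum.neutral ballI \<theta>h conv_K DK RK w_R u_R)
    finally show "\<theta> x z = 0" .
  qed
  have DR: "D r \<in> R" if r: "r \<in> R" for r
  proof (rule \<theta>_imp_R[OF DK[OF RK[OF r]]])
    fix x
    \<comment> \<open>Moving multiplication by \<open>r\<close> across the Casimir element and
      expanding \<open>D (r \<star> u t)\<close> expresses \<open>D r\<close>, times the dimension
      of \<open>R\<close>, as the commutator of \<open>r\<close> and \<open>z\<close> modulo
      \<open>R\<close>.\<close>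
    have "(\<Sum>t\<in>T. \<theta> x (r \<star> w t \<star> D (u t))) = (\<Sum>t\<in>T. \<theta> x (w t \<star> D (r \<star> u t)))"
    proof (rule casimir_adjoint[OF bil])
      show "B (r \<star> p) q = B p (r \<star> q)" if "p \<in> R" "q \<in> R" for p q
        unfolding B_def R_comm[OF r that(1)] using r that by (simp only: conv_assoc RK)
    qed (rule R_conv[OF r], assumption)+
    moreover have "r \<star> w t \<star> D (u t) = r \<star> (w t \<star> D (u t))" if "t \<in> T" for t
      by (rule conv_assoc) (intro RK r w_R u_R DK that)+
    moreover have "w t \<star> D (r \<star> u t) = (w t \<star> u t) \<star> D r + (w t \<star> D (u t)) \<star> r" if "t \<in> T" for t
    proof -
      have K: "w t \<in> K" "u t \<in> K" "D (u t) \<in> K" "D r \<in> K" "r \<in> K"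
        by (intro RK r w_R u_R DK that)+
      show ?thesis
        unfolding R_comm[OF r u_R[OF that]] using K
        by (simp only: Dconv conv_add_right conv_assoc)
    qed
    ultimately have "(\<Sum>t\<in>T. \<theta> x (r \<star> (w t \<star> D (u t))))
      = (\<Sum>t\<in>T. \<theta> x ((w t \<star> u t) \<star> D r) + \<theta> x ((w t \<star> D (u t)) \<star> r))" by (simp only: \<theta>_lin cong: sum.cong)
    also have "(\<Sum>t\<in>T. \<theta> x (r \<star> (w t \<star> D (u t)))) = \<theta> x (r \<star> z)"
      unfolding z_def conv_sum_right \<theta>_lin ..
    also have "\<dots> = 0" by (intro \<theta>_R R_closed r zR)
    also have "(\<Sum>t\<in>T. \<theta> x ((w t \<star> u t) \<star> D r) + \<theta> x ((w t \<star> D (u t)) \<star> r))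
      = \<theta> x ((\<Sum>t\<in>T. w t \<star> u t) \<star> D r) + \<theta> x (z \<star> r)"
      unfolding z_def conv_sum_left \<theta>_lin sum.distrib ..
    also have "\<theta> x (z \<star> r) = 0" by (intro \<theta>_R R_closed r zR)
    also have "(\<Sum>t\<in>T. w t \<star> u t) \<star> D r = fsc (of_nat (card T)) (D r)"
      unfolding casimir_conv conv_scale_left by (simp only: conv_eps DK[OF RK[OF r]])
    finally have "of_nat (card T) * \<theta> x (D r) = 0" by (simp only: \<theta>_lin add_0_right)
    moreover have "card T \<noteq> 0"
    proof
      assume "card T = 0"
      then have "T = {}" using T_fin by simp
      then have "eps = 0" using w_expand[OF R_eps] by simp
      then show False using eps_one by (simp only: zero_fun_apply zero_neq_one)
    qed
    then have "of_nat (card T) \<noteq> (0 :: 'f)" using char0[of "card T - 1"] by simp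
    ultimately show "\<theta> x (D r) = 0" by simp
  qed
  \<comment> \<open>The echelon form pays off: the values of \<open>w t\<close> on \<open>T\<close>
    are 0 and 1, so the element \<open>D (w t)\<close> of \<open>R\<close> vanishes on
    \<open>T\<close> and therefore everywhere.\<close>
  have "D (w t) x = (\<Sum>q\<in>T. D (w t) q * w q x)"
    using interpD(4)[OF w_interp DR[OF w_R[OF t]]] .
  also have "\<dots> = 0" using t by (intro sum.neutral) (simp add: D_def w_dual d0 d1)
  finally show ?thesis by (simp add: D_def)
qed

end

text \<open>A value of \<open>w t\<close> outside \<open>k\<close> would have a nonzero image under
  some derivation over \<open>k\<close>, contrary to \<open>derivation_zero\<close>.\<close>

theorem (in dual_module_algebra) rational_basis:
  assumes ac: "\<And>p :: 'k poly. degree p > 0 \<Longrightarrow> \<exists>x. poly p x = 0"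
  shows "\<exists>T w. T \<subseteq> C \<and> interp R T w \<and> (\<forall>t\<in>T. range (w t) \<subseteq> range \<iota>)"
proof -
  obtain T w u where d: "T \<subseteq> C" "interp R T w" "\<forall>t\<in>T. u t \<in> R \<and> (\<forall>r\<in>R. B (u t) r = r t)"
    using ex_dual_bases by blast
  interpret dual_bases H \<iota> L R T w u by unfold_locales (use d in auto)
  have "w t x \<in> range \<iota>" if t: "t \<in> T" for t x
  proof (rule ccontr)
    assume "w t x \<notin> range \<iota>"
    from ex_derivation[OF ac char0 this]
    obtain \<delta> :: "'f \<Rightarrow> 'f" where \<delta>: "\<And>x y. \<delta> (x + y) = \<delta> x + \<delta> y" "\<And>x y. \<delta> (x * y) = x * \<delta> y + \<delta> x * y"
      "\<And>a. \<delta> (\<iota> a) = 0" "\<delta> (w t x) \<noteq> 0" by blast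
    show False using derivation_zero[OF \<delta>(1,2,3) t] \<delta>(4) by blast
  qed
  then show ?thesis using d by blast
qed

section \<open>Inner faithful actions on commutative domains\<close>

locale domain_action = hopf_action H sA act
  for H :: "('k::{alg_closed_field, field_char_0}, 'h::ab_group_add) hopf" (structure)
    and sA :: "'k \<Rightarrow> 'a::idom \<Rightarrow> 'a" and act :: "'h \<Rightarrow> 'a \<Rightarrow> 'a" +
  assumes fin: "fin_dim H" and cosem: "cosemisimple H"
begin

definition emb :: "'k \<Rightarrow> 'a fract" where "emb c = to_fract (sA c 1)"

lemma emb_scale: "to_fract (sA c a) = emb c * to_fract a"
  unfolding emb_def by (simp add: A.scale_mult_left flip: to_fract_mult)

sublocale k: fd_hopf H
  by unfold_locales (auto simp: fin)

sublocale F: fd_hopf_ext H emb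
proof unfold_locales
  show "emb (a * b) = emb a * emb b" for a b
    using emb_scale[of a "sA b 1"] by (simp add: emb_def)
qed (simp_all add: emb_def A.scale_left_distrib fin)

definition \<rho> :: "'a \<Rightarrow> 'h \<Rightarrow> 'a fract" where "\<rho> a = F.restr (\<lambda>h. to_fract (act h a))"

lemma \<rho>_K: "\<rho> a \<in> F.K"
  unfolding \<rho>_def by (rule F.restr_K) (simp add: F.lin_def act_add_left act_scale_left emb_scale)

lemma to_fract_lin_ext: "to_fract (lin_ext sA f p) = F.ev (\<lambda>b. to_fract (f b)) p"
proof -
  have "to_fract (\<Sum>i\<in>I. f i) = (\<Sum>i\<in>I. to_fract (f i))" for I :: "'z set" and f :: "'z \<Rightarrow> 'a"
    by (induction I rule: infinite_finite_induct) simp_all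
  then show ?thesis by (simp add: lin_ext_def F.ev_def emb_scale)
qed

text \<open>By the module algebra axiom \<rho> is multiplicative, and \<open>R\<close> inherits
  commutativity from \<open>A\<close> through it.\<close>

lemma \<rho>_mult: "\<rho> (a * b) = F.conv (\<rho> a) (\<rho> b)"
proof (rule F.K_eqI)
  fix x assume x: "x \<in> carrier H"
  have "\<rho> (a * b) x = F.ev (\<lambda>p. to_fract (case p of (x1, x2) \<Rightarrow> act x1 a * act x2 b)) (sweedler H x)"
    using x by (simp add: \<rho>_def act_prod to_fract_lin_ext)
  also have "\<dots> = F.sw (\<lambda>p q. \<rho> a p * \<rho> b q) x"
    unfolding F.sw_def using F.sweedler_keys[OF x]
    by (intro F.ev_cong) (auto simp: \<rho>_def)
  finally show "\<rho> (a * b) x = F.conv (\<rho> a) (\<rho> b) x" using x by (simp add: F.conv_apply)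
qed (simp_all add: \<rho>_K)

lemma \<rho>_one: "\<rho> 1 = F.eps"
  by (rule F.K_eqI[OF \<rho>_K F.eps_K]) (simp add: \<rho>_def F.eps_apply act_unit emb_def)

lemma \<rho>_hit: "h \<in> carrier H \<Longrightarrow> F.hit h (\<rho> a) = \<rho> (act h a)"
  by (rule F.K_eqI) (simp_all add: \<rho>_K, simp add: \<rho>_def act_mult)

definition L :: 'h
  where "L = (SOME L. L \<in> carrier H \<and> counit H L = 1 \<and>
    (\<forall>h\<in>carrier H. L \<otimes> h = vscale H (counit H h) L \<and> h \<otimes> L = vscale H (counit H h) L))"

lemma L: "L \<in> carrier H" "counit H L = 1"
    "h \<in> carrier H \<Longrightarrow> L \<otimes> h = vscale H (counit H h) L" "h \<in> carrier H \<Longrightarrow> h \<otimes> L = vscale H (counit H h) L"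
proof -
  have "\<exists>L. L \<in> carrier H \<and> counit H L = 1 \<and>
    (\<forall>h\<in>carrier H. L \<otimes> h = vscale H (counit H h) L \<and> h \<otimes> L = vscale H (counit H h) L)"
    using cosemisimple_integral[OF hopf_algebra_axioms fin cosem] by blast
  from someI_ex[OF this, folded L_def]
  show "L \<in> carrier H" "counit H L = 1" "h \<in> carrier H \<Longrightarrow> L \<otimes> h = vscale H (counit H h) L"
    "h \<in> carrier H \<Longrightarrow> h \<otimes> L = vscale H (counit H h) L" by blast+
qed

definition R :: "('h \<Rightarrow> 'a fract) set" where "R = fv.span (range \<rho>)"

lemma \<rho>_R: "\<rho> a \<in> R"
  unfolding R_def by (rule fv.span_base) (rule rangeI)

lemma R_induct:
  assumes "r \<in> R" "fv.subspace X" "\<And>a. \<rho> a \<in> X"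
  shows "r \<in> X"
  using fv.span_minimal[of "range \<rho>" X] assms unfolding R_def by blast

sublocale F: dual_module_algebra H emb L R
proof unfold_locales
  have sub: "fv.subspace R" by (simp add: R_def)
  show "fv.subspace R" by (rule sub)
  show RK: "R \<subseteq> F.K"
    unfolding R_def by (rule fv.span_minimal[OF _ F.K_subspace]) (use \<rho>_K in blast)
  show "F.eps \<in> R" using \<rho>_R[of 1] by (simp only: \<rho>_one)
  show "of_nat (Suc n) \<noteq> (0 :: 'a fract)" for n
    using F.hom_eq_0[of "of_nat (Suc n)"] unfolding F.hom_of_nat of_nat_eq_0_iff by simp
  have 1: "F.conv r (\<rho> b) \<in> R" if "r \<in> R" for r b
  proof -
    have "r \<in> {r. F.conv r (\<rho> b) \<in> R}"
    proof (rule R_induct[OF that])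
      show "fv.subspace {r. F.conv r (\<rho> b) \<in> R}"
        using sub by (intro fv.subspaceI)
          (simp_all only: mem_Collect_eq F.conv_zero F.conv_add_left F.conv_scale_left
            fv.subspace_0 fv.subspace_add fv.subspace_scale)
      show "\<rho> a \<in> {r. F.conv r (\<rho> b) \<in> R}" for a
        using \<rho>_R[of "a * b"] by (simp only: mem_Collect_eq \<rho>_mult)
    qed
    then show ?thesis by (simp only: mem_Collect_eq)
  qed
  show "F.conv r r' \<in> R" if r: "r \<in> R" "r' \<in> R" for r r'
  proof -
    have "r' \<in> {r'. F.conv r r' \<in> R}"
    proof (rule R_induct[OF r(2)])
      show "fv.subspace {r'. F.conv r r' \<in> R}"
        using sub by (intro fv.subspaceI)
          (simp_all only: mem_Collect_eq F.conv_zero F.conv_add_right F.conv_scale_right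
            fv.subspace_0 fv.subspace_add fv.subspace_scale)
      show "\<rho> a \<in> {r'. F.conv r r' \<in> R}" for a using 1[OF r(1)] by (simp only: mem_Collect_eq)
    qed
    then show ?thesis by (simp only: mem_Collect_eq)
  qed
  have 2: "F.conv r (\<rho> b) = F.conv (\<rho> b) r" if "r \<in> R" for r b
  proof -
    have "r \<in> {r. F.conv r (\<rho> b) = F.conv (\<rho> b) r}"
    proof (rule R_induct[OF that])
      show "fv.subspace {r. F.conv r (\<rho> b) = F.conv (\<rho> b) r}"
        by (intro fv.subspaceI)
          (simp_all only: mem_Collect_eq F.conv_zero F.conv_add_left F.conv_scale_left
            F.conv_add_right F.conv_scale_right)
      show "\<rho> a \<in> {r. F.conv r (\<rho> b) = F.conv (\<rho> b) r}" for a
        by (simp only: mem_Collect_eq mult.commute flip: \<rho>_mult)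
    qed
    then show ?thesis by (simp only: mem_Collect_eq)
  qed
  show "F.conv r r' = F.conv r' r" if r: "r \<in> R" "r' \<in> R" for r r'
  proof -
    have "r' \<in> {r'. F.conv r r' = F.conv r' r}"
    proof (rule R_induct[OF r(2)])
      show "fv.subspace {r'. F.conv r r' = F.conv r' r}"
        by (intro fv.subspaceI)
          (simp_all only: mem_Collect_eq F.conv_zero F.conv_add_left F.conv_scale_left
            F.conv_add_right F.conv_scale_right)
      show "\<rho> a \<in> {r'. F.conv r r' = F.conv r' r}" for a using 2[OF r(1)] by (simp only: mem_Collect_eq)
    qed
    then show ?thesis by (simp only: mem_Collect_eq)
  qed
  show "F.hit h r \<in> R" if h: "h \<in> carrier H" and r: "r \<in> R" for h r
  proof -
    have "r \<in> {r. F.hit h r \<in> R}"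
    proof (rule R_induct[OF r])
      have "F.hit h 0 = 0" by (simp add: F.hit_def F.restr_def fun_eq_iff)
      then show "fv.subspace {r. F.hit h r \<in> R}"
        using sub by (intro fv.subspaceI)
          (simp_all only: mem_Collect_eq F.hit_add F.hit_scale
            fv.subspace_0 fv.subspace_add fv.subspace_scale)
      show "\<rho> a \<in> {r. F.hit h r \<in> R}" for a using \<rho>_R by (simp only: mem_Collect_eq \<rho>_hit[OF h])
    qed
    then show ?thesis by (simp only: mem_Collect_eq)
  qed
qed (use L in auto)

section \<open>The annihilator of the algebra is a Hopf ideal\<close>

definition I :: "'h set" where "I = {h \<in> carrier H. \<forall>a. act h a = 0}"

lemma I_R: "h \<in> carrier H \<Longrightarrow> h \<in> I \<longleftrightarrow> (\<forall>r\<in>R. r h = 0)"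
proof
  assume h: "h \<in> carrier H" "h \<in> I"
  have "r \<in> {r. r h = 0}" if "r \<in> R" for r
    by (rule R_induct[OF that]) (use h in \<open>auto simp: I_def \<rho>_def fv.subspace_def\<close>)
  then show "\<forall>r\<in>R. r h = 0" by blast
next
  assume h: "h \<in> carrier H" "\<forall>r\<in>R. r h = 0"
  have "to_fract (act h a) = 0" for a using h \<rho>_R[of a] by (auto simp: \<rho>_def)
  then show "h \<in> I" using h by (simp add: I_def)
qed

lemma act_zero: "h \<in> carrier H \<Longrightarrow> act h 0 = 0"
  using act_add_right[of h 0 0] by (metis add_0 add_cancel_right_right)

text \<open>A decomposition of \<open>H\<close> along \<open>I\<close> over \<open>k\<close>: modulo
  \<open>I\<close>, \<open>h\<close> is the combination of \<open>T\<close> with coordinates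
  \<open>\<kappa> t h\<close>. The last two clauses are what closure of \<open>R\<close> under
  products and its commutativity become over \<open>k\<close>.\<close>

definition splitting :: "'h set \<Rightarrow> ('h \<Rightarrow> 'h \<Rightarrow> 'k) \<Rightarrow> bool"
  where "splitting T \<kappa> \<longleftrightarrow> T \<subseteq> carrier H \<and> (\<forall>h\<in>carrier H. h - (\<Sum>t\<in>T. vscale H (\<kappa> t h) t) \<in> I) \<and>
    (\<forall>t\<in>T. \<forall>t'\<in>T. \<forall>h\<in>I. k.sw (\<lambda>a b. \<kappa> t a * \<kappa> t' b) h = 0) \<and>
    (\<forall>t\<in>T. \<forall>t'\<in>T. \<forall>h\<in>carrier H. k.sw (\<lambda>a b. \<kappa> t a * \<kappa> t' b) h = k.sw (\<lambda>a b. \<kappa> t' a * \<kappa> t b) h)"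

lemma splittingD:
  assumes "splitting T \<kappa>"
  shows "T \<subseteq> carrier H" "h \<in> carrier H \<Longrightarrow> h - (\<Sum>t\<in>T. vscale H (\<kappa> t h) t) \<in> I"
    "t \<in> T \<Longrightarrow> t' \<in> T \<Longrightarrow> h \<in> I \<Longrightarrow> k.sw (\<lambda>a b. \<kappa> t a * \<kappa> t' b) h = 0"
    "t \<in> T \<Longrightarrow> t' \<in> T \<Longrightarrow> h \<in> carrier H \<Longrightarrow>
      k.sw (\<lambda>a b. \<kappa> t a * \<kappa> t' b) h = k.sw (\<lambda>a b. \<kappa> t' a * \<kappa> t b) h"
  using assms unfolding splitting_def by blast+

text \<open>The coordinates are the values of the basis from \<open>rational_basis\<close>, pulled
  back along \<open>emb\<close>.\<close>

lemma ex_splitting: "\<exists>T \<kappa>. splitting T \<kappa>"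
proof -
  obtain T w where T: "T \<subseteq> carrier H" and W: "interp R T w" and rng: "\<forall>t\<in>T. range (w t) \<subseteq> range emb"
    using F.rational_basis alg_closed_imp_poly_has_root by metis
  define \<kappa> where "\<kappa> t h = inv_into UNIV emb (w t h)" for t h
  have \<kappa>: "emb (\<kappa> t h) = w t h" if "t \<in> T" for t h
    unfolding \<kappa>_def by (rule f_inv_into_f) (use rng that in blast)
  have wR: "w t \<in> R" if "t \<in> T" for t using interpD(2)[OF W that] .
  have wl: "F.lin (w t)" if "t \<in> T" for t using F.K_lin[OF F.RK[OF wR[OF that]]] .
  have swe: "emb (k.sw f x) = F.sw (\<lambda>a b. emb (f a b)) x" for f x
    by (simp add: k.sw_def F.sw_def k.ev_def F.ev_def F.hom_sum F.hom_mult case_prod_unfold)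
  have sw\<kappa>: "emb (k.sw (\<lambda>a b. \<kappa> t a * \<kappa> t' b) h) = F.conv (w t) (w t') h"
    if "t \<in> T" "t' \<in> T" "h \<in> carrier H" for t t' h
    using that by (simp only: swe F.hom_mult \<kappa> F.conv_apply)
  have "splitting T \<kappa>"
    unfolding splitting_def
  proof (intro conjI ballI)
    show "T \<subseteq> carrier H" by (rule T)
    show "h - (\<Sum>t\<in>T. vscale H (\<kappa> t h) t) \<in> I" if h: "h \<in> carrier H" for h
    proof -
      have tC: "t \<in> carrier H" if "t \<in> T" for t using T that by blast
      have hp: "(\<Sum>t\<in>T. vscale H (\<kappa> t h) t) \<in> carrier H" by (intro F.C_sum F.C_scale tC)
      have "r (h - (\<Sum>t\<in>T. vscale H (\<kappa> t h) t)) = 0" if r: "r \<in> R" for r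
      proof -
        have l: "F.lin r" using F.K_lin[OF F.RK[OF r]] .
        have "r (\<Sum>t\<in>T. vscale H (\<kappa> t h) t) = (\<Sum>t\<in>T. r t * w t h)"
          using tC by (simp add: F.lin_sum[OF l] F.lin_scale[OF l] \<kappa> mult.commute)
        also have "\<dots> = r h" using interpD(4)[OF W r, of h] by simp
        finally show ?thesis using F.lin_diff[OF l h hp] by simp
      qed
      then show ?thesis using I_R[of "h - (\<Sum>t\<in>T. vscale H (\<kappa> t h) t)"] F.C_diff[OF h hp] by blast
    qed
    show "k.sw (\<lambda>a b. \<kappa> t a * \<kappa> t' b) h = 0" if "t \<in> T" "t' \<in> T" "h \<in> I" for t t' h
    proof -
      have h: "h \<in> carrier H" using that by (simp add: I_def)
      have "F.conv (w t) (w t') h = 0" using I_R[OF h] F.R_conv wR that by blast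
      then show ?thesis using sw\<kappa>[OF that(1,2) h] F.hom_eq_0 by metis
    qed
    show "k.sw (\<lambda>a b. \<kappa> t a * \<kappa> t' b) h = k.sw (\<lambda>a b. \<kappa> t' a * \<kappa> t b) h"
      if t: "t \<in> T" "t' \<in> T" "h \<in> carrier H" for t t' h
      unfolding F.hom_inj[symmetric] sw\<kappa>[OF t] sw\<kappa>[OF t(2,1,3)] F.R_comm[OF wR[OF t(1)] wR[OF t(2)]] ..
  qed
  then show ?thesis by blast
qed

lemma hopf_ideal_I: "hopf_ideal H I"
  unfolding hopf_ideal_def
proof (intro conjI ballI)
  show "I \<subseteq> carrier H" by (auto simp: I_def)
  show "V.subspace I"
  proof (rule V.subspaceI)
    show "0 \<in> I" using act_scale_left[of \<one> 0] by (simp add: I_def)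
    show "x + y \<in> I" if "x \<in> I" "y \<in> I" for x y using that by (simp add: I_def act_add_left)
    show "vscale H c x \<in> I" if "x \<in> I" for c x using that by (simp add: I_def act_scale_left)
  qed
  show mult: "h \<otimes> x \<in> I" "x \<otimes> h \<in> I" if "x \<in> I" "h \<in> carrier H" for x h
    using that by (simp_all add: I_def act_mult act_zero)
  show "counit H x = 0" if "x \<in> I" for x
  proof -
    have "emb (counit H x) = 0" using that act_unit[of x] by (simp add: I_def emb_def)
    then show ?thesis using F.hom_eq_0 by blast
  qed
  \<comment> \<open>\<open>x\<close> acts as 0 on \<open>R\<close>, hence so does its adjoint
    \<open>S x\<close>, by nondegeneracy of the form.\<close>
  show "antipode H x \<in> I" if x: "x \<in> I" for x
  proof -
    have xC: "x \<in> carrier H" "antipode H x \<in> carrier H" using x by (simp_all add: I_def)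
    have "r (antipode H x) = 0" if r: "r \<in> R" for r
    proof -
      have "F.hit (antipode H x) r = 0"
      proof (rule F.B_nondeg[OF F.R_hit[OF xC(2) r]])
        fix r' assume r': "r' \<in> R"
        have "F.hit x r' = 0"
          by (rule F.K_eqI) (use xC r' mult[OF x] I_R in \<open>auto simp: F.C_mult\<close>)
        then have "F.B (F.hit x r') r = 0" by (simp only: F.B_zero)
        then show "F.B (F.hit (antipode H x) r) r' = 0"
          using F.B_adjoint[OF xC(1) r' r] F.B_sym[OF r' F.R_hit[OF xC(2) r]] by simp
      qed
      then have "F.hit (antipode H x) r \<one> = 0" by (simp only: zero_fun_apply)
      then show ?thesis using xC by simp
    qed
    then show ?thesis using I_R[OF xC(2)] by blast
  qed
  show "\<exists>p\<in>comult H x. Poly_Mapping.keys p \<subseteq> I \<times> carrier H \<union> carrier H \<times> I" if x: "x \<in> I" for x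
  proof -
    have xC: "x \<in> carrier H" using x by (simp add: I_def)
    obtain T \<kappa> where sp: "splitting T \<kappa>" using ex_splitting by blast
    note T = splittingD(1)[OF sp] and pI = splittingD(2)[OF sp] and z = splittingD(3)[OF sp _ _ x]
    define p where "p h = (\<Sum>t\<in>T. vscale H (\<kappa> t h) t)" for h
    have tC: "t \<in> carrier H" if "t \<in> T" for t using T that by blast
    have pC: "p h \<in> carrier H" for h unfolding p_def by (intro F.C_sum F.C_scale tC)
    \<comment> \<open>With the projection \<open>p\<close> along \<open>I\<close>,
      \<open>a \<otimes> b - p a \<otimes> p b\<close> splits into two terms with a factor in
      \<open>I\<close>. The subtracted part sums to 0 because products of the coordinates vanish on
      \<open>I\<close>.\<close>
    define q where "q = lin_ext free_scale
      (\<lambda>(a, b). Poly_Mapping.single (a - p a, b) 1 + Poly_Mapping.single (p a, b - p b) (1 :: 'k)) (sweedler H x)"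
    have "Poly_Mapping.keys q \<subseteq> I \<times> carrier H \<union> carrier H \<times> I"
      unfolding q_def lin_ext_def
    proof (rule order_trans[OF keys_sum], rule UN_least)
      fix y assume "y \<in> Poly_Mapping.keys (sweedler H x)"
      then obtain a b where ab: "y = (a, b)" "a \<in> carrier H" "b \<in> carrier H" using F.sweedler_keys[OF xC] by blast
      let ?q = "Poly_Mapping.single (a - p a, b) 1 + Poly_Mapping.single (p a, b - p b) (1 :: 'k)"
      have "Poly_Mapping.keys (free_scale c ?q) \<subseteq> Poly_Mapping.keys ?q" for c
        by (rule subsetI) (simp add: in_keys_iff)
      moreover have "Poly_Mapping.keys ?q \<subseteq> {(a - p a, b)} \<union> {(p a, b - p b)}"
        by (rule order_trans[OF Poly_Mapping.keys_add]) simp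
      moreover have "(a - p a, b) \<in> I \<times> carrier H" "(p a, b - p b) \<in> carrier H \<times> I"
        using ab pI[folded p_def] pC by blast+
      ultimately show "Poly_Mapping.keys (free_scale (Poly_Mapping.lookup (sweedler H x) y) (case y of (a, b) \<Rightarrow>
          Poly_Mapping.single (a - p a, b) 1 + Poly_Mapping.single (p a, b - p b) 1)) \<subseteq> I \<times> carrier H \<union> carrier H \<times> I"
        unfolding ab(1) prod.case by blast
    qed
    moreover have "q \<in> comult H x"
    proof (rule k.mem_comult[OF xC])
      show "Poly_Mapping.keys q \<subseteq> carrier H \<times> carrier H" using calculation by (auto simp: I_def)
      fix \<phi> \<psi> assume "\<phi> \<in> k.K" "\<psi> \<in> k.K"
      then have l: "k.lin \<phi>" "k.lin \<psi>" by (simp_all add: k.K_lin)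
      have lp: "\<phi> (p a) = (\<Sum>t\<in>T. \<kappa> t a * \<phi> t)" "\<psi> (p a) = (\<Sum>t\<in>T. \<kappa> t a * \<psi> t)" for a
        unfolding p_def using tC by (simp_all add: k.lin_sum[OF l(1)] k.lin_scale[OF l(1)]
            k.lin_sum[OF l(2)] k.lin_scale[OF l(2)])
      have "k.ev (\<lambda>(a, b). \<phi> a * \<psi> b) q
        = k.sw (\<lambda>a b. \<phi> (a - p a) * \<psi> b + \<phi> (p a) * \<psi> (b - p b)) x"
        unfolding q_def k.ev_lin_ext k.sw_def by (simp add: k.ev_add case_prod_unfold)
      also have "\<dots> = k.sw (\<lambda>a b. \<phi> a * \<psi> b - \<phi> (p a) * \<psi> (p b)) x"
        by (rule k.sw_cong[OF refl xC])
          (simp add: k.lin_diff[OF l(1) _ pC] k.lin_diff[OF l(2) _ pC] algebra_simps)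
      also have "\<dots> = k.sw (\<lambda>a b. \<phi> a * \<psi> b) x - k.sw (\<lambda>a b. \<phi> (p a) * \<psi> (p b)) x"
        by (rule k.sw_difff)
      also have "k.sw (\<lambda>a b. \<phi> (p a) * \<psi> (p b)) x
        = k.sw (\<lambda>a b. \<Sum>t\<in>T. \<Sum>t'\<in>T. (\<phi> t * \<psi> t') * (\<kappa> t a * \<kappa> t' b)) x"
        unfolding lp sum_product by (simp only: mult_ac)
      also have "\<dots> = (\<Sum>t\<in>T. \<Sum>t'\<in>T. (\<phi> t * \<psi> t') * k.sw (\<lambda>a b. \<kappa> t a * \<kappa> t' b) x)"
        unfolding k.sw_sumf k.sw_scalef ..
      also have "\<dots> = 0" using z by simp
      finally show "k.ev (\<lambda>(a, b). \<phi> a * \<psi> b) q = k.sw (\<lambda>a b. \<phi> a * \<psi> b) x" by simp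
    qed
    ultimately show ?thesis by blast
  qed
qed

text \<open>Inner faithfulness forces \<open>I = {0}\<close>, so on the carrier every functional is
  a combination of the coordinates \<open>\<kappa> t\<close>, whose products commute.\<close>

theorem conv_commute:
  assumes inner: "inner_faithful H sA act" and "\<phi> \<in> k.K" "\<psi> \<in> k.K"
  shows "k.conv \<phi> \<psi> = k.conv \<psi> \<phi>"
proof -
  have "A.span {act x a |x a. x \<in> I} \<subseteq> {0}"
    by (rule A.span_minimal) (auto simp: I_def)
  then have "A.span {act x a |x a. x \<in> I} = {0}" using A.span_zero by blast
  then have I0: "I = {0}" using inner hopf_ideal_I by (auto simp: inner_faithful_def)
  obtain T \<kappa> where sp: "splitting T \<kappa>" using ex_splitting by blast
  note T = splittingD(1)[OF sp] and pI = splittingD(2)[OF sp] and comm = splittingD(4)[OF sp]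
  have e: "\<phi> a = (\<Sum>t\<in>T. \<kappa> t a * \<phi> t)" if "a \<in> carrier H" "\<phi> \<in> k.K" for a \<phi>
  proof -
    have l: "k.lin \<phi>" using that by (simp add: k.K_lin)
    have "a = (\<Sum>t\<in>T. vscale H (\<kappa> t a) t)" using pI[OF that(1)] I0 by simp
    then have "\<phi> a = \<phi> (\<Sum>t\<in>T. vscale H (\<kappa> t a) t)" by simp
    also have "\<dots> = (\<Sum>t\<in>T. \<kappa> t a * \<phi> t)"
      using T by (simp add: k.lin_sum[OF l] k.lin_scale[OF l] subset_eq)
    finally show ?thesis .
  qed
  have c: "k.conv \<phi> \<psi> x = (\<Sum>t\<in>T. \<Sum>t'\<in>T. (\<phi> t * \<psi> t') * k.sw (\<lambda>a b. \<kappa> t a * \<kappa> t' b) x)"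
    if "x \<in> carrier H" "\<phi> \<in> k.K" "\<psi> \<in> k.K" for x \<phi> \<psi>
  proof -
    have "k.conv \<phi> \<psi> x = k.sw (\<lambda>a b. \<phi> a * \<psi> b) x" by (rule k.conv_apply[OF that(1)])
    also have "\<dots> = k.sw (\<lambda>a b. \<Sum>t\<in>T. \<Sum>t'\<in>T. (\<phi> t * \<psi> t') * (\<kappa> t a * \<kappa> t' b)) x"
    proof (rule k.sw_cong[OF refl that(1)])
      fix a b assume "a \<in> carrier H" "b \<in> carrier H"
      then have "\<phi> a * \<psi> b = (\<Sum>t\<in>T. \<kappa> t a * \<phi> t) * (\<Sum>t\<in>T. \<kappa> t b * \<psi> t)"
        using e that by metis
      then show "\<phi> a * \<psi> b = (\<Sum>t\<in>T. \<Sum>t'\<in>T. (\<phi> t * \<psi> t') * (\<kappa> t a * \<kappa> t' b))"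
        unfolding sum_product by (simp only: mult_ac)
    qed
    also have "\<dots> = (\<Sum>t\<in>T. \<Sum>t'\<in>T. (\<phi> t * \<psi> t') * k.sw (\<lambda>a b. \<kappa> t a * \<kappa> t' b) x)"
      unfolding k.sw_sumf k.sw_scalef ..
    finally show ?thesis .
  qed
  show ?thesis
  proof (rule k.K_eqI)
    fix x assume x: "x \<in> carrier H"
    have "k.conv \<phi> \<psi> x = (\<Sum>t\<in>T. \<Sum>t'\<in>T. (\<phi> t * \<psi> t') * k.sw (\<lambda>a b. \<kappa> t' a * \<kappa> t b) x)"
      unfolding c[OF x assms(2,3)] by (intro sum.cong refl arg_cong2[of _ _ _ _ "(*)"] comm x)
    also have "\<dots> = k.conv \<psi> \<phi> x"
      unfolding c[OF x assms(3,2)] by (subst sum.swap) (simp only: mult.commute)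
    finally show "k.conv \<phi> \<psi> x = k.conv \<psi> \<phi> x" .
  qed (simp_all add: assms)
qed

end

section \<open>Cocommutative cosemisimple Hopf algebras\<close>

text \<open>In a commutative \<open>K\<close> the two formulas of \<open>L_antipode\<close> compute
  the same value of the form, so the squared antipode is the identity.\<close>

lemma (in haar_integral) commutative_Q:
  assumes "\<And>\<phi> \<psi>. \<phi> \<in> K \<Longrightarrow> \<psi> \<in> K \<Longrightarrow> conv \<phi> \<psi> = conv \<psi> \<phi>" and p: "\<psi> \<in> K"
  shows "Q \<psi> = \<psi>"
proof (rule K_eqI)
  fix y assume y: "y \<in> C"
  define \<phi> where "\<phi> = restr (\<lambda>x. lam (x \<otimes> y))"
  define \<chi> where "\<chi> = restr (\<lambda>x. \<psi> (S x))"
  have K: "\<phi> \<in> K" "\<chi> \<in> K"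
    unfolding \<phi>_def \<chi>_def using y by (intro restr_K linI lam_lin K_comp[OF p]; simp)+
  have "\<psi> y = (\<chi> \<star> \<phi>) L"
    using L_antipode(2)[OF y K_lin[OF p]] by (simp add: conv_apply \<phi>_def \<chi>_def)
  also have "\<dots> = (\<phi> \<star> \<chi>) L" using assms(1) K by simp
  also have "\<dots> = \<psi> (S (S y))"
    using L_antipode(1)[OF y K_lin[OF K(2)]] y by (simp add: conv_apply \<phi>_def \<chi>_def)
  finally show "Q \<psi> y = \<psi> y" using y by (simp add: Q_apply)
qed (use p in auto)

context fd_hopf
begin

text \<open>The condition \<open>\<Delta> g = g \<otimes> g\<close> tested on products of
  functionals; \<open>grouplike_comult\<close> recovers the tensor form.\<close>

definition grouplike :: "'h set"
  where "grouplike = {g\<in>C. counit H g = 1 \<and> (\<forall>\<phi>\<in>K. \<forall>\<psi>\<in>K. (\<phi> \<star> \<psi>) g = \<phi> g * \<psi> g)}"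

lemma grouplike_C: "g \<in> grouplike \<Longrightarrow> g \<in> C"
  by (simp add: grouplike_def)

lemma grouplike_comult:
  assumes "g \<in> grouplike"
  shows "sg g g \<in> comult H g"
  by (rule mem_comult) (use assms in \<open>auto simp: grouplike_def conv_apply\<close>)

lemma grouplike_sw: "g \<in> grouplike \<Longrightarrow> blin f \<Longrightarrow> sw f g = f g g"
  using sw_rep[OF grouplike_C grouplike_comult] by simp

lemma grouplikeI:
  assumes "g \<in> C" "counit H g = 1" "\<And>f. blin f \<Longrightarrow> sw f g = f g g"
  shows "g \<in> grouplike"
  using assms by (simp add: grouplike_def conv_apply blin_mult K_lin)

lemma grouplike_one: "\<one> \<in> grouplike"
  by (rule grouplikeI) (simp_all add: counit_one sw_one)

lemma grouplike_mult:
  assumes "g \<in> grouplike" "h \<in> grouplike"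
  shows "g \<otimes> h \<in> grouplike"
proof (rule grouplikeI)
  note C = grouplike_C[OF assms(1)] grouplike_C[OF assms(2)]
  show "g \<otimes> h \<in> C" using C by simp
  show "counit H (g \<otimes> h) = 1" using assms C by (simp add: grouplike_def counit_mult)
  fix f :: "'h \<Rightarrow> 'h \<Rightarrow> 'k" assume f: "blin f"
  note l = linI blin_lin1[OF f] blin_lin2[OF f]
  have "sw f (g \<otimes> h) = sw (\<lambda>a b. sw (\<lambda>c d. f (a \<otimes> c) (b \<otimes> d)) h) g"
    using C f by (rule sw_mult)
  also have "\<dots> = sw (\<lambda>a b. f (a \<otimes> h) (b \<otimes> h)) g"
  proof (rule sw_cong[OF refl C(1)])
    fix a b assume "a \<in> C" "b \<in> C"
    then have "blin (\<lambda>c d. f (a \<otimes> c) (b \<otimes> d))" by (intro l | simp)+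
    then show "sw (\<lambda>c d. f (a \<otimes> c) (b \<otimes> d)) h = f (a \<otimes> h) (b \<otimes> h)" by (rule grouplike_sw[OF assms(2)])
  qed
  also have "\<dots> = f (g \<otimes> h) (g \<otimes> h)"
    by (rule grouplike_sw[OF assms(1)]) (use C in \<open>(intro l | simp)+\<close>)
  finally show "sw f (g \<otimes> h) = f (g \<otimes> h) (g \<otimes> h)" .
qed

lemma grouplike_antipode:
  assumes "g \<in> grouplike"
  shows "S g \<in> grouplike" "S g \<otimes> g = \<one>"
proof -
  note C = grouplike_C[OF assms]
  have e: "counit H g = 1" using assms by (simp add: grouplike_def)
  show 1: "S g \<otimes> g = \<one>"
  proof (rule separates_eq)
    fix \<phi> assume p: "\<phi> \<in> K"
    have "blin (\<lambda>a b. \<phi> (S a \<otimes> b))" by (intro linI K_comp[OF p] | simp)+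
    then show "\<phi> (S g \<otimes> g) = \<phi> \<one>"
      using sw_antipode(1)[OF C K_lin[OF p]] grouplike_sw[OF assms] e by simp
  qed (use C in auto)
  show "S g \<in> grouplike"
  proof (rule grouplikeI)
    show "counit H (S g) = 1" using counit_mult[of "S g" g] C e 1 by (simp add: counit_one)
    show "S g \<in> C" using C by simp
    fix f :: "'h \<Rightarrow> 'h \<Rightarrow> 'k" assume f: "blin f"
    note l = linI blin_lin1[OF f] blin_lin2[OF f]
    have "blin (\<lambda>a b. f (S b) (S a))" by (intro l | simp)+
    then show "sw f (S g) = f (S g) (S g)"
      using sw_comult_antipode[OF C f] grouplike_sw[OF assms] by simp
  qed
qed

end

text \<open>The basis is numbered by natural numbers because these are to be the elements of the
  group.\<close>

locale grouplike_basis = fd_hopf H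
  for H :: "('k::field, 'h::ab_group_add) hopf" (structure) +
  fixes n :: nat and e :: "nat \<Rightarrow> 'h" and c :: "nat \<Rightarrow> 'h \<Rightarrow> 'k"
  assumes e_gl: "i < n \<Longrightarrow> e i \<in> grouplike" and c_K: "i < n \<Longrightarrow> c i \<in> K"
    and c_e: "i < n \<Longrightarrow> j < n \<Longrightarrow> c i (e j) = (if i = j then 1 else 0)"
    and e_expand: "x \<in> C \<Longrightarrow> x = (\<Sum>i<n. s (c i x) (e i))"
begin

notation conv (infixl "\<star>" 70)

lemma e_C [simp]: "i < n \<Longrightarrow> e i \<in> C"
  using e_gl grouplike_C by blast

lemma e_lin:
  assumes "lin f" "x \<in> C" shows "f x = (\<Sum>i<n. c i x * f (e i))"
proof -
  have "f x = f (\<Sum>i<n. s (c i x) (e i))" using e_expand[OF assms(2)] by simp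
  also have "\<dots> = (\<Sum>i<n. c i x * f (e i))"
    by (subst lin_sum[OF assms(1)]) (simp_all add: lin_scale[OF assms(1)])
  finally show ?thesis .
qed

lemma e_inj: "i < n \<Longrightarrow> j < n \<Longrightarrow> e i = e j \<Longrightarrow> i = j"
  using c_e[of i i] c_e[of i j] by (simp split: if_splits)

text \<open>The coordinates of a grouplike element multiply like orthogonal idempotents of the field
  and add up to 1, so exactly one of them is 1.\<close>

lemma grouplike_e:
  assumes g: "g \<in> grouplike"
  shows "\<exists>i<n. g = e i"
proof -
  note gC = grouplike_C[OF g]
  have cc: "c i g * c j g = (if i = j then c i g else 0)" if ij: "i < n" "j < n" for i j
  proof -
    have "c i g * c j g = (c i \<star> c j) g" using g c_K that by (simp add: grouplike_def)
    also have "\<dots> = (\<Sum>k<n. c k g * (c i \<star> c j) (e k))"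
      by (rule e_lin[OF K_lin gC]) (use c_K ij in simp)
    also have "\<dots> = (\<Sum>k<n. if k = i then (if i = j then c i g else 0) else 0)"
    proof (rule sum.cong[OF refl])
      fix k assume "k \<in> {..<n}"
      then have k: "k < n" by simp
      have "(c i \<star> c j) (e k) = c i (e k) * c j (e k)" using e_gl[OF k] c_K ij by (simp add: grouplike_def)
      then show "c k g * (c i \<star> c j) (e k) = (if k = i then (if i = j then c i g else 0) else 0)"
        using ij k by (simp add: c_e)
    qed
    finally show ?thesis using ij by simp
  qed
  have "lin (counit H)" using lin_eps[OF hlin_intros(1)] .
  from e_lin[OF this gC] have "1 = (\<Sum>i<n. c i g)" using g e_gl by (simp add: grouplike_def)
  then have "(\<Sum>i<n. c i g) \<noteq> 0" by simp
  then obtain i where "i \<in> {..<n}" "c i g \<noteq> 0" by (rule sum.not_neutral_contains_not_neutral)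
  then have i: "i < n" "c i g \<noteq> 0" by simp_all
  have "c i g = 1" using cc[OF i(1) i(1)] i(2) by simp
  moreover have "c j g = 0" if "j < n" "j \<noteq> i" for j using cc[OF i(1) that(1)] i(2) that(2) by auto
  ultimately have cg: "c j g = (if j = i then 1 else 0)" if "j < n" for j using that by simp
  have "g = (\<Sum>j<n. s (c j g) (e j))" by (rule e_expand[OF gC])
  also have "\<dots> = (\<Sum>j<n. if j = i then e i else 0)" by (intro sum.cong refl) (auto simp: cg)
  also have "\<dots> = e i" using i(1) by simp
  finally show ?thesis using i(1) by blast
qed

definition idx :: "'h \<Rightarrow> nat" where "idx g = (SOME i. i < n \<and> e i = g)"

lemma idx: "g \<in> grouplike \<Longrightarrow> idx g < n" "g \<in> grouplike \<Longrightarrow> e (idx g) = g"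
proof -
  assume "g \<in> grouplike"
  then have "\<exists>i. i < n \<and> e i = g" using grouplike_e by metis
  from someI_ex[OF this, folded idx_def] show "idx g < n" "e (idx g) = g" by auto
qed

definition G :: "nat monoid"
  where "G = \<lparr>carrier = {..<n}, monoid.mult = (\<lambda>i j. idx (e i \<otimes> e j)), one = idx \<one>\<rparr>"

lemma G_simps [simp]: "carrier G = {..<n}" "i \<otimes>\<^bsub>G\<^esub> j = idx (e i \<otimes> e j)" "\<one>\<^bsub>G\<^esub> = idx \<one>"
  by (simp_all add: G_def)

lemma group_G: "group G"
proof (rule groupI)
  fix i j assume ij: "i \<in> carrier G" "j \<in> carrier G"
  then show "i \<otimes>\<^bsub>G\<^esub> j \<in> carrier G" using idx grouplike_mult e_gl by simp
  fix k assume k: "k \<in> carrier G"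
  show "i \<otimes>\<^bsub>G\<^esub> j \<otimes>\<^bsub>G\<^esub> k = i \<otimes>\<^bsub>G\<^esub> (j \<otimes>\<^bsub>G\<^esub> k)"
    using ij k by (simp add: idx grouplike_mult e_gl m_assoc)
next
  show "\<one>\<^bsub>G\<^esub> \<in> carrier G" using idx grouplike_one by simp
next
  fix i assume i: "i \<in> carrier G"
  have "idx (e i) = i" using i e_inj idx[OF e_gl[of i]] by simp
  then show "\<one>\<^bsub>G\<^esub> \<otimes>\<^bsub>G\<^esub> i = i" using i by (simp add: idx grouplike_one)
  show "\<exists>j\<in>carrier G. j \<otimes>\<^bsub>G\<^esub> i = \<one>\<^bsub>G\<^esub>"
    using i idx grouplike_antipode[OF e_gl[of i]] by (intro bexI[of _ "idx (S (e i))"]) simp_all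
qed

lemma inv_G: assumes "i < n" shows "inv\<^bsub>G\<^esub> i = idx (S (e i))"
  by (rule group.inv_equality[OF group_G])
    (use assms idx grouplike_antipode[OF e_gl[OF assms]] in simp_all)

definition \<Phi> :: "'h \<Rightarrow> nat \<Rightarrow>\<^sub>0 'k"
  where "\<Phi> x = (\<Sum>i<n. Poly_Mapping.single i (c i x))"

lemma lookup_\<Phi>: "Poly_Mapping.lookup (\<Phi> x) i = (if i < n then c i x else 0)"
  by (simp add: \<Phi>_def lookup_sum lookup_single when_def)

lemma \<Phi>_keys: "Poly_Mapping.keys (\<Phi> x) \<subseteq> {..<n}"
  by (auto simp: in_keys_iff lookup_\<Phi> split: if_splits)

lemma \<Phi>_add: "x \<in> C \<Longrightarrow> y \<in> C \<Longrightarrow> \<Phi> (x + y) = \<Phi> x + \<Phi> y"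
  by (rule poly_mapping_eqI) (simp add: lookup_\<Phi> lookup_add lin_add[OF K_lin[OF c_K]])

lemma \<Phi>_scale: "x \<in> C \<Longrightarrow> \<Phi> (s a x) = free_scale a (\<Phi> x)"
  by (rule poly_mapping_eqI) (simp add: lookup_\<Phi> lin_scale[OF K_lin[OF c_K]])

lemma \<Phi>_e: "i < n \<Longrightarrow> \<Phi> (e i) = Poly_Mapping.single i 1"
  by (rule poly_mapping_eqI) (auto simp: lookup_\<Phi> c_e lookup_single when_def)

lemma \<Phi>_gl: "g \<in> grouplike \<Longrightarrow> \<Phi> g = Poly_Mapping.single (idx g) 1"
  using \<Phi>_e[of "idx g"] idx by simp

lemma lin_ext_\<Phi>: "lin_ext free_scale f (\<Phi> x) = (\<Sum>i<n. free_scale (c i x) (f i))"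
proof -
  have "lin_ext free_scale f (\<Phi> x) = (\<Sum>i<n. free_scale (Poly_Mapping.lookup (\<Phi> x) i) (f i))"
    unfolding lin_ext_def by (rule sum.mono_neutral_left) (use \<Phi>_keys in \<open>auto simp: in_keys_iff\<close>)
  then show ?thesis by (simp add: lookup_\<Phi>)
qed

lemma \<Phi>_expand:
  assumes "hlin f" "x \<in> C"
  shows "\<Phi> (f x) = (\<Sum>i<n. free_scale (c i x) (\<Phi> (f (e i))))"
proof (rule poly_mapping_eqI)
  fix j
  have fC: "f y \<in> C" if "y \<in> C" for y using assms(1) that by (simp add: hlin_def)
  have "c j (f x) = (\<Sum>i<n. c i x * c j (f (e i)))" if "j < n"
    by (rule e_lin[OF lin_comp[OF K_lin[OF c_K[OF that]] assms(1)] assms(2)])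
  then show "Poly_Mapping.lookup (\<Phi> (f x)) j = Poly_Mapping.lookup (\<Sum>i<n. free_scale (c i x) (\<Phi> (f (e i)))) j"
    by (simp add: lookup_sum lookup_\<Phi>)
qed

lemma \<Phi>_bij: "bij_betw \<Phi> C {p. Poly_Mapping.keys p \<subseteq> {..<n}}"
proof (rule bij_betw_byWitness[where f' = "\<lambda>p. \<Sum>i<n. s (Poly_Mapping.lookup p i) (e i)"])
  show "\<forall>x\<in>C. (\<Sum>i<n. s (Poly_Mapping.lookup (\<Phi> x) i) (e i)) = x"
    using e_expand by (simp add: lookup_\<Phi>)
  show "\<forall>p\<in>{p. Poly_Mapping.keys p \<subseteq> {..<n}}. \<Phi> (\<Sum>i<n. s (Poly_Mapping.lookup p i) (e i)) = p"
  proof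
    fix p :: "nat \<Rightarrow>\<^sub>0 'k" assume p: "p \<in> {p. Poly_Mapping.keys p \<subseteq> {..<n}}"
    show "\<Phi> (\<Sum>i<n. s (Poly_Mapping.lookup p i) (e i)) = p"
    proof (rule poly_mapping_eqI)
      fix j
      show "Poly_Mapping.lookup (\<Phi> (\<Sum>i<n. s (Poly_Mapping.lookup p i) (e i))) j = Poly_Mapping.lookup p j"
      proof (cases "j < n")
        case True
        note l = K_lin[OF c_K[OF True]]
        have "c j (\<Sum>i<n. s (Poly_Mapping.lookup p i) (e i)) = (\<Sum>i<n. Poly_Mapping.lookup p i * c j (e i))"
          by (subst lin_sum[OF l]) (simp_all add: lin_scale[OF l])
        also have "\<dots> = (\<Sum>i<n. if i = j then Poly_Mapping.lookup p j else 0)"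
          using True by (intro sum.cong refl) (auto simp: c_e)
        finally show ?thesis using True by (simp add: lookup_\<Phi>)
      next
        case False
        then have "j \<notin> Poly_Mapping.keys p" using p by auto
        then show ?thesis using False by (simp add: lookup_\<Phi> in_keys_iff)
      qed
    qed
  qed
  show "\<Phi> ` C \<subseteq> {p. Poly_Mapping.keys p \<subseteq> {..<n}}" using \<Phi>_keys by blast
  show "(\<lambda>p. \<Sum>i<n. s (Poly_Mapping.lookup p i) (e i)) ` {p. Poly_Mapping.keys p \<subseteq> {..<n}} \<subseteq> C"
    by (rule image_subsetI) (intro C_sum C_scale e_C, erule lessThan_iff[THEN iffD1])
qed

text \<open>Both sides of the comultiplication condition are images of representatives of the
  comultiplication of \<open>H\<close> under the linear extension of \<open>\<Phi> \<otimes> \<Phi>\<close>, which preserves the relations.\<close>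

definition \<Psi> :: "(('h \<times> 'h) \<Rightarrow>\<^sub>0 'k) \<Rightarrow> ((nat \<Rightarrow>\<^sub>0 'k) \<times> (nat \<Rightarrow>\<^sub>0 'k)) \<Rightarrow>\<^sub>0 'k"
  where "\<Psi> = lin_ext free_scale (\<lambda>(a, b). Poly_Mapping.single (\<Phi> a, \<Phi> b) 1)"

lemma \<Psi>_superset:
  "finite A \<Longrightarrow> Poly_Mapping.keys p \<subseteq> A \<Longrightarrow>
    \<Psi> p = (\<Sum>(a, b)\<in>A. free_scale (Poly_Mapping.lookup p (a, b)) (Poly_Mapping.single (\<Phi> a, \<Phi> b) 1))"
  unfolding \<Psi>_def lin_ext_def case_prod_unfold
  by (rule sum.mono_neutral_cong_left) (auto simp: in_keys_iff)

lemma \<Psi>_add: "\<Psi> (p + q) = \<Psi> p + \<Psi> q"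
proof -
  have "Poly_Mapping.keys (p + q) \<subseteq> Poly_Mapping.keys p \<union> Poly_Mapping.keys q" by (rule keys_add)
  then show ?thesis
    by (simp add: \<Psi>_superset[of "Poly_Mapping.keys p \<union> Poly_Mapping.keys q"] lookup_add
        fr.scale_left_distrib sum.distrib case_prod_unfold)
qed

lemma \<Psi>_scale: "\<Psi> (free_scale a p) = free_scale a (\<Psi> p)"
proof -
  have "Poly_Mapping.keys (free_scale a p) \<subseteq> Poly_Mapping.keys p" by (auto simp: in_keys_iff)
  then show ?thesis
    by (simp add: \<Psi>_superset[of "Poly_Mapping.keys p"] fr.scale_sum_right case_prod_unfold)
qed

lemma \<Psi>_diff: "\<Psi> (p - q) = \<Psi> p - \<Psi> q"
  using \<Psi>_add[of "p - q" q] by simp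

lemma \<Psi>_zero: "\<Psi> 0 = 0"
  using \<Psi>_diff[of 0 0] by simp

lemma \<Psi>_sum: "\<Psi> (\<Sum>i\<in>I. f i) = (\<Sum>i\<in>I. \<Psi> (f i))"
  by (induction I rule: infinite_finite_induct) (simp_all add: \<Psi>_add \<Psi>_zero)

lemma \<Psi>_single: "\<Psi> (Poly_Mapping.single (a, b) k) = Poly_Mapping.single (\<Phi> a, \<Phi> b) k"
proof -
  have "\<Psi> (Poly_Mapping.single (a, b) k) = free_scale k (Poly_Mapping.single (\<Phi> a, \<Phi> b) 1)"
    by (simp add: \<Psi>_superset[of "{(a, b)}"])
  also have "\<dots> = Poly_Mapping.single (\<Phi> a, \<Phi> b) k"
    by (rule poly_mapping_eqI) (simp add: lookup_single when_def)
  finally show ?thesis .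
qed

lemma \<Psi>_rel:
  assumes "p \<in> R2"
  shows "\<Psi> p \<in> tensor2_relations free_scale {p. Poly_Mapping.keys p \<subseteq> {..<n}}"
proof -
  let ?L = "{p :: nat \<Rightarrow>\<^sub>0 'k. Poly_Mapping.keys p \<subseteq> {..<n}}"
  let ?T = "\<Union>y\<in>?L. slot_relations free_scale ?L (\<lambda>x. (x, y)) \<union> slot_relations free_scale ?L (\<lambda>x. (y, x))"
  have L: "\<Phi> x \<in> ?L" for x using \<Phi>_keys by blast
  have "R2 \<subseteq> {p. \<Psi> p \<in> fr.span ?T}"
    unfolding tensor2_relations_def
  proof (rule fr.span_minimal)
    show "fr.subspace {p. \<Psi> p \<in> fr.span ?T}"
      by (rule fr.subspaceI) (simp_all only: mem_Collect_eq \<Psi>_zero \<Psi>_add \<Psi>_scale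
          fr.span_zero fr.span_add fr.span_scale)
    have "\<Psi> p \<in> slot_relations free_scale ?L (\<lambda>x. (x, \<Phi> y))"
      if "y \<in> C" "p \<in> slot_relations s C (\<lambda>x. (x, y))" for p y
      using that(2) unfolding slot_relations_def
    proof (elim UnE CollectE exE conjE)
      fix u v assume "p = Poly_Mapping.single (u + v, y) 1 - Poly_Mapping.single (u, y) 1 - Poly_Mapping.single (v, y) 1"
        "u \<in> C" "v \<in> C"
      then show "\<Psi> p \<in> {Poly_Mapping.single (x + z, \<Phi> y) 1 - Poly_Mapping.single (x, \<Phi> y) 1 - Poly_Mapping.single (z, \<Phi> y) 1 |x z. x \<in> ?L \<and> z \<in> ?L} \<union>
          {Poly_Mapping.single (free_scale c x, \<Phi> y) 1 - Poly_Mapping.single (x, \<Phi> y) c |c x. x \<in> ?L}"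
        using L by (intro UnI1 CollectI exI[of _ "\<Phi> u"] exI[of _ "\<Phi> v"]) (simp only: \<Psi>_diff \<Psi>_single \<Phi>_add simp_thms)
    next
      fix a u assume "p = Poly_Mapping.single (s a u, y) 1 - Poly_Mapping.single (u, y) a" "u \<in> C"
      then show "\<Psi> p \<in> {Poly_Mapping.single (x + z, \<Phi> y) 1 - Poly_Mapping.single (x, \<Phi> y) 1 - Poly_Mapping.single (z, \<Phi> y) 1 |x z. x \<in> ?L \<and> z \<in> ?L} \<union>
          {Poly_Mapping.single (free_scale c x, \<Phi> y) 1 - Poly_Mapping.single (x, \<Phi> y) c |c x. x \<in> ?L}"
        using L by (intro UnI2 CollectI exI[of _ a] exI[of _ "\<Phi> u"]) (simp only: \<Psi>_diff \<Psi>_single \<Phi>_scale simp_thms)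
    qed
    moreover have "\<Psi> p \<in> slot_relations free_scale ?L (\<lambda>x. (\<Phi> y, x))"
      if "y \<in> C" "p \<in> slot_relations s C (\<lambda>x. (y, x))" for p y
      using that(2) unfolding slot_relations_def
    proof (elim UnE CollectE exE conjE)
      fix u v assume "p = Poly_Mapping.single (y, u + v) 1 - Poly_Mapping.single (y, u) 1 - Poly_Mapping.single (y, v) 1"
        "u \<in> C" "v \<in> C"
      then show "\<Psi> p \<in> {Poly_Mapping.single (\<Phi> y, x + z) 1 - Poly_Mapping.single (\<Phi> y, x) 1 - Poly_Mapping.single (\<Phi> y, z) 1 |x z. x \<in> ?L \<and> z \<in> ?L} \<union>
          {Poly_Mapping.single (\<Phi> y, free_scale c x) 1 - Poly_Mapping.single (\<Phi> y, x) c |c x. x \<in> ?L}"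
        using L by (intro UnI1 CollectI exI[of _ "\<Phi> u"] exI[of _ "\<Phi> v"]) (simp only: \<Psi>_diff \<Psi>_single \<Phi>_add simp_thms)
    next
      fix a u assume "p = Poly_Mapping.single (y, s a u) 1 - Poly_Mapping.single (y, u) a" "u \<in> C"
      then show "\<Psi> p \<in> {Poly_Mapping.single (\<Phi> y, x + z) 1 - Poly_Mapping.single (\<Phi> y, x) 1 - Poly_Mapping.single (\<Phi> y, z) 1 |x z. x \<in> ?L \<and> z \<in> ?L} \<union>
          {Poly_Mapping.single (\<Phi> y, free_scale c x) 1 - Poly_Mapping.single (\<Phi> y, x) c |c x. x \<in> ?L}"
        using L by (intro UnI2 CollectI exI[of _ a] exI[of _ "\<Phi> u"]) (simp only: \<Psi>_diff \<Psi>_single \<Phi>_scale simp_thms)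
    qed
    ultimately have sl: "\<Psi> p \<in> slot_relations free_scale ?L (\<lambda>x. (x, \<Phi> y)) \<union> slot_relations free_scale ?L (\<lambda>x. (\<Phi> y, x))"
      if "y \<in> C" "p \<in> slot_relations s C (\<lambda>x. (x, y)) \<union> slot_relations s C (\<lambda>x. (y, x))" for y p
      using that by blast
    show "(\<Union>y\<in>C. slot_relations s C (\<lambda>x. (x, y)) \<union> slot_relations s C (\<lambda>x. (y, x)))
        \<subseteq> {p. \<Psi> p \<in> fr.span ?T}"
      by (rule UN_least, rule subsetI, rule CollectI, rule fr.span_base, rule UN_I[OF L], rule sl)
  qed
  then show ?thesis using assms unfolding tensor2_relations_def by blast
qed

lemma comult_e:
  assumes x: "x \<in> C"
  shows "(\<Sum>i<n. free_scale (c i x) (sg (e i) (e i))) \<in> comult H x"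
proof (rule mem_comult[OF x])
  let ?q = "\<Sum>i<n. free_scale (c i x) (sg (e i) (e i))"
  show "Poly_Mapping.keys ?q \<subseteq> C \<times> C"
  proof (rule order_trans[OF keys_sum], rule UN_least)
    fix i assume "i \<in> {..<n}"
    then have "e i \<in> C" by simp
    moreover have "Poly_Mapping.keys (free_scale (c i x) (sg (e i) (e i))) \<subseteq> {(e i, e i)}"
      by (auto simp: in_keys_iff lookup_single when_def split: if_splits)
    ultimately show "Poly_Mapping.keys (free_scale (c i x) (sg (e i) (e i))) \<subseteq> C \<times> C" by blast
  qed
  fix \<phi> \<psi> assume p: "\<phi> \<in> K" "\<psi> \<in> K"
  have "sw (\<lambda>a b. \<phi> a * \<psi> b) x = (\<Sum>i<n. c i x * sw (\<lambda>a b. \<phi> a * \<psi> b) (e i))"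
    by (rule e_lin[OF sw_lin[OF blin_mult] x]) (use p in \<open>simp_all add: K_lin\<close>)
  also have "\<dots> = (\<Sum>i<n. c i x * (\<phi> (e i) * \<psi> (e i)))"
    by (intro sum.cong refl) (simp add: grouplike_sw[OF e_gl] blin_mult K_lin p)
  also have "\<dots> = ev (\<lambda>(a, b). \<phi> a * \<psi> b) ?q"
    by (simp add: ev_sum ev_scale)
  finally show "ev (\<lambda>(a, b). \<phi> a * \<psi> b) ?q = sw (\<lambda>a b. \<phi> a * \<psi> b) x" ..
qed

theorem iso_group_algebra: "\<Phi> \<in> hopf_iso H (group_algebra G)"
proof -
  let ?L = "{p :: nat \<Rightarrow>\<^sub>0 'k. Poly_Mapping.keys p \<subseteq> {..<n}}"
  have mult: "\<Phi> (x \<otimes> y) = lin_ext free_scale (\<lambda>g. lin_ext free_scale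
      (\<lambda>h. Poly_Mapping.single (g \<otimes>\<^bsub>G\<^esub> h) 1) (\<Phi> y)) (\<Phi> x)" if xy: "x \<in> C" "y \<in> C" for x y
  proof -
    have "\<Phi> (x \<otimes> y) = (\<Sum>i<n. free_scale (c i x) (\<Phi> (e i \<otimes> y)))"
      by (rule \<Phi>_expand) (use xy in \<open>intro linI | simp\<close>)+
    also have "\<dots> = (\<Sum>i<n. free_scale (c i x) (\<Sum>j<n. free_scale (c j y) (\<Phi> (e i \<otimes> e j))))"
      by (intro sum.cong refl arg_cong[of _ _ "free_scale _"] \<Phi>_expand) (use xy in \<open>(intro linI | simp)+\<close>)
    also have "\<dots> = (\<Sum>i<n. free_scale (c i x) (\<Sum>j<n. free_scale (c j y) (Poly_Mapping.single (i \<otimes>\<^bsub>G\<^esub> j) 1)))"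
      by (intro sum.cong refl arg_cong[of _ _ "free_scale _"]) (simp add: \<Phi>_gl grouplike_mult e_gl)
    finally show ?thesis by (simp only: lin_ext_\<Phi>)
  qed
  have comult: "tensor2_class free_scale ?L (lin_ext free_scale
        (\<lambda>g. Poly_Mapping.single (Poly_Mapping.single g 1, Poly_Mapping.single g 1) 1) (\<Phi> x))
      = tensor2_class free_scale ?L (\<Psi> (sweedler H x))" if x: "x \<in> C" for x
  proof -
    let ?q = "\<Sum>i<n. free_scale (c i x) (sg (e i) (e i))"
    have q: "\<Psi> ?q = lin_ext free_scale
        (\<lambda>g. Poly_Mapping.single (Poly_Mapping.single g 1, Poly_Mapping.single g 1) 1) (\<Phi> x)"
      by (simp add: lin_ext_\<Phi> \<Psi>_sum \<Psi>_scale \<Psi>_single \<Phi>_e)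
    have "?q \<in> tensor2_class s C (sweedler H x)"
      using comult_e[OF x] comult_class[OF x sweedler_in[OF x]] by simp
    then have "?q - sweedler H x \<in> R2" by (simp add: tensor2_class_def)
    from \<Psi>_rel[OF this] have d: "\<Psi> ?q - \<Psi> (sweedler H x) \<in> tensor2_relations free_scale ?L"
      by (simp only: \<Psi>_diff)
    have sb: "fr.subspace (tensor2_relations free_scale ?L)"
      by (simp add: tensor2_relations_def)
    have "r - \<Psi> ?q \<in> tensor2_relations free_scale ?L \<longleftrightarrow> r - \<Psi> (sweedler H x) \<in> tensor2_relations free_scale ?L" for r
      using fr.subspace_add[OF sb _ d, of "r - \<Psi> ?q"] fr.subspace_diff[OF sb _ d, of "r - \<Psi> (sweedler H x)"] by auto
    then show ?thesis unfolding q[symmetric] tensor2_class_def by blast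
  qed
  have counit: "lin_ext (*) (\<lambda>g. 1) (\<Phi> x) = counit H x" if x: "x \<in> C" for x
  proof -
    have "lin_ext (*) (\<lambda>g. 1) (\<Phi> x) = (\<Sum>i<n. Poly_Mapping.lookup (\<Phi> x) i * 1)"
      unfolding lin_ext_def by (rule sum.mono_neutral_left) (use \<Phi>_keys in \<open>auto simp: in_keys_iff\<close>)
    also have "\<dots> = (\<Sum>i<n. c i x * counit H (e i))"
      using e_gl by (intro sum.cong refl) (simp add: lookup_\<Phi> grouplike_def)
    also have "\<dots> = counit H x" by (rule e_lin[OF lin_eps[OF hlin_intros(1)] x, symmetric])
    finally show ?thesis .
  qed
  have antipode: "\<Phi> (S x) = lin_ext free_scale (\<lambda>g. Poly_Mapping.single (inv\<^bsub>G\<^esub> g) 1) (\<Phi> x)"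
    if x: "x \<in> C" for x
  proof -
    have "\<Phi> (S x) = (\<Sum>i<n. free_scale (c i x) (\<Phi> (S (e i))))"
      by (rule \<Phi>_expand[OF _ x]) (intro linI)
    also have "\<dots> = (\<Sum>i<n. free_scale (c i x) (Poly_Mapping.single (inv\<^bsub>G\<^esub> i) 1))"
      by (intro sum.cong refl) (simp add: \<Phi>_gl grouplike_antipode e_gl inv_G)
    finally show ?thesis by (simp only: lin_ext_\<Phi>)
  qed
  have c: "carrier (group_algebra G) = ?L" by (simp add: group_algebra_def)
  show ?thesis
    unfolding hopf_iso_def mem_Collect_eq c
  proof (intro conjI ballI allI)
    show "bij_betw \<Phi> C ?L" by (rule \<Phi>_bij)
  qed (simp_all add: group_algebra_def \<Phi>_add \<Phi>_scale \<Phi>_gl grouplike_one mult comult[unfolded \<Psi>_def] counit antipode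
      del: G_simps(2))
qed

end

text \<open>With \<open>Q\<close> trivial and \<open>K\<close> commutative, every corner
  \<open>K p\<close> is one-dimensional, so \<open>K\<close> acts on it by a character. Characters
  of the dual are evaluations at grouplike elements, and \<open>P\<close> itself is the dual
  basis.\<close>

lemma (in haar_order) ex_grouplike_basis:
  assumes comm: "\<And>\<phi> \<psi>. \<phi> \<in> K \<Longrightarrow> \<psi> \<in> K \<Longrightarrow> conv \<phi> \<psi> = conv \<psi> \<phi>"
  shows "\<exists>n e c. grouplike_basis H n e c"
proof -
  have Qid: "Q \<psi> = \<psi>" if "\<psi> \<in> K" for \<psi> using commutative_Q[OF comm that] .
  have "\<exists>a. \<phi> \<star> p = fsc a p" if p: "p \<in> P" and \<phi>: "\<phi> \<in> K" for \<phi> p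
  proof (rule corner_scalar[OF p])
    note pK = PD(2)[OF p]
    have 1: "\<phi> \<star> p \<star> p = \<phi> \<star> p" using conv_assoc[OF \<phi> pK pK] PD(5)[OF p] by simp
    then have "p \<star> (\<phi> \<star> p) = \<phi> \<star> p" using comm[OF pK conv_K[OF \<phi> pK]] by simp
    then show "\<phi> \<star> p \<in> B p p 1" using 1 \<phi> pK unfolding B_def by (simp add: Qid)
  qed
  then obtain \<chi> where \<chi>: "\<And>\<phi> p. p \<in> P \<Longrightarrow> \<phi> \<in> K \<Longrightarrow> \<phi> \<star> p = fsc (\<chi> p \<phi>) p" by metis
  have uniq: "a = b" if "p \<in> P" "fsc a p = fsc b p" for a b p
    using that(2) PD(4)[OF that(1)] by (simp only: fv.scale_cancel_right simp_thms)
  obtain T w where T: "T \<subseteq> C" and I: "interp K T w" using K_interp by blast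
  have tC: "t \<in> C" if "t \<in> T" for t using T that by blast
  \<comment> \<open>The vector at which evaluation is the character \<open>\<chi> p\<close>,
    assembled from the values of the character on the basis \<open>w\<close>.\<close>
  define g where "g p = (\<Sum>t\<in>T. s (\<chi> p (w t)) t)" for p
  have gC: "g p \<in> C" for p unfolding g_def by (intro C_sum C_scale tC)
  have g: "\<phi> \<star> p = fsc (\<phi> (g p)) p" if p: "p \<in> P" and \<phi>: "\<phi> \<in> K" for \<phi> p
  proof -
    have "\<phi> \<star> p = (\<Sum>t\<in>T. fsc (\<phi> t) (w t)) \<star> p"
      using interp_expand[OF I \<phi>] by (rule arg_cong)
    also have "\<dots> = (\<Sum>t\<in>T. fsc (\<phi> t) (fsc (\<chi> p (w t)) p))"
      unfolding conv_sum_left conv_scale_left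
      by (intro sum.cong refl arg_cong[of _ _ "fsc _"] \<chi>[OF p] interpD(2)[OF I])
    also have "\<dots> = fsc (\<Sum>t\<in>T. \<phi> t * \<chi> p (w t)) p"
      by (simp only: fv.scale_sum_left fv.scale_scale)
    also have "(\<Sum>t\<in>T. \<phi> t * \<chi> p (w t)) = \<phi> (g p)"
      unfolding g_def
      by (subst lin_sum[OF K_lin[OF \<phi>]]) (use tC in \<open>simp_all add: lin_scale[OF K_lin[OF \<phi>]] mult.commute\<close>)
    finally show ?thesis .
  qed
  have gg: "g p \<in> grouplike" if p: "p \<in> P" for p
    unfolding grouplike_def
  proof (intro CollectI conjI ballI)
    show "g p \<in> C" by (rule gC)
    have "fsc (eps (g p)) p = fsc 1 p"
      using g[OF p eps_K] PD(2)[OF p] by simp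
    then show "counit H (g p) = 1" using uniq[OF p] gC by (metis eps_apply)
    fix \<phi> \<psi> assume K: "\<phi> \<in> K" "\<psi> \<in> K"
    have "fsc ((\<phi> \<star> \<psi>) (g p)) p = \<phi> \<star> \<psi> \<star> p" by (rule g[OF p conv_K[OF K], symmetric])
    also have "\<dots> = \<phi> \<star> (\<psi> \<star> p)" by (rule conv_assoc[OF K PD(2)[OF p]])
    also have "\<dots> = fsc (\<phi> (g p) * \<psi> (g p)) p"
      unfolding g[OF p K(2)] conv_scale_right g[OF p K(1)] by (simp add: mult.commute)
    finally show "(\<phi> \<star> \<psi>) (g p) = \<phi> (g p) * \<psi> (g p)" by (rule uniq[OF p])
  qed
  have pg: "q (g p) = (if q = p then 1 else 0)" if "p \<in> P" "q \<in> P" for p q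
  proof (rule uniq[OF that(1)])
    have "fsc (q (g p)) p = q \<star> p" using g[OF that(1) PD(2)[OF that(2)]] ..
    also have "\<dots> = fsc (if q = p then 1 else 0) p" using PD(5,7) that by simp
    finally show "fsc (q (g p)) p = fsc (if q = p then 1 else 0) p" .
  qed
  have ex: "x = (\<Sum>p\<in>P. s (p x) (g p))" if x: "x \<in> C" for x
  proof (rule separates_eq[OF x])
    show "(\<Sum>p\<in>P. s (p x) (g p)) \<in> C" by (intro C_sum C_scale gC)
    fix \<phi> assume \<phi>: "\<phi> \<in> K"
    have "\<phi> = \<phi> \<star> (\<Sum>p\<in>P. p)" using PD(8) conv_eps(2)[OF \<phi>] by simp
    also have "\<dots> = (\<Sum>p\<in>P. fsc (\<phi> (g p)) p)"
      unfolding conv_sum_right by (intro sum.cong refl g \<phi>)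
    finally have "\<phi> x = (\<Sum>p\<in>P. fsc (\<phi> (g p)) p) x" by (rule fun_cong)
    also have "\<dots> = (\<Sum>p\<in>P. p x * \<phi> (g p))" by (simp add: mult.commute)
    also have "\<dots> = \<phi> (\<Sum>p\<in>P. s (p x) (g p))"
      using gC by (subst lin_sum[OF K_lin[OF \<phi>]]) (simp_all add: lin_scale[OF K_lin[OF \<phi>]])
    finally show "\<phi> x = \<phi> (\<Sum>p\<in>P. s (p x) (g p))" .
  qed
  obtain h where h: "bij_betw h {..<card P} P"
    using ex_bij_betw_nat_finite[OF PD(1)] by (auto simp: atLeast0LessThan)
  have hP: "h i \<in> P" if "i < card P" for i using h that by (auto simp: bij_betw_def)
  have "grouplike_basis H (card P) (\<lambda>i. g (h i)) h"
  proof unfold_locales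
    show "g (h i) \<in> grouplike" if "i < card P" for i using gg[OF hP[OF that]] .
    show "h i \<in> K" if "i < card P" for i using PD(2)[OF hP[OF that]] .
    show "h i (g (h j)) = (if i = j then 1 else 0)" if "i < card P" "j < card P" for i j
      using pg[OF hP[OF that(2)] hP[OF that(1)]] that h by (auto simp: bij_betw_def inj_on_def)
    show "x = (\<Sum>i<card P. s (h i x) (g (h i)))" if "x \<in> C" for x
      using ex[OF that] sum.reindex_bij_betw[OF h, of "\<lambda>p. s (p x) (g p)"] by simp
  qed
  then show ?thesis by blast
qed

theorem theorem1p3:
  fixes H :: "('k::{alg_closed_field, field_char_0}, 'h::ab_group_add) hopf"
    and sA :: "'k \<Rightarrow> 'a::idom \<Rightarrow> 'a"
    and act :: "'h \<Rightarrow> 'a \<Rightarrow> 'a"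
  assumes "hopf_algebra H"
    and "fin_dim H"
    and "cosemisimple H"
    and "hopf_action H sA act"
    and "inner_faithful H sA act"
  shows "\<exists>G :: nat monoid. group G \<and> finite (carrier G) \<and> hopf_isomorphic H (group_algebra G)"
proof -
  interpret action: domain_action H sA act
    by (intro domain_action.intro domain_action_axioms.intro assms)
  note comm = action.conv_commute[OF assms(5)]
  obtain lam where lam: "haar H lam" using action.k.ex_haar[OF assms(3)] by blast
  interpret haar H lam by (rule lam)
  obtain L where "L \<in> carrier H" "\<And>y. y \<in> carrier H \<Longrightarrow> lam (L \<otimes>\<^bsub>H\<^esub> y) = counit H y"
    "\<And>h. h \<in> carrier H \<Longrightarrow> L \<otimes>\<^bsub>H\<^esub> h = vscale H (counit H h) L"
    using ex_integral by blast
  then interpret haar_ac H lam L by unfold_locales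
  \<comment> \<open>Order 1 suffices here: commutativity of \<open>K\<close> makes \<open>Q\<close>
    trivial.\<close>
  interpret haar_order H lam L 1
    by unfold_locales (simp_all add: commutative_Q[OF comm])
  obtain n e c where "grouplike_basis H n e c" using ex_grouplike_basis[OF comm] by blast
  then interpret basis: grouplike_basis H n e c .
  show ?thesis
    using basis.group_G basis.iso_group_algebra
    by (intro exI[of _ basis.G]) (auto simp: hopf_isomorphic_def)
qed

end
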